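(* There exists a bounded linear operator $T\colon S\to S$ which is strictly singular and not compact.
   Context: All Banach spaces are over $\mathbb{R}$. An operator is strictly singular if no restriction of it to an infinite dimensional subspace is an isomorphism onto its image. $c_{00}$ is the space of finitely supported real sequences with unit vector basis $(e_i)$. For $E\subset\mathbb{N}$ and $x=\sum x_ie_i\in c_{00}$, $E(x)=Ex=\sum_{i\in E}x_ie_i$. For finite sets $E,F\subset\mathbb{N}$, $E<F$ means $\max E<\min F$ ($\max\emptyset=0$, $\min\emptyset=\infty$; chains $E_1<\dots<E_n$ are understood pairwise). Let $f(x)=\log_2(x+1)$. The space $S$ is the completion of $(c_{00},\|\cdot\|_S)$, where $\|\cdot\|_S$ is the unique norm on $c_{00}$ satisfying $$\|x\|_S=\max\Big\{\|x\|_{\ell_\infty},\ \sup_{2\le n\in\mathbb{N},\ E_1<E_2<\cdots<E_n}\frac1{f(n)}\sum_{j=1}^n\|E_jx\|_S\Big\}.$$ *)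

theory Defs
  imports "HOL-Analysis.Analysis"
begin

section \<open>The space of finitely supported real sequences\<close>

text \<open>Coordinates are indexed by the type \<^typ>\<open>nat\<close>, i.e. from 0 instead of from 1. Nothing
  below depends on the index itself, only on the order of the indices.\<close>

typedef c00 = "{x :: nat \<Rightarrow> real. finite {i. x i \<noteq> 0}}"
  morphisms coord Abs_c00
  by (rule exI[of _ "\<lambda>_. 0"]) simp

setup_lifting type_definition_c00

instantiation c00 :: real_vector
begin

lift_definition zero_c00 :: c00 is "\<lambda>_. 0" by simp

lift_definition plus_c00 :: "c00 \<Rightarrow> c00 \<Rightarrow> c00" is "\<lambda>x y i. x i + y i"
proof -
  fix x y :: "nat \<Rightarrow> real"
  assume "finite {i. x i \<noteq> 0}" "finite {i. y i \<noteq> 0}"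
  then have "finite ({i. x i \<noteq> 0} \<union> {i. y i \<noteq> 0})" by simp
  then show "finite {i. x i + y i \<noteq> 0}" by (rule rev_finite_subset) auto
qed

lift_definition uminus_c00 :: "c00 \<Rightarrow> c00" is "\<lambda>x i. - x i" by simp

lift_definition minus_c00 :: "c00 \<Rightarrow> c00 \<Rightarrow> c00" is "\<lambda>x y i. x i - y i"
proof -
  fix x y :: "nat \<Rightarrow> real"
  assume "finite {i. x i \<noteq> 0}" "finite {i. y i \<noteq> 0}"
  then have "finite ({i. x i \<noteq> 0} \<union> {i. y i \<noteq> 0})" by simp
  then show "finite {i. x i - y i \<noteq> 0}" by (rule rev_finite_subset) auto
qed

lift_definition scaleR_c00 :: "real \<Rightarrow> c00 \<Rightarrow> c00" is "\<lambda>a x i. a * x i"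
  by (erule rev_finite_subset) auto

instance
  by standard (transfer; simp add: algebra_simps fun_eq_iff)+

end

lift_definition restr :: "nat set \<Rightarrow> c00 \<Rightarrow> c00" is "\<lambda>E x i. if i \<in> E then x i else 0"
  by (erule rev_finite_subset) auto

section \<open>The norm of Schlumprecht's space\<close>

definition slog :: "real \<Rightarrow> real" where
  "slog x = log 2 (x + 1)"

text \<open>Here \<open>E < F\<close> reads as \<open>max E < min F\<close>, and it holds trivially if \<open>E\<close> or \<open>F\<close> is empty.\<close>

definition set_less :: "nat set \<Rightarrow> nat set \<Rightarrow> bool" where
  "set_less E F \<longleftrightarrow> (\<forall>a\<in>E. \<forall>b\<in>F. a < b)"

definition successive :: "nat \<Rightarrow> (nat \<Rightarrow> nat set) \<Rightarrow> bool" where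
  "successive n E \<longleftrightarrow>
     (\<forall>j\<in>{1..n}. finite (E j)) \<and> (\<forall>i\<in>{1..n}. \<forall>j\<in>{1..n}. i < j \<longrightarrow> set_less (E i) (E j))"

definition is_norm :: "('a::real_vector \<Rightarrow> real) \<Rightarrow> bool" where
  "is_norm N \<longleftrightarrow>
     (\<forall>x. 0 \<le> N x) \<and> (\<forall>x. N x = 0 \<longleftrightarrow> x = 0) \<and>
     (\<forall>x y. N (x + y) \<le> N x + N y) \<and> (\<forall>a x. N (a *\<^sub>R x) = \<bar>a\<bar> * N x)"

text \<open>The suprema are taken in the extended reals, so that the equation also says that the
  suprema are finite.\<close>

definition schlumprecht_eq :: "(c00 \<Rightarrow> real) \<Rightarrow> bool" where
  "schlumprecht_eq N \<longleftrightarrow>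
     (\<forall>x. ereal (N x) =
        max (SUP i. ereal \<bar>coord x i\<bar>)
            (SUP (n, E) \<in> {(n, E). 2 \<le> n \<and> successive n E}.
               ereal (1 / slog (real n) * (\<Sum>j=1..n. N (restr (E j) x)))))"

definition normS :: "c00 \<Rightarrow> real" where
  "normS = (THE N. is_norm N \<and> schlumprecht_eq N)"

subsection \<open>Existence and uniqueness\<close>

lemma is_normD:
  assumes "is_norm N"
  shows "0 \<le> N x" "N x = 0 \<longleftrightarrow> x = 0" "N (x + y) \<le> N x + N y" "N (a *\<^sub>R x) = \<bar>a\<bar> * N x"
  using assms by (simp_all add: is_norm_def)

lemma slog_gt_1: "2 \<le> n \<Longrightarrow> slog (real n) > 1"
  unfolding slog_def by (subst less_log_iff) auto

lemma coord_plus [simp]: "coord (x + y) i = coord x i + coord y i"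
  by transfer simp

lemma coord_scaleR [simp]: "coord (a *\<^sub>R x) i = a * coord x i"
  by transfer simp

lemma coord_zero [simp]: "coord 0 i = 0"
  by transfer simp

lemma coord_restr: "coord (restr E x) i = (if i \<in> E then coord x i else 0)"
  by transfer simp

lemma finite_supp: "finite {i. coord x i \<noteq> 0}"
  by transfer

lemma c00_eqI: "(\<And>i. coord x i = coord y i) \<Longrightarrow> x = y"
  by transfer (simp add: fun_eq_iff)

lemma restr_plus: "restr E (x + y) = restr E x + restr E y"
  by (rule c00_eqI) (simp add: coord_restr)

lemma restr_scaleR: "restr E (a *\<^sub>R x) = a *\<^sub>R restr E x"
  by (rule c00_eqI) (simp add: coord_restr)

text \<open>A norming set of linear functionals.\<close>

inductive_set normers :: "(c00 \<Rightarrow> real) set" where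
  unit: "\<bar>s\<bar> = 1 \<Longrightarrow> (\<lambda>x. s * coord x i) \<in> normers"
| comb: "2 \<le> n \<Longrightarrow> successive n E \<Longrightarrow> \<forall>j. \<phi> j \<in> normers \<Longrightarrow>
    (\<lambda>x. 1 / slog (real n) * (\<Sum>j=1..n. \<phi> j (restr (E j) x))) \<in> normers"

lemma normers_plus: "\<phi> \<in> normers \<Longrightarrow> \<phi> (x + y) = \<phi> x + \<phi> y"
proof (induction arbitrary: x y rule: normers.induct)
  case (unit s i)
  then show ?case by (simp add: algebra_simps)
next
  case (comb n E \<phi>)
  then show ?case by (simp add: restr_plus sum.distrib ring_distribs add_divide_distrib)
qed

lemma normers_scaleR: "\<phi> \<in> normers \<Longrightarrow> \<phi> (a *\<^sub>R x) = a * \<phi> x"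
proof (induction arbitrary: x rule: normers.induct)
  case (unit s i)
  then show ?case by simp
next
  case (comb n E \<phi>)
  then show ?case by (simp add: restr_scaleR sum_distrib_left)
qed

definition l1 :: "c00 \<Rightarrow> real" where
  "l1 x = (\<Sum>i | coord x i \<noteq> 0. \<bar>coord x i\<bar>)"

lemma l1_restr: "l1 (restr E x) = (\<Sum>i\<in>{i. coord x i \<noteq> 0} \<inter> E. \<bar>coord x i\<bar>)"
proof -
  have *: "{i. coord (restr E x) i \<noteq> 0} = {i. coord x i \<noteq> 0} \<inter> E"
    by (auto simp: coord_restr)
  show ?thesis unfolding l1_def * by (rule sum.cong) (auto simp: coord_restr)
qed

lemma l1_sum:
  assumes "successive n E"
  shows "(\<Sum>j=1..n. l1 (restr (E j) x)) \<le> l1 x"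
proof -
  let ?S = "{i. coord x i \<noteq> 0}"
  have disj: "(?S \<inter> E i) \<inter> (?S \<inter> E j) = {}" if "i \<in> {1..n}" "j \<in> {1..n}" "i \<noteq> j" for i j
  proof -
    have "set_less (E i) (E j) \<or> set_less (E j) (E i)"
      using that assms unfolding successive_def by (metis linorder_neqE_nat)
    then show ?thesis unfolding set_less_def by fastforce
  qed
  have "(\<Sum>j=1..n. l1 (restr (E j) x)) = (\<Sum>j=1..n. \<Sum>i\<in>?S \<inter> E j. \<bar>coord x i\<bar>)"
    by (simp add: l1_restr)
  also have "\<dots> = (\<Sum>i\<in>(\<Union>j\<in>{1..n}. ?S \<inter> E j). \<bar>coord x i\<bar>)"
    by (rule sum.UNION_disjoint[symmetric]) (use disj finite_supp in auto)
  also have "\<dots> \<le> l1 x"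
    unfolding l1_def by (rule sum_mono2) (auto simp: finite_supp)
  finally show ?thesis .
qed

lemma abs_coord_le_l1: "\<bar>coord x i\<bar> \<le> l1 x"
proof (cases "coord x i = 0")
  case True
  then show ?thesis unfolding l1_def by (simp add: sum_nonneg)
next
  case False
  then show ?thesis unfolding l1_def
    by (intro member_le_sum[where f = "\<lambda>i. \<bar>coord x i\<bar>"]) (auto simp: finite_supp)
qed

lemma l1_nonneg: "0 \<le> l1 x"
  unfolding l1_def by (simp add: sum_nonneg)

lemma normers_le_l1: "\<phi> \<in> normers \<Longrightarrow> \<phi> x \<le> l1 x"
proof (induction arbitrary: x rule: normers.induct)
  case (unit s i)
  have "s * coord x i \<le> \<bar>s * coord x i\<bar>" by simp
  also have "\<dots> = \<bar>coord x i\<bar>" using unit by (simp add: abs_mult)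
  finally show ?case using abs_coord_le_l1[of x i] by simp
next
  case (comb n E \<phi>)
  have "(\<Sum>j=1..n. \<phi> j (restr (E j) x)) \<le> (\<Sum>j=1..n. l1 (restr (E j) x))"
    by (rule sum_mono) (use comb in blast)
  also have "\<dots> \<le> l1 x" using comb by (intro l1_sum)
  finally have *: "(\<Sum>j=1..n. \<phi> j (restr (E j) x)) \<le> l1 x" .
  have f: "slog (real n) > 1" using comb by (intro slog_gt_1)
  then have "1 / slog (real n) * (\<Sum>j=1..n. \<phi> j (restr (E j) x)) \<le> 1 / slog (real n) * l1 x"
    using * by (intro mult_left_mono) auto
  also have "\<dots> \<le> 1 * l1 x"
    using f l1_nonneg by (intro mult_right_mono) auto
  finally show ?case by simp
qed

definition sup_normers :: "c00 \<Rightarrow> real" where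
  "sup_normers x = (SUP \<phi>\<in>normers. \<phi> x)"

lemma normers_ne: "normers \<noteq> {}"
  using normers.unit[of 1] by fastforce

lemma bdd_normers: "bdd_above ((\<lambda>\<phi>. \<phi> x) ` normers)"
  using normers_le_l1 by (auto simp: bdd_above_def)

lemma sup_normers_ge: "\<phi> \<in> normers \<Longrightarrow> \<phi> x \<le> sup_normers x"
  unfolding sup_normers_def by (rule cSUP_upper) (auto simp: bdd_normers)

lemma sup_normers_le: "(\<And>\<phi>. \<phi> \<in> normers \<Longrightarrow> \<phi> x \<le> c) \<Longrightarrow> sup_normers x \<le> c"
  unfolding sup_normers_def by (rule cSUP_least) (auto simp: normers_ne)

lemma sup_normers_coord: "\<bar>coord x i\<bar> \<le> sup_normers x"
  using sup_normers_ge[OF normers.unit[of 1 i], of x] sup_normers_ge[OF normers.unit[of "-1" i], of x]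
  by simp

lemma normers_uminus: "\<phi> \<in> normers \<Longrightarrow> (\<lambda>x. - \<phi> x) \<in> normers"
proof (induction rule: normers.induct)
  case (unit s i)
  then show ?case using normers.unit[of "- s" i] by simp
next
  case (comb n E \<phi>)
  then show ?case using normers.comb[of n E "\<lambda>j x. - \<phi> j x"] by (simp add: sum_negf)
qed

lemma is_norm_sup_normers: "is_norm sup_normers"
  unfolding is_norm_def
proof (intro conjI allI)
  fix x y :: c00 and a :: real
  have nn: "0 \<le> sup_normers x" for x
    using sup_normers_coord[of x 0] by simp
  show "0 \<le> sup_normers x" by (rule nn)
  show "sup_normers (x + y) \<le> sup_normers x + sup_normers y"
    by (rule sup_normers_le) (simp add: normers_plus sup_normers_ge add_mono)
  have z: "sup_normers 0 = 0"
  proof (rule antisym[OF _ nn])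
    show "sup_normers 0 \<le> 0"
      by (rule sup_normers_le) (use normers_scaleR[where a = 0] in fastforce)
  qed
  show "sup_normers x = 0 \<longleftrightarrow> x = 0"
  proof
    assume "sup_normers x = 0"
    then have "coord x i = 0" for i using sup_normers_coord[of x i] by simp
    then show "x = 0" by (intro c00_eqI) simp
  qed (simp add: z)
  have le: "sup_normers (a *\<^sub>R x) \<le> \<bar>a\<bar> * sup_normers x" for a x
  proof (rule sup_normers_le)
    fix \<phi> assume \<phi>: "\<phi> \<in> normers"
    have "\<bar>\<phi> x\<bar> \<le> sup_normers x"
      using sup_normers_ge[OF \<phi>, of x] sup_normers_ge[OF normers_uminus[OF \<phi>], of x] by simp
    then have "\<bar>a\<bar> * \<bar>\<phi> x\<bar> \<le> \<bar>a\<bar> * sup_normers x" by (rule mult_left_mono) simp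
    then show "\<phi> (a *\<^sub>R x) \<le> \<bar>a\<bar> * sup_normers x"
      unfolding normers_scaleR[OF \<phi>] by (simp add: abs_mult flip: abs_mult)
  qed
  show "sup_normers (a *\<^sub>R x) = \<bar>a\<bar> * sup_normers x"
  proof (cases "a = 0")
    case True
    then show ?thesis by (simp add: z)
  next
    case False
    have "\<bar>a\<bar> * sup_normers x = \<bar>a\<bar> * sup_normers (inverse a *\<^sub>R (a *\<^sub>R x))" using False by simp
    also have "\<dots> \<le> \<bar>a\<bar> * (\<bar>inverse a\<bar> * sup_normers (a *\<^sub>R x))"
      by (intro mult_left_mono le) simp
    also have "\<dots> = sup_normers (a *\<^sub>R x)" using False by simp
    finally show ?thesis using le[of a x] by simp
  qed
qed

lemma sup_normers_family:
  assumes n: "2 \<le> n" and E: "successive n E"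
  shows "1 / slog (real n) * (\<Sum>j=1..n. sup_normers (restr (E j) x)) \<le> sup_normers x"
proof (rule field_le_epsilon)
  fix e :: real assume e: "0 < e"
  have f: "slog (real n) > 1" using n by (rule slog_gt_1)
  define d where "d = e * slog (real n) / n"
  have d: "d > 0" unfolding d_def using e f n by simp
  have "\<exists>\<phi>. \<phi> \<in> normers \<and> sup_normers (restr (E j) x) - d < \<phi> (restr (E j) x)" for j
  proof -
    have "sup_normers (restr (E j) x) - d < (SUP \<phi>\<in>normers. \<phi> (restr (E j) x))"
      using d unfolding sup_normers_def by simp
    then show ?thesis
      by (subst (asm) less_cSUP_iff) (auto simp: normers_ne bdd_normers)
  qed
  then obtain \<phi> where \<phi>: "\<And>j. \<phi> j \<in> normers"
      and lt: "\<And>j. sup_normers (restr (E j) x) - d < \<phi> j (restr (E j) x)"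
    by metis
  have "(\<Sum>j=1..n. sup_normers (restr (E j) x)) \<le> (\<Sum>j=1..n. \<phi> j (restr (E j) x) + d)"
    by (rule sum_mono) (use lt in \<open>simp add: less_imp_le diff_less_eq\<close>)
  also have "\<dots> = (\<Sum>j=1..n. \<phi> j (restr (E j) x)) + n * d" by (simp add: sum.distrib)
  finally have "1 / slog (real n) * (\<Sum>j=1..n. sup_normers (restr (E j) x))
      \<le> 1 / slog (real n) * ((\<Sum>j=1..n. \<phi> j (restr (E j) x)) + n * d)"
    using f by (intro mult_left_mono) auto
  also have "\<dots> = 1 / slog (real n) * (\<Sum>j=1..n. \<phi> j (restr (E j) x)) + e"
    using f n unfolding d_def by (simp add: field_simps)
  also have "1 / slog (real n) * (\<Sum>j=1..n. \<phi> j (restr (E j) x)) \<le> sup_normers x"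
    using sup_normers_ge[OF normers.comb[OF n E], of \<phi> x] \<phi> by simp
  finally show "1 / slog (real n) * (\<Sum>j=1..n. sup_normers (restr (E j) x)) \<le> sup_normers x + e"
    by simp
qed

lemma schlumprecht_eq_sup_normers: "schlumprecht_eq sup_normers"
  unfolding schlumprecht_eq_def
proof (intro allI antisym)
  fix x
  let ?A = "SUP i. ereal \<bar>coord x i\<bar>"
  let ?F = "{(n, E). 2 \<le> n \<and> successive n E}"
  let ?t = "\<lambda>(n, E). ereal (1 / slog (real n) * (\<Sum>j=1..n. sup_normers (restr (E j) x)))"
  let ?M = "max ?A (SUP p\<in>?F. ?t p)"
  have "?A \<le> ereal (sup_normers x)"
    by (rule SUP_least) (simp add: sup_normers_coord)
  moreover have "(SUP p\<in>?F. ?t p) \<le> ereal (sup_normers x)"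
  proof (rule SUP_least)
    fix p assume "p \<in> ?F"
    then obtain n E where p: "p = (n, E)" and nE: "2 \<le> n" "successive n E" by auto
    show "?t p \<le> ereal (sup_normers x)"
      using sup_normers_family[OF nE, of x] by (simp add: p)
  qed
  ultimately show le: "?M \<le> ereal (sup_normers x)" by simp
  have bd: "ereal (\<phi> x) \<le> ?M" if "\<phi> \<in> normers" for \<phi>
    using that
  proof cases
    case (unit s i)
    have "s * coord x i \<le> \<bar>s * coord x i\<bar>" by simp
    also have "\<dots> = \<bar>coord x i\<bar>" using unit by (simp add: abs_mult)
    finally have "ereal (\<phi> x) \<le> ereal \<bar>coord x i\<bar>" using unit by simp
    also have "\<dots> \<le> ?A" by (rule SUP_upper) simp
    also have "\<dots> \<le> ?M" by simp
    finally show ?thesis .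
  next
    case (comb n E \<psi>)
    have "1 / slog (real n) * (\<Sum>j=1..n. \<psi> j (restr (E j) x))
       \<le> 1 / slog (real n) * (\<Sum>j=1..n. sup_normers (restr (E j) x))"
      using comb slog_gt_1[of n] by (intro mult_left_mono sum_mono sup_normers_ge) auto
    then have "ereal (\<phi> x) \<le> ?t (n, E)" using comb by simp
    also have "\<dots> \<le> (SUP p\<in>?F. ?t p)" by (rule SUP_upper) (use comb in simp)
    also have "\<dots> \<le> ?M" by simp
    finally show ?thesis .
  qed
  have "0 \<le> ?M"
    by (rule order_trans[OF _ max.cobounded1], rule SUP_upper2[of 0]) auto
  have "\<exists>m. r = ereal m" if "0 \<le> r" "r \<le> ereal (sup_normers x)" for r
    using that by (cases r) auto
  from this[OF \<open>0 \<le> ?M\<close> le] obtain m where m: "?M = ereal m" by blast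
  have "sup_normers x \<le> m"
    by (rule sup_normers_le) (use bd m in simp)
  then show "ereal (sup_normers x) \<le> ?M" using m by simp
qed

lemma schlumprecht_eq_le:
  assumes N: "is_norm N" "schlumprecht_eq N" and N': "is_norm N'" "schlumprecht_eq N'"
  shows "N x \<le> N' x"
proof (induction "card {i. coord x i \<noteq> 0}" arbitrary: x rule: less_induct)
  case less
  show ?case
  proof (rule ccontr)
    assume neg: "\<not> N x \<le> N' x"
    let ?F = "{(n, E). 2 \<le> n \<and> successive n E}"
    have N'nn: "0 \<le> N' y" and Nnn: "0 \<le> N y" for y
      by (rule is_normD(1)[OF N'(1)], rule is_normD(1)[OF N(1)])
    have N0: "N 0 = 0" by (simp add: is_normD(2)[OF N(1)])
    have eq': "ereal (N' x) = max (SUP i. ereal \<bar>coord x i\<bar>)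
        (SUP (n, E) \<in> ?F. ereal (1 / slog (real n) * (\<Sum>j=1..n. N' (restr (E j) x))))"
      using N'(2) unfolding schlumprecht_eq_def by blast
    have eq: "ereal (N x) = max (SUP i. ereal \<bar>coord x i\<bar>)
        (SUP (n, E) \<in> ?F. ereal (1 / slog (real n) * (\<Sum>j=1..n. N (restr (E j) x))))"
      using N(2) unfolding schlumprecht_eq_def by blast
    define c where "c = max (N' x) (N x / slog 2)"
    have c: "N' x \<le> c" "N x / slog 2 \<le> c" unfolding c_def by auto
    have fam: "1 / slog (real n) * (\<Sum>j=1..n. N (restr (E j) x)) \<le> c"
      if n: "2 \<le> n" and E: "successive n E" for n E
    proof (cases "\<exists>k\<in>{1..n}. {i. coord x i \<noteq> 0} \<subseteq> E k")
      case True
      then obtain k where k: "k \<in> {1..n}" "{i. coord x i \<noteq> 0} \<subseteq> E k" by blast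
      have 0: "restr (E j) x = 0" if "j \<in> {1..n}" "j \<noteq> k" for j
      proof -
        have "set_less (E j) (E k) \<or> set_less (E k) (E j)"
          using that k E unfolding successive_def by (metis linorder_neqE_nat)
        then have "E j \<inter> E k = {}" unfolding set_less_def by fastforce
        then show ?thesis using k by (intro c00_eqI) (auto simp: coord_restr)
      qed
      have 1: "restr (E k) x = x"
        using k by (intro c00_eqI) (auto simp: coord_restr)
      have "(\<Sum>j=1..n. N (restr (E j) x)) = N (restr (E k) x) + (\<Sum>j\<in>{1..n} - {k}. N (restr (E j) x))"
        using k(1) by (intro sum.remove) auto
      also have "(\<Sum>j\<in>{1..n} - {k}. N (restr (E j) x)) = 0"
        by (rule sum.neutral) (use 0 N0 in auto)
      finally have "1 / slog (real n) * (\<Sum>j=1..n. N (restr (E j) x)) = N x / slog (real n)"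
        using 1 by simp
      also have "\<dots> \<le> N x / slog 2"
        using Nnn[of x] slog_gt_1[of 2] n
        by (intro divide_left_mono) (auto simp: slog_def)
      finally show ?thesis using c(2) by simp
    next
      case False
      have "N (restr (E j) x) \<le> N' (restr (E j) x)" if "j \<in> {1..n}" for j
      proof (rule less)
        have "{i. coord (restr (E j) x) i \<noteq> 0} \<subset> {i. coord x i \<noteq> 0}"
          using False that by (auto simp: coord_restr)
        then show "card {i. coord (restr (E j) x) i \<noteq> 0} < card {i. coord x i \<noteq> 0}"
          by (rule psubset_card_mono[OF finite_supp])
      qed
      then have "1 / slog (real n) * (\<Sum>j=1..n. N (restr (E j) x))
          \<le> 1 / slog (real n) * (\<Sum>j=1..n. N' (restr (E j) x))"
        using slog_gt_1[OF n] by (intro mult_left_mono sum_mono) auto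
      moreover have "ereal (1 / slog (real n) * (\<Sum>j=1..n. N' (restr (E j) x))) \<le> ereal (N' x)"
        unfolding eq' by (rule order_trans[OF _ max.cobounded2], rule SUP_upper2[of "(n, E)"])
          (use n E in auto)
      ultimately show ?thesis using c(1) by simp
    qed
    have "ereal (N x) \<le> ereal c"
      unfolding eq
    proof (rule max.boundedI)
      have "(SUP i. ereal \<bar>coord x i\<bar>) \<le> ereal (N' x)" unfolding eq' by simp
      then show "(SUP i. ereal \<bar>coord x i\<bar>) \<le> ereal c"
        by (rule order_trans) (use c in simp)
      show "(SUP (n, E) \<in> ?F. ereal (1 / slog (real n) * (\<Sum>j=1..n. N (restr (E j) x)))) \<le> ereal c"
        by (rule SUP_least) (use fam in auto)
    qed
    then have "N x \<le> c" by simp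
    then have "N x \<le> N x / slog 2" using neg unfolding c_def by auto
    moreover have "N x > 0" using neg N'nn[of x] by simp
    ultimately show False using slog_gt_1[of 2] by (simp add: field_simps)
  qed
qed

lemma ex1_schlumprecht_norm: "\<exists>!N. is_norm N \<and> schlumprecht_eq N"
proof (rule ex1I[of _ sup_normers])
  show "is_norm sup_normers \<and> schlumprecht_eq sup_normers"
    using is_norm_sup_normers schlumprecht_eq_sup_normers by blast
  show "N = sup_normers" if "is_norm N \<and> schlumprecht_eq N" for N
    using that is_norm_sup_normers schlumprecht_eq_sup_normers
    by (intro ext antisym schlumprecht_eq_le) auto
qed

lemma is_norm_normS: "is_norm normS"
  and schlumprecht_eq_normS: "schlumprecht_eq normS"
  using theI'[OF ex1_schlumprecht_norm] unfolding normS_def by blast+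

instantiation c00 :: real_normed_vector
begin

definition norm_c00 :: "c00 \<Rightarrow> real" where
  "norm_c00 = normS"

definition sgn_c00 :: "c00 \<Rightarrow> c00" where
  "sgn_c00 x = x /\<^sub>R norm x"

definition dist_c00 :: "c00 \<Rightarrow> c00 \<Rightarrow> real" where
  "dist_c00 x y = norm (x - y)"

definition uniformity_c00 :: "(c00 \<times> c00) filter" where
  "uniformity_c00 = (INF e\<in>{0 <..}. principal {(x, y). dist x y < e})"

definition open_c00 :: "c00 set \<Rightarrow> bool" where
  "open_c00 U \<longleftrightarrow> (\<forall>x\<in>U. eventually (\<lambda>(x', y). x' = x \<longrightarrow> y \<in> U) uniformity)"

instance
proof
  fix x y :: c00 and a :: real
  show "(norm x = 0) = (x = 0)" "norm (x + y) \<le> norm x + norm y"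
    "norm (a *\<^sub>R x) = \<bar>a\<bar> * norm x"
    unfolding norm_c00_def by (rule is_normD[OF is_norm_normS])+
qed (simp_all add: sgn_c00_def dist_c00_def uniformity_c00_def open_c00_def)

end

section \<open>Completion of a normed space\<close>

definition cauchy_rel :: "(nat \<Rightarrow> 'a::real_normed_vector) \<Rightarrow> (nat \<Rightarrow> 'a) \<Rightarrow> bool" where
  "cauchy_rel X Y \<longleftrightarrow> Cauchy X \<and> Cauchy Y \<and> (\<lambda>n. X n - Y n) \<longlonglongrightarrow> 0"

lemma Cauchy_const: "Cauchy (\<lambda>_. a :: 'a::real_normed_vector)"
  using LIMSEQ_imp_Cauchy[OF tendsto_const] .

lemma Cauchy_scaleR:
  fixes X :: "nat \<Rightarrow> 'a::real_normed_vector"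
  shows "Cauchy X \<Longrightarrow> Cauchy (\<lambda>n. a *\<^sub>R X n)"
  using bounded_linear.Cauchy[OF bounded_linear_scaleR_right] .

lemma Cauchy_uminus:
  fixes X :: "nat \<Rightarrow> 'a::real_normed_vector"
  shows "Cauchy X \<Longrightarrow> Cauchy (\<lambda>n. - X n)"
  using Cauchy_scaleR[of X "-1"] by simp

lemma Cauchy_plus:
  fixes X Y :: "nat \<Rightarrow> 'a::real_normed_vector"
  assumes "Cauchy X" "Cauchy Y"
  shows "Cauchy (\<lambda>n. X n + Y n)"
proof (rule metric_CauchyI)
  fix e :: real assume "0 < e"
  then have e: "0 < e / 2" by simp
  obtain M1 where M1: "\<forall>m\<ge>M1. \<forall>n\<ge>M1. dist (X m) (X n) < e / 2"
    using metric_CauchyD[OF assms(1) e] by blast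
  obtain M2 where M2: "\<forall>m\<ge>M2. \<forall>n\<ge>M2. dist (Y m) (Y n) < e / 2"
    using metric_CauchyD[OF assms(2) e] by blast
  have "dist (X m + Y m) (X n + Y n) < e" if "m \<ge> max M1 M2" "n \<ge> max M1 M2" for m n
  proof -
    have "dist (X m) (X n) < e / 2" "dist (Y m) (Y n) < e / 2" using that M1 M2 by auto
    then show ?thesis
      using dist_triangle_add[of "X m" "Y m" "X n" "Y n"] by simp
  qed
  then show "\<exists>M. \<forall>m\<ge>M. \<forall>n\<ge>M. dist (X m + Y m) (X n + Y n) < e" by blast
qed

lemma Cauchy_norm':
  fixes X :: "nat \<Rightarrow> 'a::real_normed_vector"
  assumes "Cauchy X"
  shows "Cauchy (\<lambda>n. norm (X n))"
proof (rule metric_CauchyI)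
  fix e :: real assume "0 < e"
  then obtain M where "\<forall>m\<ge>M. \<forall>n\<ge>M. dist (X m) (X n) < e"
    using metric_CauchyD[OF assms] by blast
  then have "\<forall>m\<ge>M. \<forall>n\<ge>M. dist (norm (X m)) (norm (X n)) < e"
    by (metis dist_norm dist_real_def norm_triangle_ineq3 order.strict_trans1)
  then show "\<exists>M. \<forall>m\<ge>M. \<forall>n\<ge>M. dist (norm (X m)) (norm (X n)) < e" by blast
qed

lemma norm_lim: "Cauchy X \<Longrightarrow> (\<lambda>n. norm (X n)) \<longlonglongrightarrow> lim (\<lambda>n. norm (X n))"
  for X :: "nat \<Rightarrow> 'a::real_normed_vector"
  using Cauchy_norm' Cauchy_convergent convergent_LIMSEQ_iff by blast

lemma part_equivp_cauchy_rel: "part_equivp cauchy_rel"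
proof (rule part_equivpI)
  show "\<exists>X. cauchy_rel X (X :: nat \<Rightarrow> 'a)"
    by (rule exI[of _ "\<lambda>_. 0"]) (simp add: cauchy_rel_def Cauchy_const)
  show "symp (cauchy_rel :: (nat \<Rightarrow> 'a) \<Rightarrow> _)"
  proof (rule sympI)
    fix X Y :: "nat \<Rightarrow> 'a" assume "cauchy_rel X Y"
    then show "cauchy_rel Y X"
      unfolding cauchy_rel_def using tendsto_minus[of "\<lambda>n. X n - Y n" 0] by simp
  qed
  show "transp (cauchy_rel :: (nat \<Rightarrow> 'a) \<Rightarrow> _)"
  proof (rule transpI)
    fix X Y Z :: "nat \<Rightarrow> 'a" assume "cauchy_rel X Y" "cauchy_rel Y Z"
    then show "cauchy_rel X Z"
      unfolding cauchy_rel_def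
      using tendsto_add[of "\<lambda>n. X n - Y n" 0 sequentially "\<lambda>n. Y n - Z n" 0] by simp
  qed
qed

quotient_type (overloaded) 'a completion = "nat \<Rightarrow> 'a::real_normed_vector" / partial: cauchy_rel
  by (rule part_equivp_cauchy_rel)

lemma cauchy_rel_refl: "cauchy_rel X X \<longleftrightarrow> Cauchy X"
  by (simp add: cauchy_rel_def)

instantiation completion :: (real_normed_vector) real_vector
begin

lift_definition zero_completion :: "'a completion" is "\<lambda>_. 0"
  by (simp add: cauchy_rel_refl Cauchy_const)

lift_definition plus_completion :: "'a completion \<Rightarrow> 'a completion \<Rightarrow> 'a completion"
  is "\<lambda>X Y n. X n + Y n"
  unfolding cauchy_rel_def
  by (auto simp: Cauchy_plus add_diff_add intro: tendsto_add_zero)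

lift_definition uminus_completion :: "'a completion \<Rightarrow> 'a completion" is "\<lambda>X n. - X n"
  unfolding cauchy_rel_def
proof (elim conjE, intro conjI Cauchy_uminus)
  fix X Y :: "nat \<Rightarrow> 'a" assume "(\<lambda>n. X n - Y n) \<longlonglongrightarrow> 0"
  from tendsto_minus[OF this] show "(\<lambda>n. - X n - - Y n) \<longlonglongrightarrow> 0" by simp
qed

definition minus_completion :: "'a completion \<Rightarrow> 'a completion \<Rightarrow> 'a completion" where
  "minus_completion x y = x + (- y)"

lift_definition scaleR_completion :: "real \<Rightarrow> 'a completion \<Rightarrow> 'a completion"
  is "\<lambda>a X n. a *\<^sub>R X n"
  unfolding cauchy_rel_def
proof (elim conjE, intro conjI Cauchy_scaleR)
  fix a and X Y :: "nat \<Rightarrow> 'a" assume "(\<lambda>n. X n - Y n) \<longlonglongrightarrow> 0"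
  from tendsto_scaleR[OF tendsto_const this, of a]
  show "(\<lambda>n. a *\<^sub>R X n - a *\<^sub>R Y n) \<longlonglongrightarrow> 0" by (simp add: scaleR_diff_right)
qed

instance
proof
  fix x y z :: "'a completion" and a b :: real
  note cs = Cauchy_plus Cauchy_scaleR Cauchy_uminus Cauchy_const
  show "x + y + z = x + (y + z)" "x + y = y + x" "0 + x = x" "- x + x = 0"
    "a *\<^sub>R (x + y) = a *\<^sub>R x + a *\<^sub>R y" "(a + b) *\<^sub>R x = a *\<^sub>R x + b *\<^sub>R x"
    "a *\<^sub>R b *\<^sub>R x = (a * b) *\<^sub>R x" "1 *\<^sub>R x = x"
    by (transfer; simp add: cauchy_rel_def cs algebra_simps)+
  show "x - y = x + - y" by (rule minus_completion_def)
qed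

end

instantiation completion :: (real_normed_vector) real_normed_vector
begin

lift_definition norm_completion :: "'a completion \<Rightarrow> real" is "\<lambda>X. lim (\<lambda>n. norm (X n))"
  unfolding cauchy_rel_def
proof (elim conjE)
  fix X Y :: "nat \<Rightarrow> 'a"
  assume X: "Cauchy X" and Y: "Cauchy Y" and XY: "(\<lambda>n. X n - Y n) \<longlonglongrightarrow> 0"
  have "(\<lambda>n. norm (X n) - norm (Y n)) \<longlonglongrightarrow> 0"
    by (rule Lim_null_comparison[OF _ tendsto_norm_zero[OF XY]])
      (simp add: norm_triangle_ineq3)
  moreover have "(\<lambda>n. norm (X n) - norm (Y n)) \<longlonglongrightarrow> lim (\<lambda>n. norm (X n)) - lim (\<lambda>n. norm (Y n))"
    by (intro tendsto_diff norm_lim X Y)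
  ultimately show "lim (\<lambda>n. norm (X n)) = lim (\<lambda>n. norm (Y n))"
    using LIMSEQ_unique by fastforce
qed

definition sgn_completion :: "'a completion \<Rightarrow> 'a completion" where
  "sgn_completion x = x /\<^sub>R norm x"

definition dist_completion :: "'a completion \<Rightarrow> 'a completion \<Rightarrow> real" where
  "dist_completion x y = norm (x - y)"

definition uniformity_completion :: "('a completion \<times> 'a completion) filter" where
  "uniformity_completion = (INF e\<in>{0 <..}. principal {(x, y). dist x y < e})"

definition open_completion :: "'a completion set \<Rightarrow> bool" where
  "open_completion U \<longleftrightarrow> (\<forall>x\<in>U. eventually (\<lambda>(x', y). x' = x \<longrightarrow> y \<in> U) uniformity)"

instance
proof
  fix x y :: "'a completion" and a :: real
  show "(norm x = 0) = (x = 0)"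
  proof (transfer, unfold cauchy_rel_refl)
    fix X :: "nat \<Rightarrow> 'a" assume X: "Cauchy X"
    have "lim (\<lambda>n. norm (X n)) = 0 \<longleftrightarrow> (\<lambda>n. norm (X n)) \<longlonglongrightarrow> 0"
      using norm_lim[OF X] LIMSEQ_unique by fastforce
    also have "\<dots> \<longleftrightarrow> cauchy_rel X (\<lambda>_. 0)"
      using X by (simp add: cauchy_rel_def Cauchy_const tendsto_norm_zero_iff)
    finally show "(lim (\<lambda>n. norm (X n)) = 0) = cauchy_rel X (\<lambda>_. 0)" .
  qed
  show "norm (x + y) \<le> norm x + norm y"
  proof (transfer, unfold cauchy_rel_refl)
    fix X Y :: "nat \<Rightarrow> 'a" assume X: "Cauchy X" and Y: "Cauchy Y"
    show "lim (\<lambda>n. norm (X n + Y n)) \<le> lim (\<lambda>n. norm (X n)) + lim (\<lambda>n. norm (Y n))"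
      by (rule tendsto_le[OF _ tendsto_add[OF norm_lim[OF X] norm_lim[OF Y]]
            norm_lim[OF Cauchy_plus[OF X Y]]])
        (simp_all add: norm_triangle_ineq)
  qed
  show "norm (a *\<^sub>R x) = \<bar>a\<bar> * norm x"
  proof (transfer, unfold cauchy_rel_refl)
    fix a and X :: "nat \<Rightarrow> 'a" assume X: "Cauchy X"
    show "lim (\<lambda>n. norm (a *\<^sub>R X n)) = \<bar>a\<bar> * lim (\<lambda>n. norm (X n))"
      by (rule limI) (use tendsto_mult[OF tendsto_const norm_lim[OF X], of "\<bar>a\<bar>"] in simp)
  qed
qed (simp_all add: sgn_completion_def dist_completion_def uniformity_completion_def
    open_completion_def)

end

lift_definition to_completion :: "'a::real_normed_vector \<Rightarrow> 'a completion" is "\<lambda>x _. x"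
  by (simp add: cauchy_rel_refl Cauchy_const)

lemma linear_to_completion: "linear to_completion"
  by (rule linearI; transfer; simp add: cauchy_rel_refl Cauchy_const)

lemma norm_to_completion [simp]: "norm (to_completion x) = norm x"
  by transfer simp

lemma to_completion_diff: "to_completion (x - y) = to_completion x - to_completion y"
  by (rule linear_diff[OF linear_to_completion])

lemma to_completion_LIMSEQ:
  assumes "Cauchy Y"
  shows "(\<lambda>n. to_completion (Y n)) \<longlonglongrightarrow> abs_completion Y"
proof (rule metric_LIMSEQ_I)
  fix e :: real assume "0 < e"
  then have e: "0 < e / 2" by simp
  obtain M where M: "\<forall>m\<ge>M. \<forall>n\<ge>M. dist (Y m) (Y n) < e / 2"
    using metric_CauchyD[OF assms e] by blast
  have "dist (to_completion (Y n)) (abs_completion Y) < e" if n: "n \<ge> M" for n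
  proof -
    have C: "Cauchy (\<lambda>k. Y n + - Y k)"
      by (intro Cauchy_plus Cauchy_const Cauchy_uminus assms)
    have "to_completion (Y n) - abs_completion Y = abs_completion (\<lambda>k. Y n + - Y k)"
      unfolding minus_completion_def to_completion.abs_eq
      by (simp add: uminus_completion.abs_eq plus_completion.abs_eq cauchy_rel_refl
          Cauchy_const Cauchy_uminus assms)
    then have "dist (to_completion (Y n)) (abs_completion Y) = lim (\<lambda>k. norm (Y n + - Y k))"
      using C by (simp add: dist_completion_def norm_completion.abs_eq cauchy_rel_refl)
    also have "\<dots> \<le> e / 2"
    proof (rule tendsto_upperbound[OF norm_lim[OF C]])
      show "\<forall>\<^sub>F k in sequentially. norm (Y n + - Y k) \<le> e / 2"
        unfolding eventually_sequentially using M n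
        by (metis dist_norm less_imp_le diff_conv_add_uminus)
    qed simp
    finally show ?thesis using \<open>0 < e\<close> by simp
  qed
  then show "\<exists>no. \<forall>n\<ge>no. dist (to_completion (Y n)) (abs_completion Y) < e" by blast
qed

lemma closure_range_to_completion: "closure (range to_completion) = UNIV"
proof -
  have "x \<in> closure (range to_completion)" for x :: "'a completion"
  proof (induct x rule: completion.abs_induct)
    case (1 Y)
    then have "Cauchy Y" by (simp add: cauchy_rel_refl)
    from to_completion_LIMSEQ[OF this] show ?case
      unfolding closure_sequential by (intro exI[of _ "\<lambda>n. to_completion (Y n)"]) simp
  qed
  then show ?thesis by blast
qed

instance completion :: (real_normed_vector) banach
proof
  fix X :: "nat \<Rightarrow> 'a completion"
  assume X: "Cauchy X"
  have "\<exists>y. dist (to_completion y) (X n) < 1 / Suc n" for n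
    using closure_approachable[of "X n" "range to_completion"] closure_range_to_completion
    by (metis UNIV_I of_nat_0_less_iff rangeE zero_less_Suc zero_less_divide_1_iff)
  then obtain Y where Y: "\<And>n. dist (to_completion (Y n)) (X n) < 1 / Suc n" by metis
  have lim0: "(\<lambda>n. to_completion (Y n) - X n) \<longlonglongrightarrow> 0"
    by (rule Lim_null_comparison[OF _ LIMSEQ_inverse_real_of_nat])
      (use Y in \<open>simp add: dist_norm inverse_eq_divide less_imp_le\<close>)
  have "Cauchy (\<lambda>n. (to_completion (Y n) - X n) + X n)"
    by (intro Cauchy_plus X LIMSEQ_imp_Cauchy[OF lim0])
  then have "Cauchy (\<lambda>n. to_completion (Y n))" by simp
  then have "Cauchy Y"
    by (simp add: Cauchy_def dist_norm flip: to_completion_diff)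
  from tendsto_diff[OF to_completion_LIMSEQ[OF this] lim0] show "convergent X"
    by (auto simp: convergent_def)
qed

section \<open>Schlumprecht's space and operators\<close>

type_synonym schlumprecht = "c00 completion"

definition infinite_dimensional :: "'a::real_vector set \<Rightarrow> bool" where
  "infinite_dimensional V \<longleftrightarrow> \<not> (\<exists>B. finite B \<and> V \<subseteq> span B)"

text \<open>For a bounded linear \<open>T\<close>, the restriction to a subspace \<open>V\<close> is an isomorphism onto its
  image iff it is a homeomorphism, as the inverse is automatically linear.\<close>

definition strictly_singular :: "('a::real_normed_vector \<Rightarrow> 'b::real_normed_vector) \<Rightarrow> bool" where
  "strictly_singular T \<longleftrightarrow>
     \<not> (\<exists>V. subspace V \<and> infinite_dimensional V \<and> (\<exists>T'. homeomorphism V (T ` V) T T'))"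

definition compact_operator :: "('a::real_normed_vector \<Rightarrow> 'b::real_normed_vector) \<Rightarrow> bool" where
  "compact_operator T \<longleftrightarrow> compact (closure (T ` cball 0 1))"

end

theory Submission
  imports Defs
begin

text \<open>
  The operator has the form \<open>T y = (\<Sum>m. x\<^sub>m(y) e\<^sub>m)\<close> for successive functionals \<open>x\<^sub>m\<close> of norm at most one;
  such an operator is a contraction because every block sequence dominates the unit vector basis.
  The \<open>x\<^sub>m\<close> are longer and longer truncations of one infinite tree of flat functionals
  \<open>(e\<^sub>1 + \<dots> + e\<^sub>n) / slog n\<close>: at each stage the leaf with the largest coefficient is replaced by a flat
  functional whose length \<open>n\<close> is huge compared with everything chosen before. Replacing the dual leaf by
  \<open>slog n / n (e\<^sub>1 + \<dots> + e\<^sub>n)\<close> increases the norm of the dual vector by as little as we like, so the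
  \<open>x\<^sub>m\<close> attain at least \<open>1/3\<close> on the unit ball and \<open>T\<close> is not compact.

  For strict singularity, sort the coordinates of \<open>T y\<close> into levels by their size. On the \<open>i\<close>-th level all
  subtrees of the stage \<open>i\<close> tree except one have roots that are so long that they contribute a vector of
  bounded \<open>\<ell>\<^sub>1\<close> norm, which is negligible for functionals with small coefficients. The
  exceptional subtrees together form a block functional times a coefficient that tends to 0. Hence
  \<open>\<parallel>T y\<parallel> \<le> \<epsilon> \<parallel>y\<parallel> + K\<^sub>\<epsilon> \<parallel>T y\<parallel>\<^sub>\<infinity>\<close>, and on a subspace where \<open>T\<close> is an
  isomorphism the norm would be equivalent to a sup norm, which a gliding hump excludes.
\<close>

section \<open>Schlumprecht's norm\<close>

lemma norm_eq_sup_normers: "norm (x :: c00) = sup_normers x"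
proof -
  have "normS = sup_normers"
    using ex1_schlumprecht_norm is_norm_normS schlumprecht_eq_normS is_norm_sup_normers
      schlumprecht_eq_sup_normers by blast
  then show ?thesis by (simp add: norm_c00_def)
qed

lemma normers_le_norm: "\<phi> \<in> normers \<Longrightarrow> \<phi> x \<le> norm x"
  by (simp add: norm_eq_sup_normers sup_normers_ge)

lemma norm_le_normers: "(\<And>\<phi>. \<phi> \<in> normers \<Longrightarrow> \<phi> x \<le> c) \<Longrightarrow> norm x \<le> c"
  by (simp add: norm_eq_sup_normers sup_normers_le)

lemma abs_coord_le_norm: "\<bar>coord x i\<bar> \<le> norm x"
  by (simp add: norm_eq_sup_normers sup_normers_coord)

lemma sum_norm_restr_le:
  assumes "2 \<le> n" "successive n E"
  shows "(\<Sum>j=1..n. norm (restr (E j) x)) \<le> slog (real n) * norm x"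
proof -
  have "slog (real n) > 0" using slog_gt_1[OF assms(1)] by simp
  then show ?thesis
    using sup_normers_family[OF assms, of x]
    by (simp add: norm_eq_sup_normers field_simps)
qed

lemma linear_normers: "\<phi> \<in> normers \<Longrightarrow> linear \<phi>"
  by (rule linearI) (simp_all add: normers_plus normers_scaleR)

lemma restr_restr: "restr E (restr F x) = restr (E \<inter> F) x"
  by (rule c00_eqI) (simp add: coord_restr)

lemma coord_Abs_c00: "finite {i. f i \<noteq> 0} \<Longrightarrow> coord (Abs_c00 f) = f"
  by (simp add: Abs_c00_inverse)

lemma coord_sum: "coord (sum f A) i = (\<Sum>a\<in>A. coord (f a) i)"
  by (induction A rule: infinite_finite_induct) auto

section \<open>Growth, submultiplicativity and concavity of the weight function
  \<open>slog\<close>\<close>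

lemma slog_mono: "0 \<le> x \<Longrightarrow> x \<le> y \<Longrightarrow> slog x \<le> slog y"
  by (simp add: slog_def)

lemma slog_1 [simp]: "slog 1 = 1"
  by (simp add: slog_def)

lemma slog_ge_1: "1 \<le> x \<Longrightarrow> 1 \<le> slog x"
  using slog_mono[of 1 x] by simp

lemma slog_le_self: "1 \<le> x \<Longrightarrow> slog x \<le> x"
proof -
  assume x: "1 \<le> x"
  have "ln (x + 1) = ln 2 + ln ((x + 1) / 2)" using x by (simp add: ln_div)
  also have "\<dots> \<le> ln 2 + ((x + 1) / 2 - 1)"
    using ln_le_minus_one[of "(x + 1) / 2"] x by simp
  also have "\<dots> = ln 2 + (x - 1) * (1 / 2)" by (simp add: field_simps)
  also have "\<dots> \<le> ln 2 + (x - 1) * ln 2"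
    using ln2_ge_two_thirds x by (intro add_left_mono mult_left_mono) auto
  finally have "ln (x + 1) \<le> x * ln 2" by (simp add: algebra_simps)
  then show ?thesis by (simp add: slog_def log_def field_simps)
qed

text \<open>With \<open>a = slog x\<close> this is the convexity inequality
  \<open>(1 + q)\<^sup>a \<ge> 1 + (2\<^sup>a - 1) q\<close> for \<open>q \<ge> 1\<close>.\<close>

lemma slog_submult:
  assumes x: "1 \<le> x" and q: "1 \<le> q"
  shows "slog (x * q) \<le> slog x * slog q"
proof -
  define a where "a = slog x"
  have a1: "1 \<le> a" unfolding a_def using x by (rule slog_ge_1)
  have pa: "2 powr a = 1 + x" using x by (simp add: a_def slog_def)
  have conv: "convex_on {0<..} (\<lambda>t::real. t powr a)" using a1 by (rule powr_convex)
  \<comment> \<open>The point 2 lies between 1 and \<open>1 + q\<close>, with weight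
    \<open>1/q\<close> on the latter.\<close>
  have "((1 - 1/q) * 1 + (1/q) * (1 + q)) powr a \<le> (1 - 1/q) * (1 powr a) + (1/q) * ((1 + q) powr a)"
    using convex_onD[OF conv, of "1/q" 1 "1 + q"] q by simp
  moreover have "(1 - 1/q) * 1 + (1/q) * (1 + q) = 2" using q by (simp add: field_simps)
  ultimately have "1 + x \<le> (1 - 1/q) + (1/q) * ((1 + q) powr a)" unfolding pa[symmetric] by (simp only: mult_1_right powr_one_eq_one)
  then have "q * (1 + x) \<le> q * ((1 - 1/q) + (1/q) * ((1 + q) powr a))"
    using q by (intro mult_left_mono) auto
  also have "\<dots> = q - 1 + (1 + q) powr a" using q by (simp add: field_simps)
  finally have "1 + x * q \<le> (1 + q) powr a" by (simp add: algebra_simps)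
  then have "log 2 (1 + x * q) \<le> log 2 ((1 + q) powr a)"
    using x q by (subst log_le_cancel_iff) (auto intro: add_pos_nonneg)
  also have "\<dots> = a * log 2 (1 + q)" using q by (simp add: log_powr)
  finally show ?thesis by (simp add: a_def slog_def add.commute)
qed

text \<open>This is Jensen's inequality for the logarithm: the weighted mean of the points
  \<open>1 / p j + 1\<close> is \<open>card J + 1\<close>.\<close>

lemma slog_concave_sum:
  assumes "finite J" "J \<noteq> {}" "\<And>j. j \<in> J \<Longrightarrow> 0 < p j" "(\<Sum>j\<in>J. p j) = 1"
  shows "(\<Sum>j\<in>J. p j * slog (1 / p j)) \<le> slog (real (card J))"
proof -
  have cv: "concave_on {0<..} (log 2)" 
    by (rule log_concave) simp
  have "(\<Sum>j\<in>J. p j * log 2 (1 / p j + 1)) \<le> log 2 (\<Sum>j\<in>J. p j *\<^sub>R (1 / p j + 1))"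
    using assms by (intro concave_on_sum[OF _ _ cv, of J p "\<lambda>j. 1 / p j + 1"]) (auto intro: less_imp_le add_pos_pos)
  also have "(\<Sum>j\<in>J. p j *\<^sub>R (1 / p j + 1)) = (\<Sum>j\<in>J. 1 + p j)"
    by (rule sum.cong) (use assms(3) in \<open>force simp: field_simps\<close>)+
  also have "\<dots> = real (card J) + 1" using assms(4) by (simp add: sum.distrib)
  finally show ?thesis by (simp add: slog_def)
qed


text \<open>Submultiplicativity is applied to \<open>y = x * (y / x)\<close>, and
  \<open>slog (y / x)\<close> is bounded by \<open>y / x\<close>.\<close>

lemma slog_div_self_mono:
  assumes "1 \<le> x" "x \<le> y"
  shows "x / slog x \<le> y / slog y"
proof -
  have "slog y = slog (x * (y / x))" using assms by simp
  also have "\<dots> \<le> slog x * slog (y / x)" using assms by (intro slog_submult) auto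
  also have "\<dots> \<le> slog x * (y / x)"
    using assms slog_ge_1[of x] by (intro mult_left_mono slog_le_self) auto
  finally show ?thesis
    using assms slog_ge_1[of x] slog_ge_1[of y] by (simp add: field_simps)
qed

text \<open>In contrast to \<open>successive\<close>, the index set is arbitrary: it may have gaps
  or be infinite, as for the blocks of all functionals at once.\<close>

definition ordered_sets :: "nat set \<Rightarrow> (nat \<Rightarrow> nat set) \<Rightarrow> bool" where
  "ordered_sets A I \<longleftrightarrow> (\<forall>m\<in>A. finite (I m)) \<and> (\<forall>m\<in>A. \<forall>k\<in>A. m < k \<longrightarrow> set_less (I m) (I k))"

lemma ordered_setsD:
  assumes "ordered_sets A I"
  shows "m \<in> A \<Longrightarrow> finite (I m)" "m \<in> A \<Longrightarrow> k \<in> A \<Longrightarrow> m < k \<Longrightarrow> a \<in> I m \<Longrightarrow> b \<in> I k \<Longrightarrow> a < b"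
  using assms unfolding ordered_sets_def set_less_def by blast+

lemma ordered_sets_disjoint:
  assumes "ordered_sets A I" "m \<in> A" "k \<in> A" "m \<noteq> k"
  shows "I m \<inter> I k = {}"
  using ordered_setsD(2)[OF assms(1)] assms(2-4) by (metis disjoint_iff less_irrefl linorder_neqE_nat)

text \<open>Restrictions commute, so the outer one can be pushed through the nodes of a norming
  functional down to its coordinates; the defining inequality recombines the pieces.\<close>

lemma norm_restr_le: "norm (restr E x) \<le> norm x"
proof (rule norm_le_normers)
  fix \<phi> assume "\<phi> \<in> normers"
  then show "\<phi> (restr E x) \<le> norm x"
  proof (induction arbitrary: x rule: normers.induct)
    case (unit s i)
    have "s * coord (restr E x) i \<le> \<bar>s * coord (restr E x) i\<bar>" by simp
    also have "\<dots> \<le> \<bar>coord x i\<bar>" using unit by (simp add: abs_mult coord_restr)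
    also have "\<dots> \<le> norm x" by (rule abs_coord_le_norm)
    finally show ?case .
  next
    case (comb n F \<phi>)
    have "1 / slog (real n) * (\<Sum>j=1..n. \<phi> j (restr (F j) (restr E x)))
        \<le> 1 / slog (real n) * (\<Sum>j=1..n. norm (restr (F j) x))"
    proof (intro mult_left_mono sum_mono)
      show "\<phi> j (restr (F j) (restr E x)) \<le> norm (restr (F j) x)" for j
        using comb.IH[rule_format, THEN conjunct2, rule_format, where x = "restr (F j) x"]
        by (simp add: restr_restr Int_commute)
    qed (use slog_gt_1[OF comb.hyps(1)] in auto)
    also have "\<dots> \<le> norm x"
      using sum_norm_restr_le[OF comb.hyps(1,2), of x] slog_gt_1[OF comb.hyps(1)]
      by (simp add: field_simps)
    finally show ?case .
  qed
qed

lemma norm_restr_mono: "E \<subseteq> F \<Longrightarrow> norm (restr E x) \<le> norm (restr F x)"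
  using norm_restr_le[of E "restr F x"] by (simp add: restr_restr Int_absorb2)

text \<open>This is the domination of the unit vector basis by block sequences. A partition at a
  node of the norming functional lifts to one for \<open>y\<close>: each \<open>E j\<close> is
  replaced by the union of the \<open>I m\<close> with \<open>m\<close> in \<open>E j\<close>, and
  these unions are again successive.\<close>

lemma norm_le_of_ordered_sets:
  assumes "ordered_sets UNIV I" "\<And>m. \<bar>coord z m\<bar> \<le> norm (restr (I m) y)"
  shows "norm z \<le> norm y"
proof (rule norm_le_normers)
  fix \<phi> assume "\<phi> \<in> normers"
  then show "\<phi> z \<le> norm y" using assms(2)
  proof (induction arbitrary: y z rule: normers.induct)
    case (unit s i)
    have ne: "s * coord z i \<le> \<bar>coord z i\<bar>"
      using unit.hyps by (metis abs_ge_self abs_mult mult_1)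
    show ?case using unit.prems[of i] ne norm_restr_le[of "I i" y] by linarith
  next
    case (comb n E \<phi>)
    define F where "F j = (\<Union>m\<in>E j. I m)" for j
    have F: "successive n F"
      unfolding successive_def
    proof (intro conjI ballI impI)
      fix j assume "j \<in> {1..n}"
      then show "finite (F j)"
        using comb.hyps(2) ordered_setsD(1)[OF assms(1)] by (simp add: successive_def F_def)
    next
      fix i j assume ij: "i \<in> {1..n}" "j \<in> {1..n}" "i < j"
      show "set_less (F i) (F j)"
        unfolding set_less_def
      proof (intro ballI)
        fix a b assume "a \<in> F i" "b \<in> F j"
        then obtain m k where mk: "m \<in> E i" "a \<in> I m" "k \<in> E j" "b \<in> I k"
          by (auto simp: F_def)
        have "set_less (E i) (E j)" using comb.hyps(2) ij unfolding successive_def by blast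
        then have "m < k" using mk by (simp add: set_less_def)
        then show "a < b" using ordered_setsD(2)[OF assms(1)] mk by blast
      qed
    qed
    have le: "\<phi> j (restr (E j) z) \<le> norm (restr (F j) y)" for j
    proof (rule comb.IH[rule_format, THEN conjunct2, rule_format])
      fix m
      have "m \<in> E j \<Longrightarrow> I m \<inter> F j = I m" by (auto simp: F_def)
      then show "\<bar>coord (restr (E j) z) m\<bar> \<le> norm (restr (I m) (restr (F j) y))"
        using comb.prems[of m] by (auto simp: coord_restr restr_restr)
    qed
    have "1 / slog (real n) * (\<Sum>j=1..n. \<phi> j (restr (E j) z))
        \<le> 1 / slog (real n) * (\<Sum>j=1..n. norm (restr (F j) y))"
      using slog_gt_1[OF comb.hyps(1)] by (intro mult_left_mono sum_mono le) auto
    also have "\<dots> \<le> norm y"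
      using sum_norm_restr_le[OF comb.hyps(1) F, of y] slog_gt_1[OF comb.hyps(1)]
      by (simp add: field_simps)
    finally show ?case .
  qed
qed


text \<open>The defining inequality needs at least two sets; because \<open>slog 0 = 0\<close> and
  \<open>slog 1 = 1\<close>, the same bound holds for none or one. Otherwise the increasing
  enumeration of \<open>J\<close> gives a successive family.\<close>

lemma sum_norm_ordered_sets_le:
  assumes J: "finite J" and I: "ordered_sets J I"
  shows "(\<Sum>j\<in>J. norm (restr (I j) y)) \<le> slog (real (card J)) * norm y"
proof -
  consider "card J = 0" | "card J = 1" | "2 \<le> card J" by linarith
  then show ?thesis
  proof cases
    case 1
    then show ?thesis using J by (simp add: slog_def)
  next
    case 2
    then obtain j where "J = {j}" using card_1_singletonE by blast
    then show ?thesis by (simp add: norm_restr_le)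
  next
    case 3
    obtain h where h: "bij_betw h {..<card J} J" "strict_mono_on {..<card J} h"
      using ex_bij_betw_strict_mono_card[OF J] by (metis lessThan_atLeast0)
    \<comment> \<open>\<open>successive\<close> counts from 1, the enumeration \<open>h\<close> from
      0.\<close>
    define E where "E k = I (h (k - 1))" for k
    have hJ: "h i \<in> J" if "i < card J" for i
      using h(1) that by (auto simp: bij_betw_def)
    have "successive (card J) E"
      unfolding successive_def
    proof (intro conjI ballI impI)
      fix i j assume "i \<in> {1..card J}" "j \<in> {1..card J}" "i < j"
      moreover from this have "h (i - 1) < h (j - 1)"
        by (intro strict_mono_onD[OF h(2)]) auto
      ultimately show "set_less (E i) (E j)"
        using I hJ[of "i - 1"] hJ[of "j - 1"] unfolding E_def ordered_sets_def by auto
    next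
      fix j assume "j \<in> {1..card J}"
      then show "finite (E j)"
        using ordered_setsD(1)[OF I hJ[of "j - 1"]] by (auto simp: E_def)
    qed
    then have "(\<Sum>k=1..card J. norm (restr (E k) y)) \<le> slog (real (card J)) * norm y"
      using 3 by (intro sum_norm_restr_le)
    also have "(\<Sum>k=1..card J. norm (restr (E k) y)) = (\<Sum>k<card J. norm (restr (I (h k)) y))"
      by (rule sum.reindex_bij_witness[of _ Suc "\<lambda>k. k - 1"]) (auto simp: E_def)
    also have "\<dots> = (\<Sum>j\<in>J. norm (restr (I j) y))"
      by (rule sum.reindex_bij_betw[OF h(1)])
    finally show ?thesis .
  qed
qed

section \<open>Norms of flat vectors\<close>

lemma restr_eq_0: "(\<And>i. i \<in> E \<Longrightarrow> coord x i = 0) \<Longrightarrow> restr E x = 0"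
  by (rule c00_eqI) (simp add: coord_restr)

lemma normers_zero: "\<phi> \<in> normers \<Longrightarrow> \<phi> 0 = 0"
  using linear_0[OF linear_normers] .

text \<open>At a node, the pieces of \<open>J\<close> have sizes \<open>r j\<close> with sum
  \<open>R\<close>. Submultiplicativity compares each \<open>r j / slog (r j)\<close> with
  \<open>R / slog R\<close>, and Jensen's inequality with the weights \<open>r j / R\<close> bounds
  the loss by \<open>slog\<close> of the number of pieces, which the factor
  \<open>1 / slog n\<close> cancels.\<close>

lemma normers_flat:
  assumes "\<phi> \<in> normers" "finite J" "J \<noteq> {}"
    "\<And>i. i \<in> J \<Longrightarrow> \<bar>coord x i\<bar> \<le> 1" "\<And>i. i \<notin> J \<Longrightarrow> coord x i = 0"
  shows "\<phi> x \<le> real (card J) / slog (real (card J))"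
  using assms
proof (induction arbitrary: x J rule: normers.induct)
  case (unit s i)
  have c: "1 \<le> real (card J)" using unit.prems by (simp add: Suc_le_eq card_gt_0_iff)
  have "s * coord x i \<le> \<bar>s * coord x i\<bar>" by simp
  also have "\<dots> \<le> 1" using unit by (cases "i \<in> J") (auto simp: abs_mult)
  also have "1 \<le> real (card J) / slog (real (card J))"
    using slog_div_self_mono[OF order_refl c] by simp
  finally show ?case .
next
  case (comb n E \<phi>)
  define Jj where "Jj j = J \<inter> E j" for j
  \<comment> \<open>Sets missing \<open>J\<close> contribute 0; dropping them makes every remaining
    \<open>r j\<close> at least 1, as the estimates for \<open>slog\<close> require.\<close>
  define K where "K = {j \<in> {1..n}. Jj j \<noteq> {}}"
  define r where "r j = real (card (Jj j))" for j
  define R where "R = (\<Sum>j\<in>K. r j)"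
  have fin: "finite (Jj j)" for j using comb.prems by (simp add: Jj_def)
  have f: "slog (real n) > 1" using comb by (intro slog_gt_1)
  have r1: "1 \<le> r j" if "j \<in> K" for j
    using that fin by (simp add: K_def r_def Suc_le_eq card_gt_0_iff)
  have c: "1 \<le> real (card J)" using comb.prems by (simp add: Suc_le_eq card_gt_0_iff)
  have "(\<Sum>j=1..n. \<phi> j (restr (E j) x)) = (\<Sum>j\<in>K. \<phi> j (restr (E j) x))"
  proof (rule sum.mono_neutral_right)
    show "\<forall>j\<in>{1..n} - K. \<phi> j (restr (E j) x) = 0"
    proof
      fix j assume "j \<in> {1..n} - K"
      then have "restr (E j) x = 0"
        using comb.prems by (intro restr_eq_0) (auto simp: K_def Jj_def)
      then show "\<phi> j (restr (E j) x) = 0"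
        using comb.IH normers_zero by auto
    qed
  qed (auto simp: K_def)
  also have "\<dots> \<le> (\<Sum>j\<in>K. r j / slog (r j))"
  proof (rule sum_mono)
    fix j assume j: "j \<in> K"
    show "\<phi> j (restr (E j) x) \<le> r j / slog (r j)"
      unfolding r_def
      by (rule comb.IH[rule_format, THEN conjunct2, rule_format])
        (use comb.prems j fin in \<open>auto simp: K_def Jj_def coord_restr\<close>)
  qed
  finally have 1: "(\<Sum>j=1..n. \<phi> j (restr (E j) x)) \<le> (\<Sum>j\<in>K. r j / slog (r j))" .
  have 2: "(\<Sum>j\<in>K. r j / slog (r j)) \<le> slog (real n) * (real (card J) / slog (real (card J)))"
  proof (cases "K = {}")
    case True
    then show ?thesis using c f slog_ge_1[OF c] by simp
  next
    case False
    have finK: "finite K" by (simp add: K_def)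
    have Rr: "r j \<le> R" if "j \<in> K" for j
      unfolding R_def using that finK r1 by (intro member_le_sum) force+
    then have R1: "1 \<le> R" using False r1 by (meson all_not_in_conv order_trans)
    have "R = real (card (\<Union>j\<in>K. Jj j))"
      unfolding R_def r_def
    proof (subst card_UN_disjoint)
      show "\<forall>i\<in>K. \<forall>j\<in>K. i \<noteq> j \<longrightarrow> Jj i \<inter> Jj j = {}"
      proof (intro ballI impI)
        fix i j assume "i \<in> K" "j \<in> K" "i \<noteq> j"
        then have "set_less (E i) (E j) \<or> set_less (E j) (E i)"
          using comb.hyps(2) unfolding successive_def K_def by (metis (lifting) linorder_neqE_nat mem_Collect_eq)
        then show "Jj i \<inter> Jj j = {}" unfolding set_less_def Jj_def by fastforce
      qed
    qed (use finK fin in auto)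
    also have "\<dots> \<le> real (card J)"
      using comb.prems by (intro of_nat_mono card_mono) (auto simp: Jj_def)
    finally have RJ: "R \<le> real (card J)" .
    have "(\<Sum>j\<in>K. r j / slog (r j)) \<le> (\<Sum>j\<in>K. (R / slog R) * ((r j / R) * slog (1 / (r j / R))))"
    proof (rule sum_mono)
      fix j assume j: "j \<in> K"
      have "slog R = slog (r j * (R / r j))" using r1[OF j] by simp
      also have "\<dots> \<le> slog (r j) * slog (R / r j)"
        using r1[OF j] Rr[OF j] by (intro slog_submult) auto
      finally show "r j / slog (r j) \<le> (R / slog R) * ((r j / R) * slog (1 / (r j / R)))"
        using r1[OF j] R1 slog_ge_1[OF r1[OF j]] slog_ge_1[OF R1] by (simp add: field_simps)
    qed
    also have "\<dots> = (R / slog R) * (\<Sum>j\<in>K. (r j / R) * slog (1 / (r j / R)))"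
      by (simp add: sum_distrib_left)
    also have "\<dots> \<le> (R / slog R) * slog (real (card K))"
    proof (intro mult_left_mono slog_concave_sum)
      show "(\<Sum>j\<in>K. r j / R) = 1" using R1 by (simp add: R_def flip: sum_divide_distrib)
      show "0 < r j / R" if "j \<in> K" for j using r1[OF that] R1 by simp
    qed (use finK False R1 slog_ge_1[OF R1] in auto)
    also have "\<dots> \<le> (real (card J) / slog (real (card J))) * slog (real n)"
    proof (intro mult_mono slog_div_self_mono R1 RJ slog_mono)
      have "card K \<le> card {1..n}" by (intro card_mono) (auto simp: K_def)
      then show "real (card K) \<le> real n" by simp
      show "0 \<le> slog (real (card K))" by (simp add: slog_def)
    qed (use c slog_ge_1[OF c] in auto)
    finally show ?thesis by (simp add: mult.commute)
  qed
  from order_trans[OF 1 2] show ?case using f by (simp add: field_simps)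
qed

section \<open>Coefficients of norming functionals\<close>

lift_definition unit_vec :: "nat \<Rightarrow> c00" is "\<lambda>m i. if i = m then 1 else 0"
  by simp

lemma coord_unit_vec: "coord (unit_vec m) i = (if i = m then 1 else 0)"
  by transfer simp

lemma norm_unit_vec [simp]: "norm (unit_vec m) = 1"
proof (rule antisym)
  show "norm (unit_vec m) \<le> 1"
  proof (rule norm_le_normers)
    fix \<phi> assume "\<phi> \<in> normers"
    from normers_flat[OF this, of "{m}" "unit_vec m"] show "\<phi> (unit_vec m) \<le> 1"
      by (auto simp: coord_unit_vec)
  qed
  show "1 \<le> norm (unit_vec m)"
    using abs_coord_le_norm[of "unit_vec m" m] by (simp add: coord_unit_vec)
qed

lemma normers_abs_le: "\<phi> \<in> normers \<Longrightarrow> \<bar>\<phi> x\<bar> \<le> norm x"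
  using normers_le_norm[of \<phi> x] normers_le_norm[OF normers_uminus, of \<phi> x] by simp

lemma normers_expand:
  assumes "\<phi> \<in> normers" "finite M" "\<And>m. m \<notin> M \<Longrightarrow> coord z m = 0"
  shows "\<phi> z = (\<Sum>m\<in>M. \<phi> (unit_vec m) * coord z m)"
proof -
  have "z = (\<Sum>m\<in>M. coord z m *\<^sub>R unit_vec m)"
    by (rule c00_eqI)
      (use assms(2,3) in \<open>auto simp: coord_sum coord_unit_vec if_distrib[of "(*) _"] sum.delta cong: if_cong\<close>)
  then have "\<phi> z = \<phi> (\<Sum>m\<in>M. coord z m *\<^sub>R unit_vec m)" by simp
  then show ?thesis
    by (simp add: linear_sum[OF linear_normers[OF assms(1)]] normers_scaleR[OF assms(1)] mult.commute)
qed

text \<open>With the signs of \<open>\<phi> (unit_vec m)\<close> put on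
  \<open>\<bar>t m\<bar>\<close>, the sum becomes \<open>\<phi> z\<close> for a vector
  \<open>z\<close> that is dominated blockwise by \<open>y\<close>.\<close>

lemma normers_sum_abs_le:
  assumes \<phi>: "\<phi> \<in> normers" and G: "finite G" and I: "ordered_sets UNIV I"
    and t: "\<And>m. m \<in> G \<Longrightarrow> \<bar>t m\<bar> \<le> norm (restr (I m) y)"
  shows "(\<Sum>m\<in>G. \<bar>\<phi> (unit_vec m)\<bar> * \<bar>t m\<bar>) \<le> norm y"
proof -
  define z where "z = Abs_c00 (\<lambda>m. if m \<in> G then sgn (\<phi> (unit_vec m)) * \<bar>t m\<bar> else 0)"
  have cz: "coord z m = (if m \<in> G then sgn (\<phi> (unit_vec m)) * \<bar>t m\<bar> else 0)" for m
    unfolding z_def by (subst coord_Abs_c00) (auto intro: finite_subset[OF _ G])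
  have "(\<Sum>m\<in>G. \<bar>\<phi> (unit_vec m)\<bar> * \<bar>t m\<bar>) = \<phi> z"
    by (subst normers_expand[OF \<phi> G]) (auto simp: cz abs_sgn mult_ac intro!: sum.cong)
  also have "\<dots> \<le> norm z" by (rule normers_le_norm[OF \<phi>])
  also have "\<dots> \<le> norm y"
  proof (rule norm_le_of_ordered_sets[OF I])
    fix m
    show "\<bar>coord z m\<bar> \<le> norm (restr (I m) y)"
      using t[of m] by (auto simp: cz abs_mult abs_sgn_eq)
  qed
  finally show ?thesis .
qed

text \<open>On the vector of signs over \<open>B\<close> the functional takes at least the value
  \<open>\<eta> * card B\<close>, but a flat vector allows at most
  \<open>card B / slog (card B)\<close>; hence
  \<open>slog (card B) \<le> 1 / \<eta>\<close>.\<close>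

lemma card_large_coeffs_le:
  assumes \<phi>: "\<phi> \<in> normers" and B: "finite B" and \<eta>: "0 < \<eta>"
    "\<And>m. m \<in> B \<Longrightarrow> \<eta> \<le> \<bar>\<phi> (unit_vec m)\<bar>"
  shows "real (card B) \<le> 2 powr (1 / \<eta>)"
proof (cases "B = {}")
  case False
  define z where "z = Abs_c00 (\<lambda>m. if m \<in> B then sgn (\<phi> (unit_vec m)) else 0)"
  have cz: "coord z m = (if m \<in> B then sgn (\<phi> (unit_vec m)) else 0)" for m
    unfolding z_def by (subst coord_Abs_c00) (auto intro: finite_subset[OF _ B])
  have c: "1 \<le> real (card B)" using False B by (simp add: Suc_le_eq card_gt_0_iff)
  have "real (card B) * \<eta> = (\<Sum>m\<in>B. \<eta>)" by simp
  also have "\<dots> \<le> (\<Sum>m\<in>B. \<bar>\<phi> (unit_vec m)\<bar>)" by (intro sum_mono \<eta>)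
  also have "\<dots> = \<phi> z"
    by (subst normers_expand[OF \<phi> B]) (auto simp: cz abs_sgn mult_ac intro!: sum.cong)
  also have "\<dots> \<le> real (card B) / slog (real (card B))"
    by (rule normers_flat[OF \<phi> B False]) (auto simp: cz abs_sgn_eq)
  finally have "\<eta> * slog (real (card B)) \<le> 1"
    using c slog_ge_1[OF c] by (simp add: field_simps)
  then have "slog (real (card B)) \<le> 1 / \<eta>" using \<eta>(1) by (simp add: field_simps)
  then have "real (card B) + 1 \<le> 2 powr (1 / \<eta>)"
    unfolding slog_def using c by (subst (asm) log_le_iff) auto
  then show ?thesis by simp
qed simp

section \<open>Replacing a coordinate by a flat vector\<close>

lemma log2_le: "0 < t \<Longrightarrow> log 2 t \<le> 2 * t"
proof -
  assume t: "0 < t"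
  have "ln t \<le> t" using ln_le_minus_one[OF t] by simp
  also have "t \<le> (2 * t) * ln 2" using ln2_ge_two_thirds t by simp
  finally show ?thesis by (simp add: log_def field_simps)
qed

text \<open>By \<open>normers_flat\<close>, the left side divided by \<open>n\<close> bounds the
  norm of \<open>r\<close> points of a normalized flat vector of length \<open>n\<close>; so these
  carry hardly more than their proportional share. The reason is that \<open>slog n\<close> exceeds
  \<open>slog r\<close> by at most \<open>log 2 (n / r)\<close>.\<close>

lemma flat_asymptotics:
  assumes "0 < \<epsilon>"
  shows "\<exists>N. \<forall>n\<ge>N. \<forall>r\<in>{1..n}. real r * (slog (real n) / slog (real r)) \<le> real r + real n * \<epsilon>"
proof -
  define R where "R = 2 powr (2 / \<epsilon>)"
  obtain N :: nat where N: "(4 * R / \<epsilon>)\<^sup>2 \<le> real N" using real_arch_simple by blast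
  have "real r * (slog (real n) / slog (real r)) \<le> real r + real n * \<epsilon>"
    if n: "n \<ge> N" and r: "r \<in> {1..n}" for n r
  proof -
    have r1: "1 \<le> real r" and rn: "real r \<le> real n" using r by auto
    have sr: "1 \<le> slog (real r)" using r1 by (rule slog_ge_1)
    have "(real n + 1) \<le> (real r + 1) * (real n / real r)"
      using r1 rn by (simp add: field_simps)
    then have "slog (real n) \<le> log 2 ((real r + 1) * (real n / real r))"
      unfolding slog_def using r1 rn by (subst log_le_cancel_iff) auto
    also have "\<dots> = slog (real r) + log 2 (real n / real r)"
      using r1 rn by (subst log_mult) (auto simp: slog_def)
    finally have "real r * (slog (real n) / slog (real r))
        \<le> real r * ((slog (real r) + log 2 (real n / real r)) / slog (real r))"
      using sr r1 by (intro mult_left_mono divide_right_mono) auto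
    also have "\<dots> = real r + real r * log 2 (real n / real r) / slog (real r)"
      using sr by (simp add: field_simps)
    also have "real r * log 2 (real n / real r) / slog (real r) \<le> real n * \<epsilon>"
    \<comment> \<open>For large \<open>r\<close> the denominator beats the bound
      \<open>log 2 t \<le> 2 * t\<close>; otherwise \<open>r\<close> is below the constant
      \<open>R\<close>, and a logarithm of \<open>n\<close> is negligible against
      \<open>n\<close>.\<close>
    proof (cases "2 / \<epsilon> \<le> slog (real r)")
      case True
      have "real r * log 2 (real n / real r) \<le> real r * (2 * (real n / real r))"
        using r1 rn by (intro mult_left_mono log2_le) auto
      also have "\<dots> = 2 * real n" using r1 by simp
      also have "\<dots> \<le> real n * \<epsilon> * slog (real r)"
        using mult_left_mono[of 2 "\<epsilon> * slog (real r)" "real n"] True assms by (simp add: field_simps)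
      finally show ?thesis using sr by (simp add: field_simps)
    next
      case False
      have "real r + 1 \<le> R"
      proof -
        have "log 2 (real r + 1) \<le> 2 / \<epsilon>" using False by (simp add: slog_def)
        then show ?thesis unfolding R_def using r1 by (subst (asm) log_le_iff) auto
      qed
      then have rR: "real r \<le> R" by simp
      have nR: "4 * R / \<epsilon> \<le> sqrt (real n)"
        using N n by (intro real_le_rsqrt) (meson of_nat_mono order_trans)
      have "log 2 (real n / real r) \<le> log 2 (real n)"
        using r1 rn by (subst log_le_cancel_iff) (auto simp: field_simps)
      also have "\<dots> = 2 * log 2 (sqrt (real n))"
        using r1 rn by (simp add: log_def ln_sqrt)
      also have "\<dots> \<le> 2 * (2 * sqrt (real n))"
        using r1 rn by (intro mult_left_mono log2_le) auto
      finally have l: "log 2 (real n / real r) \<le> 4 * sqrt (real n)" by simp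
      have l0: "0 \<le> log 2 (real n / real r)" using r1 rn by (intro zero_le_log_cancel_iff[THEN iffD2]) auto
      have "real r * log 2 (real n / real r) / slog (real r) \<le> real r * log 2 (real n / real r) / 1"
        using sr r1 l0 by (intro divide_left_mono) auto
      also have "\<dots> \<le> R * (4 * sqrt (real n))"
        using rR r1 l l0 by (simp, intro mult_mono) auto
      also have "\<dots> = (4 * R / \<epsilon>) * (sqrt (real n) * \<epsilon>)" using assms by simp
      also have "\<dots> \<le> sqrt (real n) * (sqrt (real n) * \<epsilon>)"
        using nR assms by (intro mult_right_mono) auto
      also have "\<dots> = real n * \<epsilon>" by (simp flip: mult.assoc)
      finally show ?thesis .
    qed
    finally show ?thesis by simp
  qed
  then show ?thesis by blast
qed

text \<open>\<open>collapse\<close> contracts the interval of length \<open>n\<close> at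
  \<open>p\<close> to the point \<open>p\<close> and closes the gap; for \<open>l\<close> in the
  interval, \<open>section_at\<close> below is the increasing right inverse that selects
  \<open>l\<close>.\<close>

definition collapse :: "nat \<Rightarrow> nat \<Rightarrow> nat \<Rightarrow> nat" where
  "collapse p n j = (if j < p then j else if j < p + n then p else j + 1 - n)"

definition section_at :: "nat \<Rightarrow> nat \<Rightarrow> nat \<Rightarrow> nat \<Rightarrow> nat" where
  "section_at p n l q = (if q < p then q else if q = p then l else q + n - 1)"

lemma collapse_section_at: "l \<in> {p..<p + n} \<Longrightarrow> collapse p n (section_at p n l q) = q"
  by (auto simp: collapse_def section_at_def)

lemma section_at_collapse: "j \<notin> {p..<p + n} \<Longrightarrow> section_at p n l (collapse p n j) = j"
  by (auto simp: collapse_def section_at_def)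

lemma section_at_mono: "l \<in> {p..<p + n} \<Longrightarrow> q < q' \<Longrightarrow> section_at p n l q < section_at p n l q'"
  by (auto simp: section_at_def)

lemma section_at_inj: "l \<in> {p..<p + n} \<Longrightarrow> inj (section_at p n l)"
  by (metis collapse_section_at injI)

lemma collapse_eq_p: "1 \<le> n \<Longrightarrow> collapse p n j = p \<longleftrightarrow> j \<in> {p..<p + n}"
  by (auto simp: collapse_def)

lemma mono_collapse: "1 \<le> n \<Longrightarrow> j \<le> j' \<Longrightarrow> collapse p n j \<le> collapse p n j'"
  by (auto simp: collapse_def)

text \<open>The factor \<open>slog n / n\<close> is dual to the weight \<open>1 / slog n\<close> of
  the \<open>n\<close> children that replace a leaf, so the pairing of vector and functional is
  preserved.\<close>

definition expand_vec :: "nat \<Rightarrow> nat \<Rightarrow> c00 \<Rightarrow> c00" where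
  "expand_vec p n w =
     Abs_c00 (\<lambda>j. coord w (collapse p n j) * (if collapse p n j = p then slog (real n) / real n else 1))"

lemma coord_bounded: "\<exists>b. \<forall>i\<ge>b. coord w i = 0"
proof -
  obtain b where "\<forall>i\<in>{i. coord w i \<noteq> 0}. i < b" 
    using finite_nat_set_iff_bounded finite_supp by blast
  then show ?thesis by (intro exI[of _ b]) force
qed

lemma coord_expand_vec:
  "coord (expand_vec p n w) j =
     coord w (collapse p n j) * (if collapse p n j = p then slog (real n) / real n else 1)"
proof -
  define g where "g j = coord w (collapse p n j) * (if collapse p n j = p then slog (real n) / real n else 1)" for j
  obtain b where b: "\<forall>i\<ge>b. coord w i = 0" using coord_bounded by blast
  have "{j. g j \<noteq> 0} \<subseteq> {..b + n + p}"
  proof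
    fix j assume "j \<in> {j. g j \<noteq> 0}"
    then have "collapse p n j < b" using b by (auto simp: g_def not_le[symmetric])
    then show "j \<in> {..b + n + p}" by (auto simp: collapse_def split: if_splits)
  qed
  then have "finite {j. g j \<noteq> 0}" by (rule finite_subset) simp
  then have "coord (Abs_c00 g) = g" by (rule coord_Abs_c00)
  then show ?thesis by (simp add: expand_vec_def g_def[abs_def])
qed

lemma successive_vimage_section_at:
  assumes l: "l \<in> {p..<p + n}" and E: "successive k E"
  shows "successive k (\<lambda>j. section_at p n l -` E j)"
proof -
  have less: "q < q'" if "section_at p n l q < section_at p n l q'" for q q'
    using that section_at_mono[OF l, of q' q] by (metis less_asym linorder_neqE_nat order.irrefl)
  show ?thesis
    unfolding successive_def
  proof (intro conjI ballI impI)
    fix j assume "j \<in> {1..k}"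
    then show "finite (section_at p n l -` E j)"
      using E by (intro finite_vimageI section_at_inj l) (auto simp: successive_def)
  next
    fix i j assume "i \<in> {1..k}" "j \<in> {1..k}" "i < j"
    then have "set_less (E i) (E j)" using E unfolding successive_def by blast
    then show "set_less (section_at p n l -` E i) (section_at p n l -` E j)"
      unfolding set_less_def using less by blast
  qed
qed

text \<open>The average \<open>A E\<close> over all ways to contract the flat block to one of its points behaves
  additively under partitions of \<open>E\<close>, so it passes through the inductive definition of the norming
  functionals. Errors only arise at nodes which see coordinates outside the block; charging \<open>\<epsilon>\<close> to each
  such coordinate works because the weights \<open>1 / slog k\<close> are at most \<open>1 / slog 2 < 1\<close>.\<close>

lemma norm_expand_vec_le_aux:
  assumes n: "1 \<le> n" and \<epsilon>: "0 < \<epsilon>" and \<omega>: "0 \<le> \<omega>"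
    and flat: "\<forall>r\<in>{1..n}. real r * (slog (real n) / slog (real r)) \<le> real r + real n * \<omega>"
    and k0: "2 \<le> k0" "l1 w \<le> slog (real k0) * \<epsilon>"
    and \<omega>k0: "real k0 * (\<bar>coord w p\<bar> * \<omega>) \<le> (1 - 1 / slog 2) * \<epsilon>"
  shows "norm (expand_vec p n w) \<le> norm w + real (card {i. coord w i \<noteq> 0}) * \<epsilon> + \<bar>coord w p\<bar> * \<omega>"
proof -
  define w' where "w' = expand_vec p n w"
  define Q where "Q = {p..<p + n}"
  define t where "t = \<bar>coord w p\<bar>"
  \<comment> \<open>\<open>S E l\<close> is the part of \<open>w\<close> that \<open>E\<close> sees
    when the block \<open>Q\<close> is contracted to its point \<open>l\<close>.\<close>
  define S where "S E l = restr (section_at p n l -` E) w" for E l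
  define A where "A E = (\<Sum>l\<in>Q. norm (S E l)) / real n" for E
  define c where "c E = card {j \<in> E. coord w' j \<noteq> 0 \<and> j \<notin> Q}" for E
  have cw': "coord w' j = coord w (collapse p n j) * (if j \<in> Q then slog (real n) / real n else 1)" for j
    unfolding w'_def Q_def using collapse_eq_p[OF n] by (simp add: coord_expand_vec)
  have colp: "collapse p n i = p" if "i \<in> Q" for i
    using that collapse_eq_p[OF n] by (simp add: Q_def)
  have n0: "0 < real n" using n by simp
  have sn: "1 \<le> slog (real n)" using n by (intro slog_ge_1) simp
  have finQ: "finite Q" and cardQ: "card Q = n" by (auto simp: Q_def)
  have finc: "finite {j \<in> E. coord w' j \<noteq> 0 \<and> j \<notin> Q}" for E
    by (rule finite_subset[OF _ finite_supp[of w']]) auto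
  have A_ge: "t * real (card (E \<inter> Q)) / real n \<le> A E" for E
  proof -
    have "t * real (card (E \<inter> Q)) = (\<Sum>l\<in>E \<inter> Q. t)" by simp
    also have "\<dots> \<le> (\<Sum>l\<in>E \<inter> Q. norm (S E l))"
    proof (rule sum_mono)
      fix l assume "l \<in> E \<inter> Q"
      then have "t = \<bar>coord (S E l) p\<bar>" by (simp add: S_def coord_restr t_def section_at_def)
      then show "t \<le> norm (S E l)" using abs_coord_le_norm by simp
    qed
    also have "\<dots> \<le> (\<Sum>l\<in>Q. norm (S E l))" using finQ by (intro sum_mono2) auto
    finally show ?thesis unfolding A_def using n0 by (intro divide_right_mono) auto
  qed
  have A_coord: "\<bar>coord w' i\<bar> \<le> A E" if "i \<in> E" "i \<notin> Q" for i E
  proof -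
    have "real n * \<bar>coord w' i\<bar> = (\<Sum>l\<in>Q. \<bar>coord w' i\<bar>)" by (simp add: cardQ)
    also have "\<dots> \<le> (\<Sum>l\<in>Q. norm (S E l))"
    proof (rule sum_mono)
      fix l assume "l \<in> Q"
      have "coord (S E l) (collapse p n i) = coord w' i"
        using that section_at_collapse[of i p n l] cw'[of i] by (simp add: S_def coord_restr flip: Q_def)
      then show "\<bar>coord w' i\<bar> \<le> norm (S E l)" using abs_coord_le_norm by metis
    qed
    finally show ?thesis unfolding A_def using n0 by (simp add: field_simps)
  qed
  \<comment> \<open>Inside the block the flat estimate applies after rescaling to height one;
    \<open>flat\<close> turns it into the proportional share of \<open>t\<close>, which
    \<open>A_ge\<close> bounds by \<open>A E\<close>, plus an error.\<close>
  have block: "\<phi> (restr (E \<inter> Q) w') \<le> A E + t * \<omega>" if \<phi>: "\<phi> \<in> normers" for \<phi> E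
  proof (cases "E \<inter> Q = {} \<or> t = 0")
    case True
    then have "restr (E \<inter> Q) w' = 0"
      by (intro restr_eq_0) (auto simp: cw' t_def colp)
    moreover have "0 \<le> A E" unfolding A_def by (simp add: sum_nonneg)
    ultimately show ?thesis using \<omega> by (simp add: normers_zero[OF \<phi>] t_def)
  next
    case False
    define r where "r = card (E \<inter> Q)"
    define s where "s = real n / (t * slog (real n))"
    have t: "0 < t" using False by (auto simp: t_def)
    have s: "0 < s" using t sn n0 by (simp add: s_def)
    have r: "r \<in> {1..n}"
      using False finQ card_mono[OF finQ, of "E \<inter> Q"] cardQ
      by (auto simp: r_def Suc_le_eq card_gt_0_iff)
    have "\<phi> (s *\<^sub>R restr (E \<inter> Q) w') \<le> real r / slog (real r)"
      unfolding r_def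
    proof (rule normers_flat[OF \<phi>])
      fix i assume "i \<in> E \<inter> Q"
      then have "collapse p n i = p" by (simp add: colp)
      then have "\<bar>coord (s *\<^sub>R restr (E \<inter> Q) w') i\<bar> = s * (t * (slog (real n) / real n))"
        using \<open>i \<in> E \<inter> Q\<close> s sn by (simp add: coord_restr cw' abs_mult t_def)
      also have "\<dots> = 1" using t sn n0 by (simp add: s_def)
      finally show "\<bar>coord (s *\<^sub>R restr (E \<inter> Q) w') i\<bar> \<le> 1" by simp
    qed (use False finQ in \<open>auto simp: coord_restr\<close>)
    then have "s * \<phi> (restr (E \<inter> Q) w') \<le> real r / slog (real r)" by (simp add: normers_scaleR[OF \<phi>])
    then have "\<phi> (restr (E \<inter> Q) w') \<le> (real r / slog (real r)) / s"
      using s by (subst pos_le_divide_eq) (simp_all add: mult.commute)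
    also have "\<dots> = t / real n * (real r * (slog (real n) / slog (real r)))"
      by (simp add: s_def mult_ac)
    also have "\<dots> \<le> t / real n * (real r + real n * \<omega>)"
      using flat r t n0 by (intro mult_left_mono) auto
    also have "\<dots> = t * real r / real n + t * \<omega>" using n0 by (simp add: field_simps)
    finally show ?thesis using A_ge[of E] by (simp add: r_def)
  qed
  have split: "\<phi> (restr E w') = \<phi> (restr (E \<inter> Q) w') + \<phi> (restr (E - Q) w')" if "\<phi> \<in> normers" for \<phi> E
    unfolding normers_plus[OF that, symmetric]
    by (rule arg_cong[where f = \<phi>], rule c00_eqI) (auto simp: coord_restr)
  have l1w': "l1 (restr (E - Q) w') \<le> l1 w" for E
  proof -
    have "l1 (restr (E - Q) w') = (\<Sum>i\<in>{i. coord w' i \<noteq> 0} \<inter> (E - Q). \<bar>coord w' i\<bar>)" by (rule l1_restr)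
    also have "\<dots> = (\<Sum>i\<in>{i. coord w' i \<noteq> 0} \<inter> (E - Q). \<bar>coord w (collapse p n i)\<bar>)"
      by (rule sum.cong) (auto simp: cw')
    also have "\<dots> = (\<Sum>i\<in>collapse p n ` ({i. coord w' i \<noteq> 0} \<inter> (E - Q)). \<bar>coord w i\<bar>)"
      by (rule sum.reindex[symmetric, unfolded o_def])
        (rule inj_on_inverseI[of _ "section_at p n p"], auto simp: section_at_collapse Q_def)
    also have "\<dots> \<le> l1 w" unfolding l1_def
      by (rule sum_mono2) (auto simp: finite_supp cw')
    finally show ?thesis .
  qed
  have c0: "\<phi> (restr E w') \<le> A E + t * \<omega>" if "\<phi> \<in> normers" "c E = 0" for \<phi> E
  proof -
    have "restr (E - Q) w' = 0" using that(2) finc[of E] by (intro restr_eq_0) (auto simp: c_def)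
    then show ?thesis using split[OF that(1), of E] block[OF that(1), of E] normers_zero[OF that(1)] by simp
  qed
  have key: "\<phi> (restr E w') \<le> A E + real (c E) * \<epsilon> + t * \<omega>" if "\<phi> \<in> normers" for \<phi> E
    using that
  proof (induction arbitrary: E rule: normers.induct)
    case (unit s i)
    have nm: "(\<lambda>x. s * coord x i) \<in> normers" using unit by (rule normers.unit)
    have ce: "0 \<le> real (c E) * \<epsilon>" using \<epsilon> by simp
    show ?case
    proof (cases "i \<in> E \<and> i \<notin> Q")
      case True
      have "s * coord (restr E w') i \<le> \<bar>s * coord (restr E w') i\<bar>" by simp
      also have "\<dots> = \<bar>coord w' i\<bar>" using unit True by (simp add: abs_mult coord_restr)
      finally show ?thesis using A_coord[of i E] True ce \<omega> t_def by (smt (verit) abs_ge_zero mult_nonneg_nonneg)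
    next
      case False
      then have "coord (restr E w') i = coord (restr (E \<inter> Q) w') i" by (simp add: coord_restr)
      then show ?thesis using block[OF nm, of E] ce by simp
    qed
  next
    case (comb k F \<phi>)
    have fk: "slog (real k) > 1" using comb by (intro slog_gt_1)
    have nm: "(\<lambda>x. 1 / slog (real k) * (\<Sum>j=1..k. \<phi> j (restr (F j) x))) \<in> normers"
      using comb by (intro normers.comb) auto
    \<comment> \<open>A set that sees only the block is estimated as a whole by \<open>c0\<close>,
      without splitting at the node, so the errors of the children do not add up.\<close>
    show ?case
    proof (cases "c E = 0")
      case True
      then show ?thesis using c0[OF nm] by simp
    next
      case c: False
      show ?thesis
      \<comment> \<open>For \<open>k \<ge> k0\<close> the weight \<open>1 / slog k\<close> makes
        everything outside the block at most \<open>\<epsilon>\<close>, which a single charged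
        coordinate pays for. For smaller \<open>k\<close> the induction hypothesis is applied to the
        children.\<close>
      proof (cases "k0 \<le> k")
        case True
        have "(\<Sum>j=1..k. \<phi> j (restr (F j) (restr (E - Q) w'))) \<le> (\<Sum>j=1..k. l1 (restr (F j) (restr (E - Q) w')))"
          using comb.IH by (intro sum_mono normers_le_l1) auto
        also have "\<dots> \<le> l1 w" using l1_sum[OF comb.hyps(2)] l1w' order_trans by blast
        also have "\<dots> \<le> slog (real k0) * \<epsilon>" by (rule k0)
        also have "\<dots> \<le> slog (real k) * \<epsilon>" using True \<epsilon> by (intro mult_right_mono slog_mono) auto
        finally have "1 / slog (real k) * (\<Sum>j=1..k. \<phi> j (restr (F j) (restr (E - Q) w'))) \<le> \<epsilon>"
          using fk by (simp add: field_simps)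
        also have "\<epsilon> \<le> real (c E) * \<epsilon>" using c \<epsilon> by simp
        finally show ?thesis using block[OF nm, of E] split[OF nm, of E] by simp
      next
        case False
        have "(\<Sum>j=1..k. \<phi> j (restr (F j) (restr E w')))
            \<le> (\<Sum>j=1..k. A (F j \<inter> E) + real (c (F j \<inter> E)) * \<epsilon> + t * \<omega>)"
          using comb.IH by (intro sum_mono) (simp add: restr_restr)
        also have "\<dots> = (\<Sum>j=1..k. A (F j \<inter> E)) + real (\<Sum>j=1..k. c (F j \<inter> E)) * \<epsilon> + real k * (t * \<omega>)"
          by (simp add: sum.distrib sum_distrib_right)
        \<comment> \<open>Pulled back along a section, the sets \<open>F j\<close> stay successive,
          so the defining inequality holds for each \<open>S E l\<close> and hence for the
          average.\<close>
        also have "(\<Sum>j=1..k. A (F j \<inter> E)) \<le> slog (real k) * A E"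
        proof -
          have "(\<Sum>j=1..k. A (F j \<inter> E)) = (\<Sum>l\<in>Q. \<Sum>j=1..k. norm (S (F j \<inter> E) l)) / real n"
            unfolding A_def sum_divide_distrib[symmetric] by (subst sum.swap) simp
          also have "\<dots> \<le> (\<Sum>l\<in>Q. slog (real k) * norm (S E l)) / real n"
          proof (intro divide_right_mono sum_mono)
            fix l assume l: "l \<in> Q"
            have "(\<Sum>j=1..k. norm (restr (section_at p n l -` F j) (S E l))) \<le> slog (real k) * norm (S E l)"
              using l comb by (intro sum_norm_restr_le successive_vimage_section_at) (auto simp: Q_def)
            then show "(\<Sum>j=1..k. norm (S (F j \<inter> E) l)) \<le> slog (real k) * norm (S E l)"
              by (simp add: S_def restr_restr vimage_Int)
          qed simp
          also have "\<dots> = slog (real k) * A E" by (simp add: A_def sum_distrib_left)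
          finally show ?thesis .
        qed
        also have "(\<Sum>j=1..k. c (F j \<inter> E)) \<le> c E"
        proof -
          have "(\<Sum>j=1..k. c (F j \<inter> E)) = card (\<Union>j\<in>{1..k}. {i \<in> F j \<inter> E. coord w' i \<noteq> 0 \<and> i \<notin> Q})"
            unfolding c_def
          proof (rule card_UN_disjoint[symmetric])
            show "\<forall>i\<in>{1..k}. \<forall>j\<in>{1..k}. i \<noteq> j \<longrightarrow>
                {a \<in> F i \<inter> E. coord w' a \<noteq> 0 \<and> a \<notin> Q} \<inter> {a \<in> F j \<inter> E. coord w' a \<noteq> 0 \<and> a \<notin> Q} = {}"
            proof (intro ballI impI)
              fix i j assume "i \<in> {1..k}" "j \<in> {1..k}" "i \<noteq> j"
              then have "set_less (F i) (F j) \<or> set_less (F j) (F i)"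
                using comb.hyps(2) unfolding successive_def by (metis linorder_neqE_nat)
              then show "{a \<in> F i \<inter> E. coord w' a \<noteq> 0 \<and> a \<notin> Q} \<inter> {a \<in> F j \<inter> E. coord w' a \<noteq> 0 \<and> a \<notin> Q} = {}"
                unfolding set_less_def by fastforce
            qed
          qed (use finc in auto)
          also have "\<dots> \<le> c E" unfolding c_def by (intro card_mono finc) auto
          finally show ?thesis .
        qed
        finally have "(\<Sum>j=1..k. \<phi> j (restr (F j) (restr E w')))
            \<le> slog (real k) * A E + real (c E) * \<epsilon> + real k * (t * \<omega>)"
          using \<epsilon> by (simp add: mult_right_mono)
        then have "1 / slog (real k) * (\<Sum>j=1..k. \<phi> j (restr (F j) (restr E w')))
            \<le> 1 / slog (real k) * (slog (real k) * A E + real (c E) * \<epsilon> + real k * (t * \<omega>))"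
          using fk by (intro mult_left_mono) auto
        also have "\<dots> = A E + 1 / slog (real k) * (real (c E) * \<epsilon>) + 1 / slog (real k) * (real k * (t * \<omega>))"
          using fk by (simp add: field_simps)
        also have "1 / slog (real k) * (real (c E) * \<epsilon>) \<le> 1 / slog 2 * (real (c E) * \<epsilon>)"
          using comb.hyps(1) slog_gt_1[of 2] fk \<epsilon>
          by (intro mult_right_mono divide_left_mono slog_mono) auto
        also have "1 / slog (real k) * (real k * (t * \<omega>)) \<le> 1 * (real k0 * (t * \<omega>))"
          using False fk \<omega> by (intro mult_mono mult_right_mono) (auto simp: t_def)
        \<comment> \<open>The factor \<open>1 / slog 2\<close> gained on the charges leaves room for
          the errors of fewer than \<open>k0\<close> children.\<close>
        also have "1 * (real k0 * (t * \<omega>)) \<le> (1 - 1 / slog 2) * (real (c E) * \<epsilon>)"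
        proof -
          have "(1 - 1 / slog 2) * \<epsilon> \<le> (1 - 1 / slog 2) * (real (c E) * \<epsilon>)"
            using c \<epsilon> slog_gt_1[of 2] by (intro mult_left_mono) auto
          then show ?thesis using \<omega>k0 by (simp add: t_def)
        qed
        finally have "1 / slog (real k) * (\<Sum>j=1..k. \<phi> j (restr (F j) (restr E w'))) \<le> A E + real (c E) * \<epsilon>"
          by (simp add: algebra_simps)
        moreover have "0 \<le> t * \<omega>" using \<omega> by (simp add: t_def)
        ultimately show ?thesis by linarith
      qed
    qed
  qed
  have "A UNIV = norm w"
  proof -
    have "restr UNIV w = w" by (rule c00_eqI) (simp add: coord_restr)
    then show ?thesis using n0 by (simp add: A_def S_def cardQ)
  qed
  moreover have "c UNIV \<le> card {i. coord w i \<noteq> 0}"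
    unfolding c_def
  proof (rule card_inj_on_le[of "collapse p n"])
    show "inj_on (collapse p n) {j \<in> UNIV. coord w' j \<noteq> 0 \<and> j \<notin> Q}"
      by (rule inj_on_inverseI[of _ "section_at p n p"]) (auto simp: section_at_collapse Q_def)
  qed (auto simp: cw' finite_supp)
  ultimately have "A UNIV + real (c UNIV) * \<epsilon> + t * \<omega>
      \<le> norm w + real (card {i. coord w i \<noteq> 0}) * \<epsilon> + t * \<omega>"
    using \<epsilon> by (simp add: mult_right_mono)
  moreover have "restr UNIV w' = w'" by (rule c00_eqI) (simp add: coord_restr)
  ultimately show ?thesis
    unfolding w'_def[symmetric] t_def[symmetric]
    using key[of _ UNIV] by (intro norm_le_normers) (smt (verit))
qed

text \<open>The constants are fixed in the order \<open>\<epsilon>1\<close>, \<open>k0\<close>,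
  \<open>\<omega>\<close>, \<open>N\<close>: first the charge per coordinate, then a branching
  number that makes the \<open>l1\<close> norm harmless, then a flatness error small against
  both.\<close>

lemma norm_expand_vec_le:
  assumes "0 < \<epsilon>"
  shows "\<exists>N. \<forall>n\<ge>N. norm (expand_vec p n w) \<le> norm w + \<epsilon>"
proof -
  define \<epsilon>1 where "\<epsilon>1 = \<epsilon> / (2 * (real (card {i. coord w i \<noteq> 0}) + 1))"
  have \<epsilon>1: "0 < \<epsilon>1" using assms by (simp add: \<epsilon>1_def add_nonneg_pos)
  obtain k1 :: nat where k1: "2 powr (l1 w / \<epsilon>1) \<le> real k1" using real_arch_simple by blast
  define k0 where "k0 = max 2 k1"
  have "l1 w / \<epsilon>1 = log 2 (2 powr (l1 w / \<epsilon>1))" by simp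
  also have "\<dots> \<le> slog (real k0)"
    unfolding slog_def using k1 by (subst log_le_cancel_iff) (auto simp: k0_def)
  finally have k0: "2 \<le> k0" "l1 w \<le> slog (real k0) * \<epsilon>1"
    using \<epsilon>1 by (auto simp: k0_def field_simps)
  define \<omega> where "\<omega> = min ((1 - 1 / slog 2) * \<epsilon>1 / (real k0 * (\<bar>coord w p\<bar> + 1))) (\<epsilon> / (2 * (\<bar>coord w p\<bar> + 1)))"
  have s2: "0 < 1 - 1 / slog 2" using slog_gt_1[of 2] by simp
  have \<omega>: "0 < \<omega>" unfolding \<omega>_def using s2 \<epsilon>1 assms k0(1)
    by (auto intro!: divide_pos_pos mult_pos_pos add_nonneg_pos)
  have "\<bar>coord w p\<bar> * \<omega> \<le> (\<bar>coord w p\<bar> + 1) * \<omega>" using \<omega> by (intro mult_right_mono) auto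
  also have "\<dots> \<le> (\<bar>coord w p\<bar> + 1) * ((1 - 1 / slog 2) * \<epsilon>1 / (real k0 * (\<bar>coord w p\<bar> + 1)))"
    by (intro mult_left_mono) (auto simp: \<omega>_def)
  also have "\<dots> = (1 - 1 / slog 2) * \<epsilon>1 / real k0"
    by (simp add: divide_simps)
  finally have w1: "real k0 * (\<bar>coord w p\<bar> * \<omega>) \<le> (1 - 1 / slog 2) * \<epsilon>1"
    using k0(1) by (simp add: field_simps)
  have "\<bar>coord w p\<bar> * \<omega> \<le> (\<bar>coord w p\<bar> + 1) * \<omega>" using \<omega> by (intro mult_right_mono) auto
  also have "\<dots> \<le> (\<bar>coord w p\<bar> + 1) * (\<epsilon> / (2 * (\<bar>coord w p\<bar> + 1)))"
    by (intro mult_left_mono) (auto simp: \<omega>_def)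
  also have "\<dots> = \<epsilon> / 2"
    by (simp add: divide_simps)
  finally have w2: "\<bar>coord w p\<bar> * \<omega> \<le> \<epsilon> / 2" .
  have w3: "real (card {i. coord w i \<noteq> 0}) * \<epsilon>1 \<le> \<epsilon> / 2"
    using assms by (simp add: \<epsilon>1_def field_simps)
  obtain N where N: "\<forall>n\<ge>N. \<forall>r\<in>{1..n}. real r * (slog (real n) / slog (real r)) \<le> real r + real n * \<omega>"
    using flat_asymptotics[OF \<omega>] by blast
  have "norm (expand_vec p n w) \<le> norm w + \<epsilon>" if "n \<ge> max 1 N" for n
    using norm_expand_vec_le_aux[of n \<epsilon>1 \<omega> k0 w p] that N \<epsilon>1 \<omega> k0 w1 w2 w3 by simp
  then show ?thesis by blast
qed

section \<open>Trees of flat functionals\<close>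

lemma slog_mult_le:
  assumes "a \<le> b" "1 \<le> b"
  shows "slog (real (a * b)) \<le> 2 * slog (real b)"
proof -
  have "real a * real b \<le> real b * real b" using assms by (intro mult_right_mono) auto
  then have "real (a * b) + 1 \<le> (real b + 1) ^ 2" by (simp add: power2_eq_square algebra_simps)
  then have "log 2 (real (a * b) + 1) \<le> log 2 ((real b + 1) ^ 2)"
    by (subst log_le_cancel_iff) (auto intro: add_nonneg_pos)
  also have "\<dots> = 2 * log 2 (real b + 1)" by (subst log_nat_power) auto
  finally show ?thesis by (simp add: slog_def)
qed

text \<open>Coordinates of size about \<open>level_delta i P\<close> are negligible on the at most \<open>2 powr (1 / level_eta i P)\<close>
  places where a norming functional has a coefficient of at least \<open>level_eta i P\<close>, and elsewhere \<open>P\<close>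
  vectors of bounded \<open>\<ell>\<^sub>1\<close> norm are negligible.\<close>

definition level_eta :: "nat \<Rightarrow> nat \<Rightarrow> real" where
  "level_eta i P = (1/2) ^ i / real P"

definition level_delta :: "nat \<Rightarrow> nat \<Rightarrow> real" where
  "level_delta i P = (1/2) ^ i / (real i + 1 + 2 powr (1 / level_eta i P))"

text \<open>\<open>P i\<close> is the number of leaves of the tree at stage \<open>i\<close>, \<open>C i\<close> lists their coefficients (only the
  first \<open>P i\<close> values matter), \<open>p i\<close> is the leaf replaced next, \<open>n i\<close> the number of its children, and
  \<open>W i\<close> is the dual vector.\<close>

locale stages =
  fixes P p n :: "nat \<Rightarrow> nat" and C :: "nat \<Rightarrow> nat \<Rightarrow> real" and W :: "nat \<Rightarrow> c00"
  assumes P_0: "P 0 = 1" and C_0: "C 0 0 = 1" and W_0: "W 0 = unit_vec 0"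
    and n_ge_2: "2 \<le> n i"
    and p_less: "p i < P i" and p_max: "q < P i \<Longrightarrow> C i q \<le> C i (p i)"
    and P_Suc: "P (Suc i) = P i + n i - 1"
    and C_Suc: "C (Suc i) j = C i (collapse (p i) (n i) j) /
          (if collapse (p i) (n i) j = p i then slog (real (n i)) else 1)"
    and W_Suc: "W (Suc i) = expand_vec (p i) (n i) (W i)"
    and norm_W_le: "norm (W i) \<le> 3"
    and n_ge: "i \<le> n i" "P i \<le> n i"
    and n_large: "n i \<le> x \<Longrightarrow> slog (real x) < real x * level_delta i (P i)"
begin

section \<open>Size of the trees and decay of the coefficients\<close>

lemma slog_n_gt_1: "1 < slog (real (n i))"
  using slog_gt_1[OF n_ge_2] .

lemma n_ge_1: "1 \<le> n i"
  using n_ge_2[of i] by simp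

lemma P_pos: "0 < P i"
  using p_less[of i] by simp

lemma collapse_less: "j < P (Suc i) \<Longrightarrow> collapse (p i) (n i) j < P i"
  using n_ge_2[of i] p_less[of i] by (auto simp: collapse_def P_Suc)

lemma C_pos: "j < P i \<Longrightarrow> 0 < C i j"
proof (induction i arbitrary: j)
  case 0
  then show ?case by (simp add: P_0 C_0)
next
  case (Suc i)
  then show ?case using slog_n_gt_1[of i] collapse_less by (auto simp: C_Suc intro!: divide_pos_pos)
qed

lemma C_Suc_le: "j < P (Suc i) \<Longrightarrow> C (Suc i) j \<le> C i (collapse (p i) (n i) j)"
  using slog_n_gt_1[of i] C_pos[OF collapse_less, of j i]
  by (auto simp: C_Suc field_simps)

lemma C_le_1: "j < P i \<Longrightarrow> C i j \<le> 1"
proof (induction i arbitrary: j)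
  case 0
  then show ?case by (simp add: P_0 C_0)
next
  case (Suc i)
  then show ?case using C_Suc_le[OF Suc.prems] collapse_less[OF Suc.prems] by fastforce
qed

lemma mono_n: "i \<le> j \<Longrightarrow> n i \<le> n j"
proof (rule lift_Suc_mono_le[of n])
  show "n i \<le> n (Suc i)" for i
    using n_ge(2)[of "Suc i"] P_Suc[of i] P_pos[of i] by simp
qed

text \<open>The maximal coefficients do not increase. If they stayed at or above
  \<open>\<epsilon>\<close>, then from some stage on the new children would lie below
  \<open>\<epsilon>\<close>, because \<open>n i \<ge> i\<close>, so every stage would reduce the
  number of leaves with coefficient at least \<open>\<epsilon>\<close>.\<close>

lemma C_p_tendsto_0: "(\<lambda>i. C i (p i)) \<longlonglongrightarrow> 0"
proof (rule LIMSEQ_I)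
  fix \<epsilon> :: real assume \<epsilon>: "0 < \<epsilon>"
  have dec: "C (Suc i) (p (Suc i)) \<le> C i (p i)" for i
    using C_Suc_le[OF p_less] p_max[OF collapse_less[OF p_less]] order_trans by blast
  have "\<exists>i. C i (p i) < \<epsilon>"
  proof (rule ccontr)
    assume "\<not> ?thesis"
    then have ge: "\<epsilon> \<le> C i (p i)" for i by (auto simp: not_less)
    obtain i0 :: nat where i0: "2 powr (1 / \<epsilon>) \<le> real i0" using real_arch_simple by blast
    have new: "C i (p i) / slog (real (n i)) < \<epsilon>" if "i0 \<le> i" for i
    proof -
      have "1 / \<epsilon> = log 2 (2 powr (1 / \<epsilon>))" by simp
      also have "\<dots> < slog (real (n i))"
        unfolding slog_def using i0 that n_ge(1)[of i] by (subst log_less_cancel_iff) auto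
      finally have "1 < \<epsilon> * slog (real (n i))" using \<epsilon> by (simp add: field_simps)
      moreover have "C i (p i) \<le> 1" using C_le_1[OF p_less] .
      ultimately show ?thesis using slog_n_gt_1[of i] by (simp add: field_simps)
    qed
    define c where "c i = card {q. q < P i \<and> \<epsilon> \<le> C i q}" for i
    have step: "Suc (c (Suc i)) \<le> c i" if "i0 \<le> i" for i
    proof -
      let ?A = "{q. q < P (Suc i) \<and> \<epsilon> \<le> C (Suc i) q}"
      let ?B = "{q. q < P i \<and> \<epsilon> \<le> C i q}"
      have np: "collapse (p i) (n i) q \<noteq> p i" if "q \<in> ?A" for q
        using that new[OF \<open>i0 \<le> i\<close>] by (auto simp: C_Suc)
      have "card ?A \<le> card (?B - {p i})"
      proof (rule card_inj_on_le[of "collapse (p i) (n i)"])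
        show "inj_on (collapse (p i) (n i)) ?A"
          using np collapse_eq_p[OF n_ge_1]
          by (intro inj_on_inverseI[of _ "section_at (p i) (n i) (p i)"] section_at_collapse) blast
        show "collapse (p i) (n i) ` ?A \<subseteq> ?B - {p i}"
          using np C_Suc_le collapse_less by fastforce
      qed simp
      also have "\<dots> < card ?B"
        using ge p_less by (intro psubset_card_mono) auto
      finally show ?thesis by (simp add: c_def)
    qed
    have "c (i0 + k) + k \<le> c i0" for k
    proof (induction k)
      case (Suc k)
      then show ?case using step[of "i0 + k"] by simp
    qed simp
    from this[of "Suc (c i0)"] show False by simp
  qed
  then obtain i where i: "C i (p i) < \<epsilon>" by blast
  have "C j (p j) < \<epsilon>" if "i \<le> j" for j
    using that by (induction j rule: dec_induct) (use i dec order_le_less_trans in auto)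
  then show "\<exists>no. \<forall>j\<ge>no. norm (C j (p j) - 0) < \<epsilon>"
    using C_pos[OF p_less] by (intro exI[of _ i]) (simp add: less_imp_le)
qed

text \<open>Here \<open>j\<close> is a leaf of stage \<open>i + d\<close>, and the value is the leaf
  of stage \<open>i\<close> from which it descends.\<close>

fun ancestor :: "nat \<Rightarrow> nat \<Rightarrow> nat \<Rightarrow> nat" where
  "ancestor i 0 j = j"
| "ancestor i (Suc d) j = collapse (p i) (n i) (ancestor (Suc i) d j)"

lemma ancestor_add: "ancestor i (d + e) j = ancestor i d (ancestor (i + d) e j)"
  by (induction d arbitrary: i) auto

lemma ancestor_Suc': "ancestor i (Suc d) j = ancestor i d (collapse (p (i + d)) (n (i + d)) j)"
  using ancestor_add[of i d 1 j] by simp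

lemma ancestor_mono: "j \<le> j' \<Longrightarrow> ancestor i d j \<le> ancestor i d j'"
  by (induction d arbitrary: i) (auto intro: mono_collapse n_ge_1)

lemma ancestor_less: "j < P (i + d) \<Longrightarrow> ancestor i d j < P i"
  by (induction d arbitrary: i) (auto intro: collapse_less)

definition leaves :: "nat \<Rightarrow> nat \<Rightarrow> nat \<Rightarrow> nat set" where
  "leaves i d q = {j. j < P (i + d) \<and> ancestor i d j = q}"

lemma finite_leaves [simp]: "finite (leaves i d q)"
  by (simp add: leaves_def)

lemma leaves_Suc: "leaves i (Suc d) q = (\<Union>r\<in>leaves i 1 q. leaves (Suc i) d r)"
  using ancestor_less[of _ "Suc i" d] by (auto simp: leaves_def)

lemma leaves_1_p: "leaves i 1 (p i) = {p i..<p i + n i}"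
  using collapse_eq_p[OF n_ge_1] p_less[of i] n_ge_2[of i] by (auto simp: leaves_def P_Suc)

lemma leaves_1_other:
  assumes "q < P i" "q \<noteq> p i"
  shows "\<exists>r. leaves i 1 q = {r} \<and> r < P (Suc i) \<and> C (Suc i) r = C i q"
proof -
  define r where "r = section_at (p i) (n i) (p i) q"
  have c: "collapse (p i) (n i) r = q"
    unfolding r_def using n_ge_1[of i] by (intro collapse_section_at) auto
  have "r < P (Suc i)"
    using assms n_ge_2[of i] p_less[of i] by (auto simp: r_def section_at_def P_Suc)
  have u: "j = r" if "collapse (p i) (n i) j = q" for j
    using that assms(2) section_at_collapse[of j "p i" "n i" "p i"] collapse_eq_p[OF n_ge_1, of "p i" i j]
    by (auto simp: r_def)
  have "leaves i 1 q = {j. j < P (Suc i) \<and> collapse (p i) (n i) j = q}" by (simp add: leaves_def)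
  also have "\<dots> = {r}" using u c \<open>r < P (Suc i)\<close> by blast
  finally have "leaves i 1 q = {r}" .
  moreover have "C (Suc i) r = C i q" using c assms(2) by (simp add: C_Suc)
  ultimately show ?thesis using \<open>r < P (Suc i)\<close> by blast
qed

lemma ordered_sets_leaves: "ordered_sets A (\<lambda>r. (+) k ` leaves i d r)"
  unfolding ordered_sets_def set_less_def
proof (intro conjI ballI impI)
  fix r r' a b assume "r < r'" "a \<in> (+) k ` leaves i d r" "b \<in> (+) k ` leaves i d r'"
  then obtain j j' where j: "a = k + j" "b = k + j'" "ancestor i d j = r" "ancestor i d j' = r'"
    by (auto simp: leaves_def)
  then show "a < b" using \<open>r < r'\<close> ancestor_mono[of j' j i d] by (cases "j < j'") auto
qed simp

lemma disjoint_leaves: "r \<noteq> r' \<Longrightarrow> leaves i d r \<inter> leaves i d r' = {}"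
  by (auto simp: leaves_def)

lemma sum_leaves_Suc:
  "sum h (leaves i (Suc d) q) = (\<Sum>r\<in>leaves i 1 q. sum h (leaves (Suc i) d r))"
  unfolding leaves_Suc by (rule sum.UNION_disjoint) (use disjoint_leaves in auto)

text \<open>The contribution of the subtree below leaf \<open>q\<close> of stage \<open>i\<close> to
  the functional of stage \<open>i + d\<close>, placed at \<open>k\<close>. Coefficients count from
  the root of the whole tree, hence the factor \<open>C i q\<close> in the estimate below.\<close>

definition leaf_sum :: "nat \<Rightarrow> nat \<Rightarrow> nat \<Rightarrow> nat \<Rightarrow> c00 \<Rightarrow> real" where
  "leaf_sum i d q k y = (\<Sum>j\<in>leaves i d q. C (i + d) j * coord y (k + j))"

text \<open>The induction peels off the first replacement. If \<open>q\<close> is replaced, its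
  \<open>n i\<close> children each have the coefficient \<open>C i q / slog (n i)\<close> and lie
  over successive sets, so the weight cancels; any other leaf survives with its coefficient.\<close>

lemma abs_leaf_sum_le:
  "q < P i \<Longrightarrow> \<bar>leaf_sum i d q k y\<bar> \<le> C i q * norm (restr ((+) k ` leaves i d q) y)"
proof (induction d arbitrary: i q)
  case 0
  have l: "leaves i 0 q = {q}" using 0 by (auto simp: leaves_def)
  have "\<bar>coord y (k + q)\<bar> \<le> norm (restr {k + q} y)"
    using abs_coord_le_norm[of "restr {k + q} y" "k + q"] by (simp add: coord_restr)
  then show ?case using C_pos[OF 0] by (simp add: l leaf_sum_def abs_mult)
next
  case (Suc d)
  let ?I = "\<lambda>r. (+) k ` leaves (Suc i) d r"
  have sub: "r < P (Suc i)" if "r \<in> leaves i 1 q" for r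
    using that by (simp add: leaves_def)
  have "\<bar>leaf_sum i (Suc d) q k y\<bar> = \<bar>\<Sum>r\<in>leaves i 1 q. leaf_sum (Suc i) d r k y\<bar>"
    unfolding leaf_sum_def sum_leaves_Suc by simp
  also have "\<dots> \<le> (\<Sum>r\<in>leaves i 1 q. \<bar>leaf_sum (Suc i) d r k y\<bar>)" by (rule sum_abs)
  also have "\<dots> \<le> (\<Sum>r\<in>leaves i 1 q. C (Suc i) r * norm (restr (?I r) y))"
    by (intro sum_mono Suc.IH sub)
  finally have *: "\<bar>leaf_sum i (Suc d) q k y\<bar> \<le> (\<Sum>r\<in>leaves i 1 q. C (Suc i) r * norm (restr (?I r) y))" .
  let ?y = "restr ((+) k ` leaves i (Suc d) q) y"
  show ?case
  proof (cases "q = p i")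
    case True
    have "(\<Sum>r\<in>leaves i 1 q. C (Suc i) r * norm (restr (?I r) y))
        = (\<Sum>r\<in>leaves i 1 q. C i q / slog (real (n i)) * norm (restr (?I r) ?y))"
    proof (rule sum.cong[OF refl])
      fix r assume r: "r \<in> leaves i 1 q"
      then have "C (Suc i) r = C i q / slog (real (n i))"
        using True by (simp add: leaves_def C_Suc)
      moreover have "?I r \<inter> (+) k ` leaves i (Suc d) q = ?I r" using r by (auto simp: leaves_Suc[of i d])
      ultimately show "C (Suc i) r * norm (restr (?I r) y) = C i q / slog (real (n i)) * norm (restr (?I r) ?y)"
        by (simp add: restr_restr)
    qed
    also have "\<dots> = C i q / slog (real (n i)) * (\<Sum>r\<in>leaves i 1 q. norm (restr (?I r) ?y))"
      by (simp add: sum_distrib_left)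
    also have "\<dots> \<le> C i q / slog (real (n i)) * (slog (real (card (leaves i 1 q))) * norm ?y)"
      using C_pos[OF Suc.prems] slog_n_gt_1[of i]
      by (intro mult_left_mono sum_norm_ordered_sets_le ordered_sets_leaves) auto
    also have "\<dots> = C i q * norm ?y" using slog_n_gt_1[of i] True by (simp add: leaves_1_p[simplified])
    finally show ?thesis using * by simp
  next
    case False
    then obtain r where r: "leaves i 1 q = {r}" "C (Suc i) r = C i q"
      using leaves_1_other[OF Suc.prems] by blast
    then have "leaves i (Suc d) q = leaves (Suc i) d r" unfolding leaves_Suc by simp
    then show ?thesis using * r by simp
  qed
qed

text \<open>A leaf that is never replaced keeps its coefficient, while the largest coefficient tends
  to 0.\<close>

lemma eventually_expanded:
  assumes "q < P i"
  shows "\<exists>d. leaves i d q = {p (i + d)}"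
proof (rule ccontr)
  assume neg: "\<nexists>d. leaves i d q = {p (i + d)}"
  have "\<exists>r. r < P (i + d) \<and> leaves i d q = {r} \<and> C (i + d) r = C i q" for d
  proof (induction d)
    case 0
    then show ?case using assms by (auto simp: leaves_def)
  next
    case (Suc d)
    then obtain r where r: "r < P (i + d)" "leaves i d q = {r}" "C (i + d) r = C i q" by blast
    then have "r \<noteq> p (i + d)" using neg by blast
    then obtain r' where r': "leaves (i + d) 1 r = {r'}" "r' < P (Suc (i + d))" "C (Suc (i + d)) r' = C (i + d) r"
      using leaves_1_other[OF r(1)] by blast
    have "leaves i (Suc d) q = {j. j < P (Suc (i + d)) \<and> collapse (p (i + d)) (n (i + d)) j \<in> leaves i d q}"
      using collapse_less by (auto simp: leaves_def ancestor_Suc' simp del: ancestor.simps(2))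
    also have "\<dots> = leaves (i + d) 1 r" using r(2) by (auto simp: leaves_def)
    finally show ?case using r' r(3) by auto
  qed
  then have "C i q \<le> C (i + d) (p (i + d))" for d using p_max by metis
  moreover have "\<exists>j. \<forall>d\<ge>j. C d (p d) < C i q"
    using order_tendstoD(2)[OF C_p_tendsto_0 C_pos[OF assms]] by (simp add: eventually_sequentially)
  ultimately show False by (metis le_add2 not_le)
qed

text \<open>The number of stages until leaf \<open>q\<close> of stage \<open>i\<close> is replaced.\<close>

definition delay :: "nat \<Rightarrow> nat \<Rightarrow> nat" where
  "delay i q = (SOME d. leaves i d q = {p (i + d)})"

lemma leaves_delay: "q < P i \<Longrightarrow> leaves i (delay i q) q = {p (i + delay i q)}"
  unfolding delay_def using someI_ex[OF eventually_expanded] .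

text \<open>The \<open>m\<close>-th functional uses a stage so late that all leaves of stages before \<open>m\<close> have been replaced.\<close>

definition stage :: "nat \<Rightarrow> nat" where
  "stage m = Suc (m + (\<Sum>i<m. \<Sum>q<P i. i + delay i q))"

lemma stage_gt: "m < stage m"
  by (simp add: stage_def)

lemma delay_less_stage:
  assumes "i < m" "q < P i"
  shows "i + delay i q < stage m"
proof -
  have "i + delay i q \<le> (\<Sum>q<P i. i + delay i q)"
    using assms by (intro member_le_sum[of q _ "\<lambda>q. i + delay i q"]) auto
  also have "\<dots> \<le> (\<Sum>i<m. \<Sum>q<P i. i + delay i q)"
    using assms by (intro member_le_sum[of i _ "\<lambda>i. \<Sum>q<P i. i + delay i q"]) auto
  finally show ?thesis by (simp add: stage_def)
qed

section \<open>The functionals on successive blocks\<close>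

definition offset :: "nat \<Rightarrow> nat" where
  "offset m = (\<Sum>k<m. P (stage k))"

definition block :: "nat \<Rightarrow> nat set" where
  "block m = {offset m..<offset m + P (stage m)}"

lemma offset_Suc: "offset (Suc m) = offset m + P (stage m)"
  by (simp add: offset_def)

lemma offset_mono: "m \<le> k \<Longrightarrow> offset m \<le> offset k"
  by (rule lift_Suc_mono_le[of offset]) (simp_all add: offset_Suc)

lemma le_offset: "m \<le> offset m"
proof (induction m)
  case (Suc m)
  then show ?case using P_pos[of "stage m"] by (simp add: offset_Suc)
qed simp

lemma ordered_sets_block: "ordered_sets A block"
  unfolding ordered_sets_def set_less_def block_def
proof (intro conjI ballI impI)
  fix m k a b assume "m < k" "a \<in> {offset m..<offset m + P (stage m)}"
    "b \<in> {offset k..<offset k + P (stage k)}"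
  then show "a < b" using offset_mono[of "Suc m" k] by (auto simp: offset_Suc)
qed simp

lemma block_disjoint: "m \<noteq> k \<Longrightarrow> a \<in> block m \<Longrightarrow> a \<notin> block k"
  using ordered_sets_disjoint[OF ordered_sets_block[of UNIV]] by blast

text \<open>The share of the subtree below leaf \<open>q\<close> of stage \<open>i\<close> in
  \<open>func m\<close>; it has this meaning for \<open>i \<le> stage m\<close>, where the
  subtraction is not truncated.\<close>

definition part :: "nat \<Rightarrow> nat \<Rightarrow> nat \<Rightarrow> c00 \<Rightarrow> real" where
  "part i q m y = leaf_sum i (stage m - i) q (offset m) y"

definition func :: "nat \<Rightarrow> c00 \<Rightarrow> real" where
  "func m y = (\<Sum>j<P (stage m). C (stage m) j * coord y (offset m + j))"

lemma leaves_subset_block: "i \<le> stage m \<Longrightarrow> (+) (offset m) ` leaves i (stage m - i) q \<subseteq> block m"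
  by (auto simp: leaves_def block_def)

lemma abs_part_le:
  assumes "q < P i" "i \<le> stage m"
  shows "\<bar>part i q m y\<bar> \<le> C i q * norm (restr (block m) y)"
proof -
  have "\<bar>part i q m y\<bar> \<le> C i q * norm (restr ((+) (offset m) ` leaves i (stage m - i) q) y)"
    unfolding part_def by (rule abs_leaf_sum_le[OF assms(1)])
  also have "\<dots> \<le> C i q * norm (restr (block m) y)"
    using C_pos[OF assms(1)] by (intro mult_left_mono norm_restr_mono leaves_subset_block assms) auto
  finally show ?thesis .
qed

lemma func_eq_sum_part:
  assumes "i \<le> stage m"
  shows "func m y = (\<Sum>q<P i. part i q m y)"
proof -
  have i: "i + (stage m - i) = stage m" using assms by simp
  have "func m y = sum (\<lambda>j. C (stage m) j * coord y (offset m + j)) (\<Union>q\<in>{..<P i}. leaves i (stage m - i) q)"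
    unfolding func_def by (rule sum.cong) (use ancestor_less[of _ i "stage m - i"] i in \<open>auto simp: leaves_def\<close>)
  also have "\<dots> = (\<Sum>q<P i. part i q m y)"
    unfolding part_def leaf_sum_def i
    by (rule sum.UNION_disjoint) (use disjoint_leaves in auto)
  finally show ?thesis .
qed

lemma abs_func_le: "\<bar>func m y\<bar> \<le> norm (restr (block m) y)"
  using func_eq_sum_part[of 0 m y] abs_part_le[of 0 0 m y] by (simp add: P_0 C_0)

text \<open>The leaf \<open>q\<close> is replaced at a stage \<open>s\<close> after \<open>i\<close>
  and before each \<open>stage m\<close>, by \<open>n s\<close> children, and
  \<open>n s \<ge> n (Suc i) \<ge> card A\<close>. The sets over these children, for all
  \<open>m\<close> in \<open>A\<close>, are \<open>card A * n s\<close> successive sets, so their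
  norms add up to at most \<open>2 * slog (n s) * norm y\<close>, while the coefficients are at most
  \<open>1 / slog (n s)\<close>.\<close>

lemma sum_abs_part_le:
  assumes q: "q < P i" "q \<noteq> p i" and A: "finite A" "card A \<le> n (Suc i)" "\<And>m. m \<in> A \<Longrightarrow> i < m"
  shows "(\<Sum>m\<in>A. \<bar>part i q m y\<bar>) \<le> 2 * norm y"
proof -
  define d where "d = delay i q"
  define s where "s = i + d"
  define Q where "Q = {p s..<p s + n s}"
  define K where "K = p s + n s"
  define V where "V m r = (+) (offset m) ` leaves (Suc s) (stage m - Suc s) r" for m r
  have ld: "leaves i d q = {p s}" using leaves_delay[OF q(1)] by (simp add: d_def s_def)
  have "q \<in> leaves i 0 q" using q by (simp add: leaves_def)
  then have "d \<noteq> 0" using ld q(2) by (metis add_0_right s_def singletonD)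
  then have ns: "n (Suc i) \<le> n s" by (intro mono_n) (simp add: s_def)
  have sm: "s < stage m" if "m \<in> A" for m
    using delay_less_stage[OF A(3)[OF that] q(1)] by (simp add: s_def d_def)
  have bound: "\<bar>part i q m y\<bar> \<le> (\<Sum>r\<in>Q. norm (restr (V m r) y)) / slog (real (n s))" if m: "m \<in> A" for m
  proof -
    define e where "e = stage m - Suc s"
    have e: "Suc s + e = stage m" "stage m - i = d + Suc e" using sm[OF m] by (auto simp: e_def s_def)
    have si: "s + Suc e = stage m" using e by simp
    have im: "i + (stage m - i) = stage m" using sm[OF m] by (simp add: s_def)
    have anc: "ancestor i (stage m - i) j = ancestor i d (ancestor s (Suc e) j)" for j
      unfolding e(2) s_def by (rule ancestor_add)
    \<comment> \<open>The path from \<open>q\<close> is cut at stage \<open>s\<close>, where its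
      only descendant is \<open>p s\<close>.\<close>
    have "leaves i (stage m - i) q = {j. j < P (stage m) \<and> ancestor i d (ancestor s (Suc e) j) = q}"
      unfolding leaves_def im anc ..
    also have "\<dots> = {j. j < P (stage m) \<and> ancestor s (Suc e) j \<in> leaves i d q}"
      using ancestor_less[of _ s "Suc e", unfolded si] unfolding leaves_def s_def by blast
    also have "\<dots> = leaves s (Suc e) (p s)"
      unfolding ld using si by (auto simp: leaves_def simp del: ancestor.simps)
    finally have l: "leaves i (stage m - i) q = leaves s (Suc e) (p s)" .
    have "part i q m y = leaf_sum s (Suc e) (p s) (offset m) y"
      unfolding part_def leaf_sum_def l im si ..
    also have "\<dots> = (\<Sum>r\<in>Q. leaf_sum (Suc s) e r (offset m) y)"
      unfolding leaf_sum_def sum_leaves_Suc Q_def leaves_1_p by simp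
    finally have "\<bar>part i q m y\<bar> \<le> (\<Sum>r\<in>Q. \<bar>leaf_sum (Suc s) e r (offset m) y\<bar>)"
      using sum_abs by metis
    also have "\<dots> \<le> (\<Sum>r\<in>Q. 1 / slog (real (n s)) * norm (restr (V m r) y))"
    proof (rule sum_mono)
      fix r assume "r \<in> Q"
      then have r: "r \<in> leaves s 1 (p s)" by (simp only: Q_def leaves_1_p)
      then have rP: "r < P (Suc s)" by (simp add: leaves_def)
      have "C (Suc s) r = C s (p s) / slog (real (n s))" using r by (simp add: leaves_def C_Suc)
      also have "\<dots> \<le> 1 / slog (real (n s))"
        using slog_n_gt_1[of s] C_le_1[OF p_less] by (intro divide_right_mono) auto
      finally have c: "C (Suc s) r \<le> 1 / slog (real (n s))" .
      have "\<bar>leaf_sum (Suc s) e r (offset m) y\<bar> \<le> C (Suc s) r * norm (restr (V m r) y)"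
        using abs_leaf_sum_le[OF rP] by (simp add: V_def e_def)
      also have "\<dots> \<le> 1 / slog (real (n s)) * norm (restr (V m r) y)"
        by (intro mult_right_mono c) simp
      finally show "\<bar>leaf_sum (Suc s) e r (offset m) y\<bar> \<le> 1 / slog (real (n s)) * norm (restr (V m r) y)" .
    qed
    also have "\<dots> = (\<Sum>r\<in>Q. norm (restr (V m r) y)) / slog (real (n s))"
      by (simp add: sum_divide_distrib)
    finally show ?thesis .
  qed
  have K: "0 < K" using n_ge_2[of s] by (simp add: K_def)
  \<comment> \<open>Pairs are coded in lexicographic order, since \<open>ordered_sets\<close> is
    indexed by naturals; all \<open>r\<close> in \<open>Q\<close> are below
    \<open>K\<close>.\<close>
  define key where "key = (\<lambda>(m, r). m * K + r)"
  have rK: "r < K" if "r \<in> Q" for r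
    using that by (simp add: Q_def K_def)
  have div: "(m * K + r) div K = m" "(m * K + r) mod K = r" if "r \<in> Q" for m r
    using rK[OF that] K by simp_all
  have inj: "inj_on key (A \<times> Q)"
    by (rule inj_on_inverseI[of _ "\<lambda>k. (k div K, k mod K)"]) (use K in \<open>auto simp: key_def rK\<close>)
  define I where "I k = V (k div K) (k mod K)" for k
  have ord: "ordered_sets (key ` (A \<times> Q)) I"
    unfolding ordered_sets_def
  proof (intro conjI ballI impI)
    fix k k' assume k: "k \<in> key ` (A \<times> Q)" "k' \<in> key ` (A \<times> Q)" "k < k'"
    then obtain m r m' r' where kk: "m \<in> A" "r \<in> Q" "k = m * K + r" "m' \<in> A" "r' \<in> Q" "k' = m' * K + r'"
      by (auto simp: key_def)
    have I: "I k = V m r" "I k' = V m' r'" using K by (simp_all add: I_def kk rK)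
    have "m \<le> m'" using div_le_mono[of k k' K] k(3) div kk by simp
    then have "m < m' \<or> m = m' \<and> r < r'"
      using k(3) unfolding kk(3,6) by (cases "m = m'") simp_all
    then consider "m < m'" | "m = m'" "r < r'" by blast
    then show "set_less (I k) (I k')"
    proof cases
      case 1
      have "V m r \<subseteq> block m" "V m' r' \<subseteq> block m'"
        using sm kk leaves_subset_block unfolding V_def by (simp_all add: Suc_le_eq)
      then show ?thesis unfolding I set_less_def
        using ordered_setsD(2)[OF ordered_sets_block[of UNIV], of m m'] 1 by blast
    next
      case 2
      then show ?thesis unfolding I set_less_def V_def
        using ordered_setsD(2)[OF ordered_sets_leaves[of UNIV], of r r'] by blast
    qed
  qed (auto simp: I_def V_def)
  have "(\<Sum>m\<in>A. \<bar>part i q m y\<bar>) \<le> (\<Sum>m\<in>A. (\<Sum>r\<in>Q. norm (restr (V m r) y)) / slog (real (n s)))"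
    by (intro sum_mono bound)
  also have "\<dots> = (\<Sum>(m, r)\<in>A \<times> Q. norm (restr (V m r) y)) / slog (real (n s))"
    by (simp add: sum.cartesian_product flip: sum_divide_distrib)
  also have "(\<Sum>(m, r)\<in>A \<times> Q. norm (restr (V m r) y)) = (\<Sum>k\<in>key ` (A \<times> Q). norm (restr (I k) y))"
    by (subst sum.reindex[OF inj]) (use K in \<open>auto simp: I_def key_def rK intro!: sum.cong\<close>)
  also have "\<dots> \<le> slog (real (card (key ` (A \<times> Q)))) * norm y"
    using A by (intro sum_norm_ordered_sets_le ord) (auto simp: Q_def)
  also have "card (key ` (A \<times> Q)) = card A * n s"
    by (subst card_image[OF inj]) (simp add: card_cartesian_product Q_def)
  also have "slog (real (card A * n s)) * norm y \<le> (2 * slog (real (n s))) * norm y"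
    using A(2) ns n_ge_1[of s] by (intro mult_right_mono slog_mult_le) auto
  finally show ?thesis using slog_n_gt_1[of s] by (simp add: field_simps divide_right_mono)
qed

section \<open>The operator on finitely supported sequences\<close>

definition tree_op :: "c00 \<Rightarrow> c00" where
  "tree_op y = Abs_c00 (\<lambda>m. func m y)"

lemma finite_func_nonzero: "finite {m. func m y \<noteq> 0}"
proof -
  obtain b where b: "\<forall>i\<ge>b. coord y i = 0" using coord_bounded by blast
  have "{m. func m y \<noteq> 0} \<subseteq> {..<b}"
  proof
    fix m assume "m \<in> {m. func m y \<noteq> 0}"
    then have "\<exists>j<P (stage m). coord y (offset m + j) \<noteq> 0"
      unfolding func_def by (metis (mono_tags, lifting) lessThan_iff mem_Collect_eq mult_zero_right sum.neutral)
    then obtain j where "coord y (offset m + j) \<noteq> 0" by blast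
    then have "offset m + j < b" using b by (metis not_le)
    then show "m \<in> {..<b}" using le_offset[of m] by simp
  qed
  then show ?thesis by (rule finite_subset) simp
qed

lemma coord_tree_op [simp]: "coord (tree_op y) m = func m y"
  unfolding tree_op_def by (subst coord_Abs_c00[OF finite_func_nonzero]) (rule refl)

lemma linear_tree_op: "linear tree_op"
proof (rule linearI; rule c00_eqI)
  show "coord (tree_op (x + y)) m = coord (tree_op x + tree_op y) m" for x y m
    by (simp add: func_def sum.distrib ring_distribs)
  show "coord (tree_op (a *\<^sub>R x)) m = coord (a *\<^sub>R tree_op x) m" for a x m
    by (simp add: func_def sum_distrib_left mult_ac)
qed

lemma norm_tree_op_le: "norm (tree_op y) \<le> norm y"
  by (rule norm_le_of_ordered_sets[OF ordered_sets_block]) (simp add: abs_func_le)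

section \<open>Estimates for images with small coordinates\<close>

abbreviation \<eta> :: "nat \<Rightarrow> real" where "\<eta> i \<equiv> level_eta i (P i)"
abbreviation \<delta> :: "nat \<Rightarrow> real" where "\<delta> i \<equiv> level_delta i (P i)"

lemma \<eta>_pos: "0 < \<eta> i"
  using P_pos by (simp add: level_eta_def)

lemma \<delta>_pos: "0 < \<delta> i"
  by (auto simp: level_delta_def intro!: divide_pos_pos add_nonneg_pos)

lemma \<delta>_eq: "(real i + 1 + 2 powr (1 / \<eta> i)) * \<delta> i = (1/2) ^ i"
  unfolding level_delta_def by (simp add: add_nonneg_pos less_imp_neq[THEN not_sym])

lemma \<delta>_le: "\<delta> i \<le> (1/2) ^ i"
proof -
  have "1 * \<delta> i \<le> (real i + 1 + 2 powr (1 / \<eta> i)) * \<delta> i"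
    using \<delta>_pos[of i] by (intro mult_right_mono) auto
  then show ?thesis by (simp add: \<delta>_eq)
qed

text \<open>The index is the one just before \<open>\<delta>\<close> first drops to \<open>a\<close>
  or below, counting from \<open>i0\<close>.\<close>

lemma exists_level:
  assumes "0 < a" "a < \<delta> i0"
  shows "\<exists>i\<ge>i0. \<delta> (Suc i) \<le> a \<and> a < \<delta> i"
proof -
  obtain k where k: "(1/2) ^ k < a" using real_arch_pow_inv[OF assms(1), of "1/2"] by auto
  have "\<delta> (i0 + k) \<le> (1/2) ^ (i0 + k)" by (rule \<delta>_le)
  also have "\<dots> \<le> (1/2) ^ k" by (intro power_decreasing) auto
  finally have ex: "\<exists>k. \<delta> (i0 + k) \<le> a" using k by (intro exI[of _ k]) simp
  define k0 where "k0 = (LEAST k. \<delta> (i0 + k) \<le> a)"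
  have k0: "\<delta> (i0 + k0) \<le> a" unfolding k0_def using LeastI_ex[OF ex] .
  then obtain l where l: "k0 = Suc l" using assms(2) by (cases k0) auto
  have "a < \<delta> (i0 + l)"
    using not_less_Least[of l "\<lambda>k. \<delta> (i0 + k) \<le> a"] l by (simp add: k0_def)
  then show ?thesis using k0 l by (intro exI[of _ "i0 + l"]) simp
qed

text \<open>Level \<open>i\<close> consists of the coordinates of size between
  \<open>\<delta> (Suc i)\<close> and \<open>\<delta> i\<close>. There \<open>func m\<close> is
  split along the leaves of stage \<open>i\<close>: the leaf \<open>p i\<close> contributes to
  \<open>main\<close>, in total at most \<open>\<kappa>\<close>, and all else to
  \<open>rest\<close>, at most \<open>3 * (1/2) ^ i\<close> per level.\<close>

lemma norm_tree_op_small: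
  assumes y: "norm y \<le> 1" and small: "\<And>m. \<bar>func m y\<bar> < \<delta> i0"
    and \<kappa>: "\<And>i. i0 \<le> i \<Longrightarrow> C i (p i) \<le> \<kappa>"
  shows "norm (tree_op y) \<le> \<kappa> + 6 * (1/2) ^ i0"
proof (rule norm_le_normers)
  fix \<phi> assume \<phi>: "\<phi> \<in> normers"
  define M where "M = {m. func m y \<noteq> 0}"
  have finM: "finite M" unfolding M_def by (rule finite_func_nonzero)
  define c where "c m = \<bar>\<phi> (unit_vec m)\<bar>" for m
  have c1: "c m \<le> 1" for m using normers_abs_le[OF \<phi>, of "unit_vec m"] by (simp add: c_def)
  have c0: "0 \<le> c m" for m by (simp add: c_def)
  obtain lev where lev: "\<And>m. m \<in> M \<Longrightarrow> i0 \<le> lev m \<and> \<delta> (Suc (lev m)) \<le> \<bar>func m y\<bar> \<and> \<bar>func m y\<bar> < \<delta> (lev m)"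
  proof -
    have "\<forall>m\<in>M. \<exists>i\<ge>i0. \<delta> (Suc i) \<le> \<bar>func m y\<bar> \<and> \<bar>func m y\<bar> < \<delta> i"
      using small by (auto simp: M_def intro: exists_level)
    then show ?thesis using that by metis
  qed
  define D where "D i = {m \<in> M. lev m = i}" for i
  have finD: "finite (D i)" for i using finM by (simp add: D_def)
  \<comment> \<open>A coordinate is bad if its index is too small for
    \<open>sum_abs_part_le\<close>, which needs the level to be below \<open>m\<close>, or if
    \<open>\<phi>\<close> has a large coefficient there. Bad coordinates are few and go into
    \<open>rest\<close> whole.\<close>
  define bad where "bad m \<longleftrightarrow> m \<le> lev m \<or> \<eta> (lev m) \<le> c m" for m
  define rest where "rest m = (if bad m then \<bar>func m y\<bar>
      else c m * (\<Sum>q\<in>{..<P (lev m)} - {p (lev m)}. \<bar>part (lev m) q m y\<bar>))" for m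
  define main where "main m = (if bad m then 0 else \<bar>part (lev m) (p (lev m)) m y\<bar>)" for m
  have pointwise: "c m * \<bar>func m y\<bar> \<le> rest m + c m * main m" if m: "m \<in> M" for m
  proof (cases "bad m")
    case True
    then show ?thesis using mult_right_mono[OF c1[of m], of "\<bar>func m y\<bar>"] by (simp add: rest_def main_def)
  next
    case False
    then have "lev m \<le> stage m" using stage_gt[of m] by (simp add: bad_def)
    then have "func m y = (\<Sum>q<P (lev m). part (lev m) q m y)" by (rule func_eq_sum_part)
    also have "\<dots> = part (lev m) (p (lev m)) m y + (\<Sum>q\<in>{..<P (lev m)} - {p (lev m)}. part (lev m) q m y)"
      using p_less by (intro sum.remove) auto
    finally have "\<bar>func m y\<bar> \<le> \<bar>part (lev m) (p (lev m)) m y\<bar> + (\<Sum>q\<in>{..<P (lev m)} - {p (lev m)}. \<bar>part (lev m) q m y\<bar>)"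
      using sum_abs[of "\<lambda>q. part (lev m) q m y" "{..<P (lev m)} - {p (lev m)}"] by linarith
    from mult_left_mono[OF this c0[of m]] show ?thesis
      using False by (simp add: rest_def main_def algebra_simps)
  qed
  \<comment> \<open>Otherwise \<open>n_large\<close> at stage \<open>Suc i\<close> would make the
    sum of the coordinates on this level exceed what the norm of \<open>y\<close> allows for so many
    successive blocks.\<close>
  have cardD: "card (D i) \<le> n (Suc i)" for i
  proof (rule ccontr)
    assume "\<not> ?thesis"
    then have "slog (real (card (D i))) < real (card (D i)) * \<delta> (Suc i)" by (intro n_large) simp
    also have "\<dots> = (\<Sum>m\<in>D i. \<delta> (Suc i))" by simp
    also have "\<dots> \<le> (\<Sum>m\<in>D i. norm (restr (block m) y))"
      using lev by (intro sum_mono order_trans[OF _ abs_func_le]) (auto simp: D_def)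
    also have "\<dots> \<le> slog (real (card (D i))) * norm y"
      by (intro sum_norm_ordered_sets_le finD ordered_sets_block)
    also have "\<dots> \<le> slog (real (card (D i))) * 1"
      using y by (intro mult_left_mono) (auto simp: slog_def)
    finally show False by simp
  qed
  have level: "sum rest (D i) \<le> 3 * (1/2) ^ i" for i
  proof -
    let ?B = "{m \<in> D i. bad m}" and ?G = "{m \<in> D i. \<not> bad m}"
    let ?Q = "{..<P i} - {p i}"
    have "sum rest (D i) = sum rest ?B + sum rest ?G"
      by (subst sum.union_disjoint[symmetric]) (use finD in \<open>auto intro!: sum.cong\<close>)
    also have "sum rest ?B \<le> (1/2) ^ i"
    proof -
      have "real (card ?B) \<le> real (card {..i}) + real (card {m \<in> D i. \<eta> i \<le> c m})"
      proof -
        have "?B \<subseteq> {..i} \<union> {m \<in> D i. \<eta> i \<le> c m}" by (auto simp: bad_def D_def)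
        then have "card ?B \<le> card ({..i} \<union> {m \<in> D i. \<eta> i \<le> c m})"
          using finD by (intro card_mono) auto
        also have "\<dots> \<le> card {..i} + card {m \<in> D i. \<eta> i \<le> c m}" by (rule card_Un_le)
        finally show ?thesis by (simp flip: of_nat_add)
      qed
      also have "real (card {m \<in> D i. \<eta> i \<le> c m}) \<le> 2 powr (1 / \<eta> i)"
        by (rule card_large_coeffs_le[OF \<phi>]) (use finD \<eta>_pos in \<open>auto simp: c_def\<close>)
      finally have cB: "real (card ?B) \<le> real i + 1 + 2 powr (1 / \<eta> i)" by simp
      have "sum rest ?B \<le> (\<Sum>m\<in>?B. \<delta> i)"
        using lev by (intro sum_mono) (auto simp: rest_def D_def less_imp_le)
      also have "\<dots> = real (card ?B) * \<delta> i" by simp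
      also have "\<dots> \<le> (real i + 1 + 2 powr (1 / \<eta> i)) * \<delta> i"
        using cB \<delta>_pos[of i] by (intro mult_right_mono) auto
      finally show ?thesis by (simp add: \<delta>_eq)
    qed
    also have "sum rest ?G \<le> 2 * (1/2) ^ i"
    proof -
      \<comment> \<open>Coefficients below \<open>\<eta> i\<close> compensate for the fewer than
        \<open>P i\<close> subtrees, each of which has a bounded sum over the level.\<close>
      have "sum rest ?G \<le> (\<Sum>m\<in>?G. \<eta> i * (\<Sum>q\<in>?Q. \<bar>part i q m y\<bar>))"
      proof (rule sum_mono)
        fix m assume "m \<in> ?G"
        then show "rest m \<le> \<eta> i * (\<Sum>q\<in>?Q. \<bar>part i q m y\<bar>)"
          by (auto simp: rest_def bad_def D_def intro!: mult_right_mono sum_nonneg)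
      qed
      also have "\<dots> = \<eta> i * (\<Sum>q\<in>?Q. \<Sum>m\<in>?G. \<bar>part i q m y\<bar>)"
        unfolding sum_distrib_left[symmetric] by (subst sum.swap) simp
      also have "\<dots> \<le> \<eta> i * (\<Sum>q\<in>?Q. 2 * norm y)"
      proof (intro mult_left_mono sum_mono sum_abs_part_le)
        show "card ?G \<le> n (Suc i)"
          using card_mono[OF finD[of i], of ?G] cardD[of i] by auto
      qed (use finM \<eta>_pos[of i] in \<open>auto simp: bad_def D_def\<close>)
      also have "\<dots> \<le> \<eta> i * (real (P i) * 2)"
      proof (intro mult_left_mono)
        have "(\<Sum>q\<in>?Q. 2 * norm y) \<le> (\<Sum>q\<in>?Q. 2)" using y by (intro sum_mono) simp
        also have "\<dots> \<le> real (P i) * 2" using card_mono[of "{..<P i}" ?Q] by (simp del: card_Diff_insert)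
        finally show "(\<Sum>q\<in>?Q. 2 * norm y) \<le> real (P i) * 2" .
      qed (use \<eta>_pos[of i] in simp)
      also have "\<dots> = 2 * (1/2) ^ i" using P_pos[of i] by (simp add: level_eta_def)
      finally show ?thesis .
    qed
    finally show ?thesis by simp
  qed
  have rest: "sum rest M \<le> 6 * (1/2) ^ i0"
  proof -
    have "sum rest M = (\<Sum>i\<in>lev ` M. sum rest (D i))"
      unfolding D_def using finM by (intro sum.group[symmetric]) auto
    also have "\<dots> \<le> (\<Sum>i\<in>lev ` M. 3 * (1/2) ^ i)" by (intro sum_mono level)
    also have "\<dots> \<le> (\<Sum>i\<in>{i0..<i0 + Suc (Max (insert 0 (lev ` M)))}. 3 * (1/2) ^ i)"
    proof (intro sum_mono2)
      show "lev ` M \<subseteq> {i0..<i0 + Suc (Max (insert 0 (lev ` M)))}"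
        using lev finM by (auto simp: less_Suc_eq_le intro!: trans_le_add2 Max_ge)
    qed auto
    also have "\<dots> = 3 * (1/2) ^ i0 * (\<Sum>i<Suc (Max (insert 0 (lev ` M))). (1/2) ^ i)"
      unfolding sum_distrib_left
      by (rule sum.reindex_bij_witness[of _ "\<lambda>i. i0 + i" "\<lambda>i. i - i0"]) (auto simp: power_add[symmetric])
    also have "\<dots> \<le> 3 * (1/2) ^ i0 * 2"
    proof (intro mult_left_mono)
      show "(\<Sum>i<Suc (Max (insert 0 (lev ` M))). (1/2) ^ i) \<le> (2::real)"
        by (subst geometric_sum) auto
    qed auto
    finally show ?thesis by simp
  qed
  \<comment> \<open>The parts are dominated by \<open>\<kappa>\<close> times the norms of
    \<open>y\<close> on successive blocks, which \<open>normers_sum_abs_le\<close> sums to at most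
    \<open>norm y\<close>.\<close>
  have main: "(\<Sum>m\<in>M. c m * main m) \<le> \<kappa>"
  proof -
    have \<kappa>0: "0 \<le> \<kappa>" using \<kappa>[of i0] C_pos[OF p_less, of i0] by simp
    have "(\<Sum>m\<in>M. c m * main m) \<le> (\<Sum>m\<in>M. \<kappa> * (c m * \<bar>norm (restr (block m) y)\<bar>))"
    proof (rule sum_mono)
      fix m assume m: "m \<in> M"
      have "main m \<le> \<kappa> * norm (restr (block m) y)"
      proof (cases "bad m")
        case True
        then show ?thesis using \<kappa>0 by (simp add: main_def)
      next
        case False
        then have "lev m \<le> stage m" using stage_gt[of m] by (simp add: bad_def)
        from abs_part_le[OF p_less this] have "main m \<le> C (lev m) (p (lev m)) * norm (restr (block m) y)"
          using False by (simp add: main_def)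
        also have "\<dots> \<le> \<kappa> * norm (restr (block m) y)"
          using \<kappa> lev[OF m] by (intro mult_right_mono) auto
        finally show ?thesis .
      qed
      from mult_left_mono[OF this c0[of m]]
      show "c m * main m \<le> \<kappa> * (c m * \<bar>norm (restr (block m) y)\<bar>)" by (simp add: mult_ac)
    qed
    also have "\<dots> = \<kappa> * (\<Sum>m\<in>M. c m * \<bar>norm (restr (block m) y)\<bar>)" by (simp add: sum_distrib_left)
    also have "\<dots> \<le> \<kappa> * norm y"
      unfolding c_def by (intro mult_left_mono normers_sum_abs_le[OF \<phi> finM ordered_sets_block] \<kappa>0) simp
    also have "\<dots> \<le> \<kappa> * 1" by (intro mult_left_mono y \<kappa>0)
    finally show ?thesis by simp
  qed
  have "\<phi> (tree_op y) = (\<Sum>m\<in>M. \<phi> (unit_vec m) * func m y)"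
    using normers_expand[OF \<phi> finM, of "tree_op y"] by (auto simp: M_def)
  also have "\<dots> \<le> (\<Sum>m\<in>M. c m * \<bar>func m y\<bar>)"
    by (intro sum_mono) (simp add: c_def flip: abs_mult)
  also have "\<dots> \<le> (\<Sum>m\<in>M. rest m + c m * main m)" by (intro sum_mono pointwise)
  also have "\<dots> = sum rest M + (\<Sum>m\<in>M. c m * main m)" by (rule sum.distrib)
  also have "\<dots> \<le> \<kappa> + 6 * (1/2) ^ i0" using rest main by linarith
  finally show "\<phi> (tree_op y) \<le> \<kappa> + 6 * (1/2) ^ i0" .
qed

text \<open>If every coordinate of \<open>tree_op y\<close> is below
  \<open>norm y * \<delta> i0\<close>, the previous estimate applies to the normalized
  \<open>y\<close>. Otherwise \<open>norm y\<close> itself is at most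
  \<open>s / \<delta> i0\<close>, and contractivity suffices.\<close>

lemma norm_tree_op_le_sup:
  assumes "0 < \<epsilon>"
  shows "\<exists>K\<ge>0. \<forall>y s. (\<forall>m. \<bar>func m y\<bar> \<le> s) \<longrightarrow> norm (tree_op y) \<le> \<epsilon> * norm y + K * s"
proof -
  obtain i1 where i1: "\<And>i. i1 \<le> i \<Longrightarrow> C i (p i) < \<epsilon> / 2"
    using order_tendstoD(2)[OF C_p_tendsto_0, of "\<epsilon> / 2"] assms by (auto simp: eventually_sequentially)
  obtain k where k: "(1/2) ^ k < \<epsilon> / 12" using real_arch_pow_inv[of "\<epsilon> / 12" "1/2"] assms by auto
  define i0 where "i0 = max i1 k"
  have "(1/2) ^ i0 \<le> (1/2 :: real) ^ k" by (intro power_decreasing) (auto simp: i0_def)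
  then have le: "\<epsilon> / 2 + 6 * (1/2) ^ i0 \<le> \<epsilon>" using k by linarith
  have "norm (tree_op y) \<le> \<epsilon> * norm y + 1 / \<delta> i0 * s" if s: "\<forall>m. \<bar>func m y\<bar> \<le> s" for y s
  proof (cases "\<forall>m. \<bar>func m y\<bar> < norm y * \<delta> i0")
    case True
    then have r: "0 < norm y" using \<delta>_pos[of i0] by (metis abs_ge_zero le_less_trans zero_less_mult_pos2)
    define z where "z = (1 / norm y) *\<^sub>R y"
    have f: "func m z = func m y / norm y" for m
      using arg_cong[OF linear_scale[OF linear_tree_op, of "1 / norm y" y], of "\<lambda>x. coord x m"]
      by (simp add: z_def)
    have "norm (tree_op z) \<le> \<epsilon> / 2 + 6 * (1/2) ^ i0"
    proof (rule norm_tree_op_small)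
      show "norm z \<le> 1" using r by (simp add: z_def)
      show "\<bar>func m z\<bar> < \<delta> i0" for m using True r by (simp add: f field_simps)
      show "i0 \<le> i \<Longrightarrow> C i (p i) \<le> \<epsilon> / 2" for i using i1[of i] by (simp add: i0_def)
    qed
    moreover have "norm (tree_op z) = norm (tree_op y) / norm y"
      by (simp add: z_def linear_scale[OF linear_tree_op])
    ultimately have "norm (tree_op y) / norm y \<le> \<epsilon>" using le by linarith
    then have "norm (tree_op y) \<le> \<epsilon> * norm y" using r by (simp add: pos_divide_le_eq)
    moreover have "0 \<le> s" using s[rule_format, of 0] by simp
    ultimately show ?thesis using \<delta>_pos[of i0] by (simp add: add_increasing2)
  next
    case False
    then obtain m where "norm y * \<delta> i0 \<le> \<bar>func m y\<bar>" by (auto simp: not_less)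
    then have "norm y * \<delta> i0 \<le> s" using s order_trans by blast
    then have "norm y \<le> 1 / \<delta> i0 * s" using \<delta>_pos[of i0] by (simp add: field_simps)
    moreover have "0 \<le> \<epsilon> * norm y" using assms by simp
    ultimately show ?thesis using norm_tree_op_le[of y] by linarith
  qed
  then show ?thesis using \<delta>_pos[of i0] by (intro exI[of _ "1 / \<delta> i0"]) auto
qed

section \<open>Dual vectors and preimages of the unit vectors\<close>

lemma W_support: "P i \<le> j \<Longrightarrow> coord (W i) j = 0"
proof (induction i arbitrary: j)
  case 0
  then show ?case by (simp add: W_0 P_0 coord_unit_vec)
next
  case (Suc i)
  have "P i \<le> collapse (p i) (n i) j"
    using Suc.prems p_less[of i] n_ge_2[of i] by (auto simp: collapse_def P_Suc)
  then show ?case using Suc.IH by (simp add: W_Suc coord_expand_vec)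
qed

text \<open>A replacement divides the coefficient by \<open>slog n\<close> and multiplies the dual
  coordinate by \<open>slog n / n\<close>, on \<open>n\<close> children, so the pairing keeps its
  initial value 1.\<close>

lemma sum_C_W: "(\<Sum>j<P i. C i j * coord (W i) j) = 1"
proof (induction i)
  case 0
  then show ?case by (simp add: P_0 C_0 W_0 coord_unit_vec)
next
  case (Suc i)
  define h where "h j = C (Suc i) j * coord (W (Suc i)) j" for j
  have "(\<Sum>j<P (Suc i). h j) = (\<Sum>j\<in>(\<Union>q\<in>{..<P i}. leaves i 1 q). h j)"
    by (rule sum.cong) (use collapse_less in \<open>auto simp: leaves_def\<close>)
  also have "\<dots> = (\<Sum>q<P i. sum h (leaves i 1 q))"
    by (rule sum.UNION_disjoint) (use disjoint_leaves in auto)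
  also have "\<dots> = (\<Sum>q<P i. C i q * coord (W i) q)"
  proof (rule sum.cong[OF refl])
    fix q assume q: "q \<in> {..<P i}"
    show "sum h (leaves i 1 q) = C i q * coord (W i) q"
    proof (cases "q = p i")
      case True
      have "sum h (leaves i 1 q) = (\<Sum>j\<in>leaves i 1 q. C i q * coord (W i) q / real (n i))"
      proof (rule sum.cong[OF refl])
        fix j assume "j \<in> leaves i 1 q"
        then have "collapse (p i) (n i) j = p i" using True by (simp add: leaves_def)
        then show "h j = C i q * coord (W i) q / real (n i)"
          using slog_n_gt_1[of i] True by (simp add: h_def C_Suc W_Suc coord_expand_vec)
      qed
      also have "\<dots> = C i q * coord (W i) q"
        using n_ge_2[of i] unfolding True leaves_1_p by simp
      finally show ?thesis .
    next
      case False
      then obtain r where r: "leaves i 1 q = {r}" using leaves_1_other[of q i] q by auto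
      then have "r \<in> leaves i 1 q" by blast
      then have "collapse (p i) (n i) r = q" by (simp add: leaves_def)
      then show ?thesis unfolding r using False by (simp add: h_def C_Suc W_Suc coord_expand_vec)
    qed
  qed
  finally show ?case using Suc.IH by (simp add: h_def)
qed

text \<open>The dual vector of \<open>stage m\<close>, moved to block \<open>m\<close>, is paired to
  1 by \<open>func m\<close> and misses the blocks of all other functionals.\<close>

lemma exists_preimage_unit_vec: "\<exists>y. norm y \<le> 3 \<and> tree_op y = unit_vec m"
proof -
  define w where "w = W (stage m)"
  define g where "g k = (if offset m \<le> k then coord w (k - offset m) else 0)" for k
  obtain b where b: "\<forall>i\<ge>b. coord w i = 0" using coord_bounded by blast
  have "{k. g k \<noteq> 0} \<subseteq> {..offset m + b}"
    using b by (auto simp: g_def split: if_splits) (metis le_diff_conv2 nle_le add.commute)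
  then have fin: "finite {k. g k \<noteq> 0}" by (rule finite_subset) simp
  define y where "y = Abs_c00 g"
  have cy: "coord y k = g k" for k by (simp add: y_def coord_Abs_c00[OF fin])
  \<comment> \<open>Translation to the right does not increase the norm: coordinate \<open>k\<close>
    of \<open>y\<close> is matched with a singleton for \<open>w\<close>, and with the empty set
    before the block, where \<open>y\<close> vanishes.\<close>
  define I where "I k = (if offset m \<le> k then {k - offset m} else {})" for k
  have "norm y \<le> norm w"
  proof (rule norm_le_of_ordered_sets)
    show "ordered_sets UNIV I" by (auto simp: ordered_sets_def set_less_def I_def)
    show "\<bar>coord y k\<bar> \<le> norm (restr (I k) w)" for k
      using abs_coord_le_norm[of "restr (I k) w" "k - offset m"]
      by (auto simp: cy g_def I_def coord_restr)
  qed
  then have "norm y \<le> 3" using norm_W_le[of "stage m"] by (simp add: w_def)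
  moreover have "func k y = (if k = m then 1 else 0)" for k
  proof (cases "k = m")
    case True
    then show ?thesis using sum_C_W[of "stage m"] by (simp add: func_def cy g_def w_def)
  next
    case False
    have "coord y (offset k + j) = 0" if "j < P (stage k)" for j
    proof (rule ccontr)
      assume ne: "coord y (offset k + j) \<noteq> 0"
      then have "offset m \<le> offset k + j" "offset k + j - offset m < P (stage m)"
        using W_support[of "stage m" "offset k + j - offset m"]
        by (auto simp: cy g_def w_def not_le[symmetric] split: if_splits)
      then have "offset k + j \<in> block m" by (auto simp: block_def)
      moreover have "offset k + j \<in> block k" using that by (auto simp: block_def)
      ultimately show False using block_disjoint[OF False] by blast
    qed
    then show ?thesis using False by (simp add: func_def)
  qed
  then have "tree_op y = unit_vec m" by (intro c00_eqI) (simp add: coord_unit_vec)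
  ultimately show ?thesis by blast
qed

end

section \<open>Existence of the tree and passage to the completion\<close>

lemma slog_eventually_less:
  assumes "0 < \<delta>"
  shows "\<exists>N. \<forall>x\<ge>N. slog (real x) < real x * \<delta>"
proof -
  obtain N :: nat where N: "(8 / \<delta>)\<^sup>2 < real N" using reals_Archimedean2 by blast
  have "slog (real x) < real x * \<delta>" if x: "max 1 N \<le> x" for x
  proof -
    have x1: "1 \<le> real x" using x by simp
    have "(8 / \<delta>)\<^sup>2 < real x" using N x by simp
    then have sx: "8 / \<delta> < sqrt (real x)" by (rule real_less_rsqrt)
    have "slog (real x) \<le> log 2 ((2 * sqrt (real x))\<^sup>2)"
      unfolding slog_def using x1 by (subst log_le_cancel_iff) (auto simp: power_mult_distrib)
    also have "\<dots> = 2 * log 2 (2 * sqrt (real x))" using x1 by (subst log_nat_power) auto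
    also have "\<dots> \<le> 2 * (2 * (2 * sqrt (real x)))"
      using x1 by (intro mult_left_mono log2_le) auto
    also have "\<dots> = (8 / \<delta>) * (sqrt (real x) * \<delta>)" using assms by simp
    also have "\<dots> < sqrt (real x) * (sqrt (real x) * \<delta>)"
      using sx assms x1 by (intro mult_strict_right_mono) auto
    also have "\<dots> = real x * \<delta>" using x1 by (simp flip: mult.assoc)
    finally show ?thesis .
  qed
  then show ?thesis by blast
qed

lemma exists_stages: "\<exists>P p n C W. stages P p n C W"
proof -
  define pos where "pos = (\<lambda>(P::nat, C::nat \<Rightarrow> real, w::c00). SOME p. p < P \<and> (\<forall>q<P. C q \<le> C p))"
  define nxt where "nxt = (\<lambda>(P::nat, C::nat \<Rightarrow> real, w::c00) p n. (P + n - 1,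
     \<lambda>j. C (collapse p n j) / (if collapse p n j = p then slog (real n) else 1), expand_vec p n w))"
  \<comment> \<open>The bound starts at 1, the norm of the first unit vector, and grows by
    \<open>(1/2) ^ i\<close> at stage \<open>i\<close>, which is what \<open>good\<close>
    allows.\<close>
  define ok where "ok = (\<lambda>i (P::nat, C::nat \<Rightarrow> real, w::c00). 0 < P \<and> norm w \<le> 3 - 2 * (1/2) ^ i)"
  define good where "good = (\<lambda>i st n. 2 \<le> n \<and> i \<le> n \<and> fst st \<le> n \<and>
     (\<forall>x\<ge>n. slog (real x) < real x * level_delta i (fst st)) \<and>
     norm (expand_vec (pos st) n (snd (snd st))) \<le> norm (snd (snd st)) + (1/2) ^ i)"
  have ex_good: "\<exists>n. good i st n" if "ok i st" for i st
  proof -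
    obtain P C w where st: "st = (P, C, w)" by (cases st)
    have "0 < level_eta i P" using that by (simp add: ok_def st level_eta_def)
    then have "0 < level_delta i P"
      by (auto simp: level_delta_def intro!: divide_pos_pos add_nonneg_pos)
    then obtain N1 where N1: "\<forall>x\<ge>N1. slog (real x) < real x * level_delta i P"
      using slog_eventually_less by blast
    obtain N2 where N2: "\<forall>n\<ge>N2. norm (expand_vec (pos st) n w) \<le> norm w + (1/2) ^ i"
      using norm_expand_vec_le[of "(1/2) ^ i" "pos st" w] by auto
    show ?thesis using N1 N2 unfolding good_def
      by (intro exI[of _ "Max {2, i, P, N1, N2}"]) (auto simp: st)
  qed
  define st where "st = rec_nat (1, \<lambda>_. 1, unit_vec 0) (\<lambda>i s. nxt s (pos s) (SOME n. good i s n))"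
  define n where "n i = (SOME n. good i (st i) n)" for i
  define p where "p i = pos (st i)" for i
  have st0: "st 0 = (1, \<lambda>_. 1, unit_vec 0)" by (simp add: st_def)
  have stS: "st (Suc i) = nxt (st i) (p i) (n i)" for i by (simp add: st_def p_def n_def)
  have ok: "ok i (st i)" for i
  proof (induction i)
    case 0
    then show ?case by (simp add: st0 ok_def)
  next
    case (Suc i)
    obtain P C w where s: "st i = (P, C, w)" by (cases "st i")
    have "good i (st i) (n i)" unfolding n_def using someI_ex[OF ex_good[OF Suc]] .
    then show ?case using Suc by (auto simp: good_def ok_def s stS nxt_def p_def)
  qed
  have good: "good i (st i) (n i)" for i unfolding n_def using someI_ex[OF ex_good[OF ok]] .
  have pos: "p i < fst (st i) \<and> (\<forall>q<fst (st i). fst (snd (st i)) q \<le> fst (snd (st i)) (p i))" for i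
  proof -
    obtain P C w where s: "st i = (P, C, w)" by (cases "st i")
    have "0 < P" using ok[of i] by (simp add: ok_def s)
    then have ne: "C ` {..<P} \<noteq> {}" by auto
    obtain p0 where "p0 < P" "C p0 = Max (C ` {..<P})"
      using Max_in[OF _ ne] by auto
    then have "\<exists>p. p < P \<and> (\<forall>q<P. C q \<le> C p)" by (intro exI[of _ p0]) simp
    from someI_ex[OF this] show ?thesis by (simp add: s p_def pos_def)
  qed
  have "stages (\<lambda>i. fst (st i)) p n (\<lambda>i. fst (snd (st i))) (\<lambda>i. snd (snd (st i)))"
  proof
    fix i
    obtain P C w where s: "st i = (P, C, w)" by (cases "st i")
    show "norm (snd (snd (st i))) \<le> 3"
    proof -
      have "norm w \<le> 3 - 2 * (1/2) ^ i" using ok[of i] by (simp add: ok_def s)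
      also have "\<dots> \<le> 3" by simp
      finally show ?thesis by (simp add: s)
    qed
    show "fst (st (Suc i)) = fst (st i) + n i - 1"
      "fst (snd (st (Suc i))) j = fst (snd (st i)) (collapse (p i) (n i) j) /
         (if collapse (p i) (n i) j = p i then slog (real (n i)) else 1)"
      "snd (snd (st (Suc i))) = expand_vec (p i) (n i) (snd (snd (st i)))" for j
      by (simp_all add: stS nxt_def s)
    show "n i \<le> x \<Longrightarrow> slog (real x) < real x * level_delta i (fst (st i))" for x
      using good[of i] by (simp add: good_def)
  qed (use good pos in \<open>auto simp: good_def st0\<close>)
  then show ?thesis by blast
qed

lemma extend_to_completion:
  fixes f :: "'a::real_normed_vector \<Rightarrow> 'b::banach"
  assumes f: "linear f" and le: "\<And>x. norm (f x) \<le> B * norm x"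
  shows "\<exists>F. bounded_linear F \<and> (\<forall>x. F (to_completion x) = f x)"
proof -
  have bl: "bounded_linear f"
    using le by (intro bounded_linear_intro[where K = B])
      (simp_all add: linear_add[OF f] linear_scale[OF f] mult.commute)
  have "\<exists>X. (\<lambda>k. to_completion (X k)) \<longlonglongrightarrow> z" for z :: "'a completion"
  proof -
    have "z \<in> closure (range to_completion)" by (simp add: closure_range_to_completion)
    then obtain Y where Y: "\<And>k. Y k \<in> range to_completion" "Y \<longlonglongrightarrow> z"
      unfolding closure_sequential by blast
    then have "\<exists>x. Y k = to_completion x" for k by blast
    then obtain X where "\<And>k. Y k = to_completion (X k)" by metis
    then have "Y = (\<lambda>k. to_completion (X k))" by blast
    then show ?thesis using Y(2) by auto
  qed
  then obtain S where S: "\<And>z :: 'a completion. (\<lambda>k. to_completion (S z k)) \<longlonglongrightarrow> z" by metis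
  define F where "F z = lim (\<lambda>k. f (S z k))" for z
  have FS: "(\<lambda>k. f (S z k)) \<longlonglongrightarrow> F z" for z
  proof -
    have "Cauchy (\<lambda>k. to_completion (S z k))" using LIMSEQ_imp_Cauchy[OF S] .
    then have "Cauchy (S z)" by (simp add: Cauchy_def dist_norm flip: to_completion_diff)
    then have "Cauchy (\<lambda>k. f (S z k))" by (rule bounded_linear.Cauchy[OF bl])
    then show ?thesis unfolding F_def using Cauchy_convergent_iff convergent_LIMSEQ_iff by blast
  qed
  \<comment> \<open>The limit does not depend on the approximating sequence; linearity follows by
    approximating sums and multiples termwise.\<close>
  have key: "(\<lambda>k. f (X k)) \<longlonglongrightarrow> F z" if X: "(\<lambda>k. to_completion (X k)) \<longlonglongrightarrow> z" for X z
  proof -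
    have "(\<lambda>k. to_completion (X k) - to_completion (S z k)) \<longlonglongrightarrow> 0"
      using tendsto_diff[OF X S[of z]] by simp
    then have "(\<lambda>k. X k - S z k) \<longlonglongrightarrow> 0"
      by (subst tendsto_norm_zero_iff[symmetric], subst (asm) tendsto_norm_zero_iff[symmetric])
        (simp flip: to_completion_diff)
    then have "(\<lambda>k. f (X k - S z k)) \<longlonglongrightarrow> 0" by (rule bounded_linear.tendsto_zero[OF bl])
    then have "(\<lambda>k. f (X k) - f (S z k)) \<longlonglongrightarrow> 0" by (simp add: linear_diff[OF f])
    from tendsto_add[OF this FS[of z]] show ?thesis by simp
  qed
  have "bounded_linear F"
  proof (rule bounded_linear_intro[where K = B])
    fix z z' :: "'a completion" and a :: real
    have "(\<lambda>k. f (S z k + S z' k)) \<longlonglongrightarrow> F (z + z')"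
      by (rule key) (simp add: linear_add[OF linear_to_completion] tendsto_add S)
    then show "F (z + z') = F z + F z'"
      using LIMSEQ_unique tendsto_add[OF FS FS, of z z'] by (simp add: linear_add[OF f])
    have "(\<lambda>k. f (a *\<^sub>R S z k)) \<longlonglongrightarrow> F (a *\<^sub>R z)"
      by (rule key) (simp add: linear_scale[OF linear_to_completion] tendsto_scaleR S)
    then show "F (a *\<^sub>R z) = a *\<^sub>R F z"
      using LIMSEQ_unique tendsto_scaleR[OF tendsto_const FS, of a z] by (simp add: linear_scale[OF f])
    have "(\<lambda>k. norm (S z k)) \<longlonglongrightarrow> norm z" using tendsto_norm[OF S, of z] by simp
    then have "(\<lambda>k. B * norm (S z k)) \<longlonglongrightarrow> B * norm z" by (intro tendsto_mult tendsto_const)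
    from tendsto_le[OF _ this tendsto_norm[OF FS]] show "norm (F z) \<le> norm z * B"
      using le by (simp add: mult.commute)
  qed
  moreover have "F (to_completion x) = f x" for x
    using key[of "\<lambda>_. x" "to_completion x"] by (simp add: LIMSEQ_const_iff)
  ultimately show ?thesis by blast
qed

section \<open>Coordinate functionals on the completion\<close>

lemma approx_completion:
  assumes "0 < e"
  shows "\<exists>x. norm (to_completion x - z) < e"
  using closure_approachable[of z "range to_completion"] assms
  by (auto simp: closure_range_to_completion dist_norm)

lemma exists_ccoord:
  "\<exists>c :: nat \<Rightarrow> schlumprecht \<Rightarrow> real. \<forall>i. bounded_linear (c i) \<and> (\<forall>x. c i (to_completion x) = coord x i)"
proof -
  have "\<exists>c :: schlumprecht \<Rightarrow> real. bounded_linear c \<and> (\<forall>x. c (to_completion x) = coord x i)" for i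
    by (rule extend_to_completion[where B = 1]) (auto intro: linearI simp: abs_coord_le_norm)
  then show ?thesis by metis
qed

definition ccoord :: "nat \<Rightarrow> schlumprecht \<Rightarrow> real" where
  "ccoord = (SOME c. \<forall>i. bounded_linear (c i) \<and> (\<forall>x. c i (to_completion x) = coord x i))"

lemma bounded_linear_ccoord: "bounded_linear (ccoord i)"
  and ccoord_to_completion [simp]: "ccoord i (to_completion x) = coord x i"
  using someI_ex[OF exists_ccoord] unfolding ccoord_def by blast+

lemma linear_ccoord: "linear (ccoord i)"
  using bounded_linear_ccoord bounded_linear.linear by blast

text \<open>On finitely supported vectors this is the bound for successive sets applied to
  singletons, and both sides are continuous. It yields the growth of the norm in the gliding hump
  argument.\<close>

lemma sum_abs_ccoord_le:
  assumes J: "finite J"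
  shows "(\<Sum>j\<in>J. \<bar>ccoord j z\<bar>) \<le> slog (real (card J)) * norm z"
proof -
  define S where "S = {z. (\<Sum>j\<in>J. \<bar>ccoord j z\<bar>) \<le> slog (real (card J)) * norm z}"
  have "closed S" unfolding S_def
    by (intro closed_Collect_le continuous_intros
        linear_continuous_on bounded_linear_ccoord)
  moreover have "range to_completion \<subseteq> S"
  proof
    fix z :: schlumprecht assume "z \<in> range to_completion"
    then obtain x where x: "z = to_completion x" by blast
    have "(\<Sum>j\<in>J. \<bar>coord x j\<bar>) \<le> (\<Sum>j\<in>J. norm (restr {j} x))"
    proof (rule sum_mono)
      show "\<bar>coord x j\<bar> \<le> norm (restr {j} x)" for j
        using abs_coord_le_norm[of "restr {j} x" j] by (simp add: coord_restr)
    qed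
    also have "\<dots> \<le> slog (real (card J)) * norm x"
      by (rule sum_norm_ordered_sets_le[OF J]) (auto simp: ordered_sets_def set_less_def)
    finally show "z \<in> S" by (simp add: S_def x)
  qed
  ultimately have "closure (range to_completion) \<subseteq> S" by (simp add: closure_minimal)
  then show ?thesis using closure_range_to_completion by (auto simp: S_def)
qed

lemma abs_ccoord_le_norm: "\<bar>ccoord i z\<bar> \<le> norm z"
  using sum_abs_ccoord_le[of "{i}" z] by simp

lemma ccoord_tendsto_0: "(\<lambda>i. ccoord i z) \<longlonglongrightarrow> 0"
proof (rule LIMSEQ_I)
  fix e :: real assume "0 < e"
  then obtain x where x: "norm (to_completion x - z) < e" using approx_completion by blast
  obtain b where b: "\<forall>i\<ge>b. coord x i = 0" using coord_bounded by blast
  have "norm (ccoord i z - 0) < e" if "b \<le> i" for i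
    using abs_ccoord_le_norm[of i "to_completion x - z"] b x that
    by (simp add: linear_diff[OF linear_ccoord])
  then show "\<exists>no. \<forall>i\<ge>no. norm (ccoord i z - 0) < e" by blast
qed

text \<open>Each further functional costs at most one dimension: its kernel and one vector outside
  it span everything.\<close>

lemma infinite_dimensional_kernel:
  fixes f :: "nat \<Rightarrow> 'a::real_vector \<Rightarrow> real"
  assumes V: "subspace V" "infinite_dimensional V" and f: "\<And>i. linear (f i)"
  shows "subspace {v \<in> V. \<forall>i<M. f i v = 0} \<and> infinite_dimensional {v \<in> V. \<forall>i<M. f i v = 0}"
proof (induction M)
  case 0
  then show ?case using V by simp
next
  case (Suc M)
  define U where "U = {v \<in> V. \<forall>i<M. f i v = 0}"
  have U: "subspace U" "infinite_dimensional U" using Suc by (auto simp: U_def)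
  have eq: "{v \<in> V. \<forall>i<Suc M. f i v = 0} = {v \<in> U. f M v = 0}"
    by (auto simp: U_def less_Suc_eq)
  have "subspace {v \<in> U. f M v = 0}"
    using U(1) by (auto simp: subspace_def linear_0[OF f] linear_add[OF f] linear_scale[OF f])
  moreover have "infinite_dimensional {v \<in> U. f M v = 0}"
    unfolding infinite_dimensional_def
  proof
    assume "\<exists>B. finite B \<and> {v \<in> U. f M v = 0} \<subseteq> span B"
    then obtain B where B: "finite B" "{v \<in> U. f M v = 0} \<subseteq> span B" by blast
    show False
    proof (cases "\<forall>v\<in>U. f M v = 0")
      case True
      then have "{v \<in> U. f M v = 0} = U" by blast
      then show False using B U(2) by (auto simp: infinite_dimensional_def)
    next
      case False
      then obtain u where u: "u \<in> U" "f M u \<noteq> 0" by blast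
      have "U \<subseteq> span (insert u B)"
      proof
        fix v assume v: "v \<in> U"
        define a where "a = f M v / f M u"
        have "v - a *\<^sub>R u \<in> U" using U(1) u v by (simp add: subspace_diff subspace_scale)
        moreover have "f M (v - a *\<^sub>R u) = 0"
          using u(2) by (simp add: linear_diff[OF f] linear_scale[OF f] a_def)
        ultimately have "v - a *\<^sub>R u \<in> span B" using B by blast
        then show "v \<in> span (insert u B)" unfolding span_insert by blast
      qed
      then show False using B(1) U(2) by (auto simp: infinite_dimensional_def)
    qed
  qed
  ultimately show ?case unfolding eq by blast
qed

text \<open>Gliding hump: the sum of \<open>N\<close> almost disjoint vectors of sup norm one has norm at least about
  \<open>N / slog N\<close>.\<close>

lemma sup_norm_not_equivalent:
  fixes T :: "schlumprecht \<Rightarrow> schlumprecht"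
  assumes T: "linear T" and V: "subspace V" "infinite_dimensional V"
    and le: "\<And>v s. v \<in> V \<Longrightarrow> (\<And>m. \<bar>ccoord m (T v)\<bar> \<le> s) \<Longrightarrow> norm v \<le> K * s"
    and nT: "\<And>v. norm (T v) \<le> norm v"
  shows False
proof -
  have lin: "linear (\<lambda>v. ccoord m (T v))" for m
    using linear_compose[OF T linear_ccoord] by (simp add: o_def)
  \<comment> \<open>The bounds survive adding a vector \<open>u\<close> that vanishes before
    \<open>M\<close> and has sup norm 1: before \<open>M\<close> only \<open>v\<close> counts, and
    from \<open>M\<close> on \<open>v\<close> is below 1/2.\<close>
  have "\<exists>v\<in>V. \<exists>J. finite J \<and> card J = N \<and> (\<forall>j\<in>J. 1/2 < \<bar>ccoord j (T v)\<bar>) \<and> (\<forall>m. \<bar>ccoord m (T v)\<bar> < 2)" for N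
  proof (induction N)
    case 0
    have "T 0 = 0" "\<And>m. ccoord m 0 = 0" using linear_0[OF T] linear_0[OF linear_ccoord] by auto
    then show ?case using subspace_0[OF V(1)] by (intro bexI[of _ 0] exI[of _ "{}"]) auto
  next
    case (Suc N)
    then obtain v J where v: "v \<in> V" and J: "finite J" "card J = N"
      and big: "\<And>j. j \<in> J \<Longrightarrow> 1/2 < \<bar>ccoord j (T v)\<bar>" and bd: "\<And>m. \<bar>ccoord m (T v)\<bar> < 2" by blast
    obtain M1 where M1: "\<And>m. M1 \<le> m \<Longrightarrow> \<bar>ccoord m (T v)\<bar> < 1/2"
      using LIMSEQ_D[OF ccoord_tendsto_0, of "1/2" "T v"] by auto
    obtain M2 where M2: "\<And>j. j \<in> J \<Longrightarrow> j < M2"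
      using J(1) finite_nat_iff_bounded[of J] by auto
    define M where "M = max M1 M2"
    define U where "U = {v \<in> V. \<forall>i<M. ccoord i (T v) = 0}"
    have U: "subspace U" "infinite_dimensional U"
      using infinite_dimensional_kernel[OF V, of "\<lambda>m v. ccoord m (T v)" M] lin by (auto simp: U_def)
    have "\<not> U \<subseteq> span {}" using U(2) unfolding infinite_dimensional_def by blast
    then obtain u0 where u0: "u0 \<in> U" "u0 \<noteq> 0" by auto
    have u0V: "u0 \<in> V" using u0 by (simp add: U_def)
    \<comment> \<open>Otherwise the hypothesis with \<open>s = 0\<close> would give
      \<open>u0 = 0\<close>.\<close>
    have "\<exists>m. ccoord m (T u0) \<noteq> 0"
      using le[OF u0V, of 0] u0(2) by force
    then obtain m0 where m0: "ccoord m0 (T u0) \<noteq> 0" by blast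
    \<comment> \<open>Since the coordinates tend to 0, only finitely many reach the size of
      coordinate \<open>m0\<close>, so the maximum is attained at some \<open>j\<close>.\<close>
    define A where "A = {m. \<bar>ccoord m0 (T u0)\<bar> \<le> \<bar>ccoord m (T u0)\<bar>}"
    have finA: "finite A"
    proof -
      obtain M3 where M3: "\<And>m. M3 \<le> m \<Longrightarrow> \<bar>ccoord m (T u0)\<bar> < \<bar>ccoord m0 (T u0)\<bar>"
        using LIMSEQ_D[OF ccoord_tendsto_0, of "\<bar>ccoord m0 (T u0)\<bar>" "T u0"] m0 by auto
      have "A \<subseteq> {..<M3}" using M3 by (force simp: A_def not_le[symmetric])
      then show ?thesis by (rule finite_subset) simp
    qed
    have neA: "A \<noteq> {}" by (auto simp: A_def)
    define g where "g m = \<bar>ccoord m (T u0)\<bar>" for m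
    have "Max (g ` A) \<in> g ` A" using finA neA by (intro Max_in) auto
    then obtain j where j: "j \<in> A" "g j = Max (g ` A)" by auto
    have jA: "g m \<le> g j" if "m \<in> A" for m using that finA j(2) by simp
    have jmax: "\<bar>ccoord m (T u0)\<bar> \<le> \<bar>ccoord j (T u0)\<bar>" for m
      using j(1) jA[of m] by (cases "m \<in> A") (auto simp: A_def g_def)
    have j0: "0 < \<bar>ccoord j (T u0)\<bar>" using jmax[of m0] m0 by simp
    define u where "u = (1 / \<bar>ccoord j (T u0)\<bar>) *\<^sub>R u0"
    have cu: "ccoord m (T u) = ccoord m (T u0) / \<bar>ccoord j (T u0)\<bar>" for m
      using linear_scale[OF lin, of m] by (simp add: u_def)
    have uU: "u \<in> U" using U(1) u0(1) by (simp add: u_def subspace_scale)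
    have u1: "\<bar>ccoord m (T u)\<bar> \<le> 1" for m using jmax[of m] j0 by (simp add: cu)
    have uj: "\<bar>ccoord j (T u)\<bar> = 1" using j0 by (simp add: cu)
    have u0': "ccoord m (T u) = 0" if "m < M" for m using uU that by (simp add: U_def)
    have jM: "M \<le> j" using u0'[of j] uj by (cases "j < M") auto
    have add: "ccoord m (T (v + u)) = ccoord m (T v) + ccoord m (T u)" for m
      using linear_add[OF lin] .
    have "v + u \<in> V" using v uU V(1) by (simp add: U_def subspace_add)
    moreover have "card (insert j J) = Suc N"
    proof -
      have "j \<notin> J" using M2[of j] jM by (auto simp: M_def)
      then show ?thesis using J by simp
    qed
    moreover have "1/2 < \<bar>ccoord i (T (v + u))\<bar>" if "i \<in> insert j J" for i
    proof (cases "i = j")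
      case True
      have "\<bar>ccoord j (T v)\<bar> < 1/2" using M1[of j] jM by (simp add: M_def)
      then show ?thesis unfolding True add using uj by linarith
    next
      case False
      then show ?thesis using that big[of i] u0'[of i] M2[of i] by (simp add: add M_def)
    qed
    moreover have "\<bar>ccoord m (T (v + u))\<bar> < 2" for m
    proof (cases "m < M")
      case True
      then show ?thesis using bd[of m] u0' by (simp add: add)
    next
      case False
      then have "\<bar>ccoord m (T v)\<bar> < 1/2" using M1[of m] by (simp add: M_def)
      then show ?thesis unfolding add using u1[of m] by linarith
    qed
    ultimately show ?case using J(1) by (intro bexI[of _ "v + u"] exI[of _ "insert j J"]) auto
  qed
  note hump = this
  \<comment> \<open>The threshold makes \<open>2 * slog N0 * (\<bar>K\<bar> + 1)\<close> less than
    \<open>N0 / 2\<close>, the lower bound for the sum of the coordinates in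
    \<open>J\<close>.\<close>
  obtain N0 where N0: "\<forall>x\<ge>N0. slog (real x) < real x * (1 / (4 * (\<bar>K\<bar> + 1)))"
    using slog_eventually_less[of "1 / (4 * (\<bar>K\<bar> + 1))"] by (auto simp: add_nonneg_pos)
  obtain v J where v: "v \<in> V" and J: "finite J" "card J = N0"
    and big: "\<And>j. j \<in> J \<Longrightarrow> 1/2 < \<bar>ccoord j (T v)\<bar>" and bd: "\<And>m. \<bar>ccoord m (T v)\<bar> < 2"
    using hump[of N0] by blast
  have "real N0 * (1/2) = (\<Sum>j\<in>J. 1/2)" by (simp add: J)
  also have "\<dots> \<le> (\<Sum>j\<in>J. \<bar>ccoord j (T v)\<bar>)" using big by (intro sum_mono) (simp add: less_imp_le)
  also have "\<dots> \<le> slog (real N0) * norm (T v)" using sum_abs_ccoord_le[OF J(1)] J(2) by simp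
  also have "\<dots> \<le> slog (real N0) * (K * 2)"
    using le[OF v, of 2] bd nT[of v] by (intro mult_left_mono) (auto simp: slog_def less_imp_le intro: order_trans)
  also have "\<dots> \<le> slog (real N0) * ((\<bar>K\<bar> + 1) * 2)"
    by (intro mult_left_mono) (auto simp: slog_def)
  also have "\<dots> < (real N0 * (1 / (4 * (\<bar>K\<bar> + 1)))) * ((\<bar>K\<bar> + 1) * 2)"
    using N0 by (intro mult_strict_right_mono) (auto simp: add_nonneg_pos)
  also have "\<dots> = real N0 * (1/2)" by (simp add: divide_simps)
  finally show False by simp
qed

theorem theorem1p2:
  shows "\<exists>T :: schlumprecht \<Rightarrow> schlumprecht.
           bounded_linear T \<and> strictly_singular T \<and> \<not> compact_operator T"
proof -
  obtain P p n C W where "stages P p n C W" using exists_stages by blast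
  then interpret stages P p n C W .
  have "linear (\<lambda>y. to_completion (tree_op y))"
    using linear_compose[OF linear_tree_op linear_to_completion] by (simp add: o_def)
  then obtain T :: "schlumprecht \<Rightarrow> schlumprecht"
    where bl: "bounded_linear T" and T: "\<And>y. T (to_completion y) = to_completion (tree_op y)"
    using extend_to_completion[of "\<lambda>y. to_completion (tree_op y)" 1] norm_tree_op_le by auto
  have lin: "linear T" using bl bounded_linear.linear by blast
  have nT: "norm (T v) \<le> norm v" for v
  proof -
    have "closed {v. norm (T v) \<le> norm v}"
      by (intro closed_Collect_le continuous_intros linear_continuous_on bl)
    then have "closure (range to_completion) \<subseteq> {v. norm (T v) \<le> norm v}"
      by (intro closure_minimal) (auto simp: T norm_tree_op_le)
    then show ?thesis using closure_range_to_completion by auto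
  qed
  have small: "\<exists>K\<ge>0. \<forall>v s. (\<forall>m. \<bar>ccoord m (T v)\<bar> \<le> s) \<longrightarrow> norm (T v) \<le> \<epsilon> * norm v + K * s" if \<epsilon>: "0 < \<epsilon>" for \<epsilon>
  proof -
    obtain K where K: "0 \<le> K" "\<And>y s. (\<And>m. \<bar>func m y\<bar> \<le> s) \<Longrightarrow> norm (tree_op y) \<le> \<epsilon> * norm y + K * s"
      using norm_tree_op_le_sup[OF \<epsilon>] by blast
    have "norm (T v) \<le> \<epsilon> * norm v + K * s" if s: "\<And>m. \<bar>ccoord m (T v)\<bar> \<le> s" for v s
    proof (rule field_le_epsilon)
      fix e :: real assume e: "0 < e"
      \<comment> \<open>Approximating \<open>v\<close> within \<open>\<tau>\<close> costs
        \<open>\<tau> * \<epsilon>\<close> in the first term, \<open>\<tau> * K\<close> in the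
        second and \<open>\<tau>\<close> on the left.\<close>
      define \<tau> where "\<tau> = e / (\<epsilon> + K + 1)"
      have \<tau>: "0 < \<tau>" "\<tau> * (\<epsilon> + K + 1) = e" using e \<epsilon> K(1) by (auto simp: \<tau>_def)
      obtain y where y: "norm (to_completion y - v) < \<tau>" using approx_completion[OF \<tau>(1)] by blast
      have Ty: "norm (to_completion (tree_op y) - T v) \<le> \<tau>"
        using nT[of "to_completion y - v"] y by (simp add: linear_diff[OF lin] T)
      have "\<bar>func m y\<bar> \<le> s + \<tau>" for m
        using abs_ccoord_le_norm[of m "to_completion (tree_op y) - T v"] Ty s[of m]
        by (simp add: linear_diff[OF linear_ccoord])
      then have "norm (tree_op y) \<le> \<epsilon> * norm y + K * (s + \<tau>)" by (rule K(2))
      also have "\<dots> \<le> \<epsilon> * (norm v + \<tau>) + K * (s + \<tau>)"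
        using norm_triangle_ineq2[of "to_completion y" v] y \<epsilon>
        by (intro add_right_mono mult_left_mono) auto
      finally have "norm (tree_op y) + \<tau> \<le> \<epsilon> * norm v + K * s + \<tau> * (\<epsilon> + K + 1)"
        by (simp add: algebra_simps)
      moreover have "norm (T v) \<le> norm (tree_op y) + \<tau>"
        using norm_triangle_ineq2[of "T v" "to_completion (tree_op y)"] Ty by (simp add: norm_minus_commute)
      ultimately show "norm (T v) \<le> \<epsilon> * norm v + K * s + e" using \<tau>(2) by simp
    qed
    then show ?thesis using K(1) by blast
  qed
  have "strictly_singular T"
    unfolding strictly_singular_def
  proof
    assume "\<exists>V. subspace V \<and> infinite_dimensional V \<and> (\<exists>T'. homeomorphism V (T ` V) T T')"
    then obtain V T' where V: "subspace V" "infinite_dimensional V" and h: "homeomorphism V (T ` V) T T'" by blast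
    have T'T: "T' (T v) = v" if "v \<in> V" for v using h that by (simp add: homeomorphism_def)
    have T'0: "T' 0 = 0" using T'T[OF subspace_0[OF V(1)]] linear_0[OF lin] by simp
    have "continuous_on (T ` V) T'" using h by (simp add: homeomorphism_def)
    moreover have z: "0 \<in> T ` V" using subspace_0[OF V(1)] linear_0[OF lin] by force
    ultimately obtain d where d: "0 < d" "\<And>w. w \<in> T ` V \<Longrightarrow> norm w < d \<Longrightarrow> norm (T' w) < 1"
      unfolding continuous_on_iff using T'0 by (metis (no_types, lifting) dist_norm diff_zero zero_less_one)
    define \<gamma> where "\<gamma> = d / 2"
    have \<gamma>: "0 < \<gamma>" using d by (simp add: \<gamma>_def)
    \<comment> \<open>By continuity of \<open>T'\<close> at 0, a normalized vector of
      \<open>V\<close> whose image has norm below \<open>d\<close> would itself have norm below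
      1.\<close>
    have lower: "\<gamma> * norm v \<le> norm (T v)" if v: "v \<in> V" for v
    proof (rule ccontr)
      assume neg: "\<not> \<gamma> * norm v \<le> norm (T v)"
      then have v0: "0 < norm v" by (auto simp: linear_0[OF lin])
      define u where "u = (1 / norm v) *\<^sub>R v"
      have uV: "u \<in> V" using V(1) v by (simp add: u_def subspace_scale)
      have "norm (T v) * 2 < d * norm v" using neg by (simp add: \<gamma>_def)
      then have less: "norm (T v) < d * norm v" using norm_ge_zero[of "T v"] by linarith
      have "norm (T u) = norm (T v) / norm v" by (simp add: u_def linear_scale[OF lin])
      also have "\<dots> < d" using less v0 by (simp add: pos_divide_less_eq)
      finally have "norm (T' (T u)) < 1" using uV by (intro d(2)) auto
      then show False using v0 by (simp add: T'T[OF uV]) (simp add: u_def)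
    qed
    \<comment> \<open>With \<open>\<epsilon> = \<gamma> / 2\<close>, half of
      \<open>\<gamma> * norm v\<close> is absorbed, and the coordinates of \<open>T v\<close>
      control the norm on \<open>V\<close>.\<close>
    obtain K where K: "0 \<le> K" "\<And>v s. (\<And>m. \<bar>ccoord m (T v)\<bar> \<le> s) \<Longrightarrow> norm (T v) \<le> \<gamma> / 2 * norm v + K * s"
      using small[of "\<gamma> / 2"] \<gamma> by auto
    show False
    proof (rule sup_norm_not_equivalent[OF lin V _ nT])
      fix v s assume v: "v \<in> V" and s: "\<And>m. \<bar>ccoord m (T v)\<bar> \<le> s"
      have "\<gamma> * norm v \<le> \<gamma> / 2 * norm v + K * s" using lower[OF v] K(2)[OF s] by simp
      then show "norm v \<le> (2 * K / \<gamma>) * s" using \<gamma> by (simp add: field_simps)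
    qed
  qed
  moreover have "\<not> compact_operator T"
  proof
    assume "compact_operator T"
    then have c: "seq_compact (closure (T ` cball 0 1))"
      by (simp add: compact_operator_def compact_eq_seq_compact_metric)
    \<comment> \<open>These vectors are images of unit ball elements, because the unit vectors have
      preimages of norm at most 3, and the coordinate functionals keep them at least
      \<open>1/3\<close> apart.\<close>
    define w where "w m = (1/3) *\<^sub>R to_completion (unit_vec m)" for m
    have "w m \<in> closure (T ` cball 0 1)" for m
    proof -
      obtain y where y: "norm y \<le> 3" "tree_op y = unit_vec m" using exists_preimage_unit_vec by blast
      have "w m = T ((1/3) *\<^sub>R to_completion y)" by (simp add: w_def linear_scale[OF lin] T y)
      moreover have "(1/3) *\<^sub>R to_completion y \<in> cball 0 1" using y by simp
      ultimately have "w m \<in> T ` cball 0 1" by (rule image_eqI)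
      then show ?thesis by (rule subsetD[OF closure_subset])
    qed
    then obtain l r where "strict_mono r" and "(w \<circ> r) \<longlonglongrightarrow> l"
      using c unfolding seq_compact_def by metis
    then have "Cauchy (w \<circ> r)" using LIMSEQ_imp_Cauchy by blast
    then obtain N where N: "\<And>i j. N \<le> i \<Longrightarrow> N \<le> j \<Longrightarrow> dist (w (r i)) (w (r j)) < 1/3"
      using metric_CauchyD[of "w \<circ> r" "1/3"] by auto
    have ne: "r (Suc N) \<noteq> r N" using \<open>strict_mono r\<close> by (metis lessI less_irrefl strict_monoD)
    have "ccoord (r N) (w (r N) - w (r (Suc N))) = 1/3"
      using ne by (simp add: w_def linear_diff[OF linear_ccoord] linear_scale[OF linear_ccoord] coord_unit_vec)
    then have "1/3 \<le> dist (w (r N)) (w (r (Suc N)))"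
      using abs_ccoord_le_norm[of "r N" "w (r N) - w (r (Suc N))"] by (simp add: dist_norm)
    then show False using N[of N "Suc N"] by simp
  qed
  ultimately show ?thesis using bl by blast
qed

end
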